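(* Let $[a,b]\subset\mathbb{R}$ be a finite interval, $n\in\mathbb{N}\cup\{0\}$, $m,r\in\mathbb{N}$, $1\leq p\leq\infty$. Let $A_{r-\ell}\in(W_p^n)^{m\times m}$ for $\ell\in\{1,\dots,r\}$, let $B\colon(W_p^{n+r})^m\to\mathbb{C}^{rm}$ be an arbitrary continuous linear operator, and let $$(Ly)(t)=y^{(r)}(t)+\sum_{\ell=1}^{r}A_{r-\ell}(t)\,y^{(r-\ell)}(t),\qquad t\in(a,b).$$ Then the bounded linear operator $$(L,B)\colon(W_p^{n+r})^m\to(W_p^n)^m\oplus\mathbb{C}^{rm},\qquad y\mapsto(Ly,By),$$ is a Fredholm operator with index zero.
   Context: For $l\in\mathbb{N}$, $W_p^{l}=W_p^l([a,b];\mathbb{C})$ is the space of $y\in C^{l-1}([a,b];\mathbb{C})$ with $y^{(l-1)}$ absolutely continuous and $y^{(l)}\in L_p[a,b]$, with norm $\|y\|_{l,p}=\sum_{s=0}^{l}\|y^{(s)}\|_p$; $W_p^0:=L_p$. $(W_p^{l})^m$ and $(W_p^l)^{m\times m}$ are the spaces of $\mathbb{C}^m$-valued (column) and $\mathbb{C}^{m\times m}$-valued functions with entries in $W_p^l$, normed by the sum of the norms of the entries. A bounded linear operator $T\colon E_1\to E_2$ between Banach spaces is Fredholm if its kernel and cokernel $E_2/T(E_1)$ are finite-dimensional; its index is $\dim\ker T-\dim(E_2/T(E_1))$. *)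

theory Defs
  imports "HOL-Probability.Probability"
begin

section \<open>Complex vector spaces\<close>

class complex_vector = ab_group_add +
  fixes scaleC :: "complex \<Rightarrow> 'a \<Rightarrow> 'a" (infixr \<open>*\<^sub>C\<close> 75)
  assumes scaleC_add_right: "c *\<^sub>C (x + y) = c *\<^sub>C x + c *\<^sub>C y"
    and scaleC_add_left: "(c + d) *\<^sub>C x = c *\<^sub>C x + d *\<^sub>C x"
    and scaleC_scaleC: "c *\<^sub>C d *\<^sub>C x = (c * d) *\<^sub>C x"
    and scaleC_one: "1 *\<^sub>C x = x"

global_interpretation complex_vector: vector_space "scaleC :: complex \<Rightarrow> 'a \<Rightarrow> 'a::complex_vector"
  by unfold_locales (simp_all add: scaleC_add_right scaleC_add_left scaleC_scaleC scaleC_one)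

instantiation complex :: complex_vector
begin
definition scaleC_complex :: "complex \<Rightarrow> complex \<Rightarrow> complex"
  where "scaleC_complex c x = c * x"
instance by standard (simp_all add: scaleC_complex_def algebra_simps)
end

instantiation vec :: (complex_vector, finite) complex_vector
begin
definition scaleC_vec :: "complex \<Rightarrow> 'a ^ 'b \<Rightarrow> 'a ^ 'b"
  where "scaleC_vec c x = (\<chi> i. c *\<^sub>C x $ i)"
instance
  by standard (simp_all add: scaleC_vec_def vec_eq_iff scaleC_add_right scaleC_add_left
      scaleC_scaleC scaleC_one)
end

instantiation prod :: (complex_vector, complex_vector) complex_vector
begin
definition scaleC_prod :: "complex \<Rightarrow> 'a \<times> 'b \<Rightarrow> 'a \<times> 'b"
  where "scaleC_prod c x = (c *\<^sub>C fst x, c *\<^sub>C snd x)"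
instance
  by standard (simp_all add: scaleC_prod_def prod_eq_iff scaleC_add_right scaleC_add_left
      scaleC_scaleC scaleC_one)
end


section \<open>Fredholm operators\<close>

text \<open>
  Normed spaces are given by a carrier subspace \<open>E\<close> of some complex vector space together with a
  norm \<open>N\<close> on \<open>E\<close>; the values of \<open>N\<close> and of operators outside the carrier are irrelevant.
\<close>

definition bounded_linear_betw ::
  "'a::complex_vector set \<Rightarrow> ('a \<Rightarrow> real) \<Rightarrow> 'b::complex_vector set \<Rightarrow> ('b \<Rightarrow> real) \<Rightarrow> ('a \<Rightarrow> 'b) \<Rightarrow> bool"
  where "bounded_linear_betw E1 N1 E2 N2 T \<longleftrightarrow>
    T ` E1 \<subseteq> E2 \<and>
    (\<forall>x\<in>E1. \<forall>y\<in>E1. T (x + y) = T x + T y) \<and>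
    (\<forall>c. \<forall>x\<in>E1. T (c *\<^sub>C x) = c *\<^sub>C T x) \<and>
    (\<exists>K. \<forall>x\<in>E1. N2 (T x) \<le> K * N1 x)"

definition kernel_on :: "'a set \<Rightarrow> ('a \<Rightarrow> 'b::zero) \<Rightarrow> 'a set"
  where "kernel_on E1 T = {x \<in> E1. T x = 0}"

definition vcoset :: "'a::ab_group_add set \<Rightarrow> 'a \<Rightarrow> 'a set"
  where "vcoset U v = {v + u | u. u \<in> U}"

definition quotient_space :: "'a::ab_group_add set \<Rightarrow> 'a set \<Rightarrow> 'a set set"
  where "quotient_space V U = vcoset U ` V"

text \<open>
  The cosets of \<open>b 0, \<dots>, b (d - 1)\<close> form a basis of \<open>V / U\<close>; the linear combination of these cosets
  with coefficients \<open>c\<close> is the coset of the linear combination of the representatives.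
\<close>

definition quotient_basis ::
  "'a::complex_vector set \<Rightarrow> 'a set \<Rightarrow> nat \<Rightarrow> (nat \<Rightarrow> 'a) \<Rightarrow> bool"
  where "quotient_basis V U d b \<longleftrightarrow>
    (\<forall>i<d. b i \<in> V) \<and>
    (\<forall>X\<in>quotient_space V U. \<exists>!c. (\<forall>i\<ge>d. c i = 0) \<and> X = vcoset U (\<Sum>i<d. c i *\<^sub>C b i))"

definition quotient_finite_dim :: "'a::complex_vector set \<Rightarrow> 'a set \<Rightarrow> bool"
  where "quotient_finite_dim V U \<longleftrightarrow> (\<exists>d b. quotient_basis V U d b)"

definition quotient_dim :: "'a::complex_vector set \<Rightarrow> 'a set \<Rightarrow> nat"
  where "quotient_dim V U = (THE d. \<exists>b. quotient_basis V U d b)"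

definition fredholm ::
  "'a::complex_vector set \<Rightarrow> ('a \<Rightarrow> real) \<Rightarrow> 'b::complex_vector set \<Rightarrow> ('b \<Rightarrow> real) \<Rightarrow> ('a \<Rightarrow> 'b) \<Rightarrow> bool"
  where "fredholm E1 N1 E2 N2 T \<longleftrightarrow>
    bounded_linear_betw E1 N1 E2 N2 T \<and>
    (\<exists>S. finite S \<and> kernel_on E1 T \<subseteq> complex_vector.span S) \<and>
    quotient_finite_dim E2 (T ` E1)"

definition fredholm_index ::
  "'a::complex_vector set \<Rightarrow> 'b::complex_vector set \<Rightarrow> ('a \<Rightarrow> 'b) \<Rightarrow> int"
  where "fredholm_index E1 E2 T =
    int (complex_vector.dim (kernel_on E1 T)) - int (quotient_dim E2 (T ` E1))"

definition prod_norm :: "('a \<Rightarrow> real) \<Rightarrow> ('b \<Rightarrow> real) \<Rightarrow> 'a \<times> 'b \<Rightarrow> real"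
  where "prod_norm N1 N2 x = N1 (fst x) + N2 (snd x)"


section \<open>Complex functions modulo equality almost everywhere\<close>

text \<open>
  Functions on \<open>[a,b]\<close> are identified with their extensions by zero to the real line, so that one type
  serves all intervals.  Measurability is imposed in the definition of \<open>Lp\<close> below.
\<close>

quotient_type aefun = "real \<Rightarrow> complex" / "\<lambda>f g. AE t in lebesgue. f t = g t"
proof (rule equivpI)
  show "reflp (\<lambda>f g :: real \<Rightarrow> complex. AE t in lebesgue. f t = g t)"
    by (simp add: reflp_def)
  show "symp (\<lambda>f g :: real \<Rightarrow> complex. AE t in lebesgue. f t = g t)"
    by (auto simp: symp_def elim: eventually_mono)
  show "transp (\<lambda>f g :: real \<Rightarrow> complex. AE t in lebesgue. f t = g t)"
    by (auto simp: transp_def elim: eventually_elim2)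
qed

instantiation aefun :: comm_ring_1
begin
lift_definition zero_aefun :: aefun is "\<lambda>t. 0" .
lift_definition one_aefun :: aefun is "\<lambda>t. 1" .
lift_definition plus_aefun :: "aefun \<Rightarrow> aefun \<Rightarrow> aefun" is "\<lambda>f g t. f t + g t"
  by (auto elim: eventually_elim2)
lift_definition minus_aefun :: "aefun \<Rightarrow> aefun \<Rightarrow> aefun" is "\<lambda>f g t. f t - g t"
  by (auto elim: eventually_elim2)
lift_definition uminus_aefun :: "aefun \<Rightarrow> aefun" is "\<lambda>f t. - f t"
  by (auto elim: eventually_mono)
lift_definition times_aefun :: "aefun \<Rightarrow> aefun \<Rightarrow> aefun" is "\<lambda>f g t. f t * g t"
  by (auto elim: eventually_elim2)
instance
proof
  show "(0::aefun) \<noteq> 1"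
    by transfer (simp add: ae_filter_eq_bot_iff)
qed (transfer; simp add: algebra_simps)+
end

instantiation aefun :: complex_vector
begin
lift_definition scaleC_aefun :: "complex \<Rightarrow> aefun \<Rightarrow> aefun" is "\<lambda>c f t. c * f t"
  by (auto elim: eventually_mono)
instance by standard (transfer; simp add: algebra_simps)+
end

definition class_on :: "real \<Rightarrow> real \<Rightarrow> (real \<Rightarrow> complex) \<Rightarrow> aefun"
  where "class_on a b f = abs_aefun (\<lambda>t. if t \<in> {a..b} then f t else 0)"


section \<open>Lebesgue spaces on an interval\<close>

definition Lp_fun :: "ennreal \<Rightarrow> 'a measure \<Rightarrow> ('a \<Rightarrow> complex) \<Rightarrow> bool"
  where "Lp_fun p M f \<longleftrightarrow> f \<in> borel_measurable M \<and>
    (if p = \<infinity> then esssup M (\<lambda>t. ereal (norm (f t))) < \<infinity>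
     else integrable M (\<lambda>t. norm (f t) powr enn2real p))"

definition Lp_fun_norm :: "ennreal \<Rightarrow> 'a measure \<Rightarrow> ('a \<Rightarrow> complex) \<Rightarrow> real"
  where "Lp_fun_norm p M f =
    (if p = \<infinity> then real_of_ereal (esssup M (\<lambda>t. ereal (norm (f t))))
     else (\<integral>t. norm (f t) powr enn2real p \<partial>M) powr (1 / enn2real p))"

definition Lp :: "ennreal \<Rightarrow> real \<Rightarrow> real \<Rightarrow> aefun set"
  where "Lp p a b = {class_on a b f | f. Lp_fun p (lebesgue_on {a..b}) f}"

lemma Lp_fun_norm_AE_cong:
  assumes "AE t in lebesgue. f t = g t" and [measurable]: "S \<in> sets lebesgue"
  shows "Lp_fun_norm p (lebesgue_on S) f = Lp_fun_norm p (lebesgue_on S) g"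
proof -
  have ae: "AE t in lebesgue_on S. f t = g t" "AE t in lebesgue_on S. g t = f t"
    using assms by (auto simp: AE_restrict_space_iff elim: eventually_mono)
  have meas: "(\<lambda>t. h (f t)) \<in> borel_measurable (lebesgue_on S) \<longleftrightarrow>
      (\<lambda>t. h (g t)) \<in> borel_measurable (lebesgue_on S)" for h :: "complex \<Rightarrow> real"
  proof -
    have eq: "AE t in lebesgue. (if t \<in> S then h (f t) else 0) = (if t \<in> S then h (g t) else 0)"
      "AE t in lebesgue. (if t \<in> S then h (g t) else 0) = (if t \<in> S then h (f t) else 0)"
      using assms(1) by (auto elim: eventually_mono)
    have "(\<lambda>t. if t \<in> S then h (f t) else 0) \<in> borel_measurable lebesgue \<longleftrightarrow>
        (\<lambda>t. if t \<in> S then h (g t) else 0) \<in> borel_measurable lebesgue"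
      using borel_measurable_AE[OF _ eq(1)] borel_measurable_AE[OF _ eq(2)] by blast
    then show ?thesis
      by (simp add: borel_measurable_if)
  qed
  have emeas: "(\<lambda>t. ereal (norm (f t))) \<in> borel_measurable (lebesgue_on S) \<longleftrightarrow>
      (\<lambda>t. ereal (norm (g t))) \<in> borel_measurable (lebesgue_on S)"
    unfolding borel_measurable_ereal_iff by (rule meas)
  have "esssup (lebesgue_on S) (\<lambda>t. ereal (norm (f t))) = esssup (lebesgue_on S) (\<lambda>t. ereal (norm (g t)))"
    using emeas ae by (auto simp: esssup_def intro!: Limsup_eq elim: eventually_mono)
  moreover have "(\<integral>t. norm (f t) powr q \<partial>lebesgue_on S) = (\<integral>t. norm (g t) powr q \<partial>lebesgue_on S)" for q
  proof (cases "(\<lambda>t. norm (f t) powr q) \<in> borel_measurable (lebesgue_on S)")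
    case True
    with meas[of "\<lambda>z. norm z powr q"] ae show ?thesis
      by (intro integral_cong_AE) (auto elim: eventually_mono)
  next
    case False
    with meas[of "\<lambda>z. norm z powr q"] show ?thesis
      by (metis borel_measurable_integrable not_integrable_integral_eq)
  qed
  ultimately show ?thesis
    by (simp add: Lp_fun_norm_def)
qed

lift_definition Lp_norm :: "ennreal \<Rightarrow> real \<Rightarrow> real \<Rightarrow> aefun \<Rightarrow> real"
  is "\<lambda>p a b f. Lp_fun_norm p (lebesgue_on {a..b}) f"
  by (rule Lp_fun_norm_AE_cong) auto


section \<open>Sobolev spaces on an interval\<close>

definition absolutely_continuous_on :: "real \<Rightarrow> real \<Rightarrow> (real \<Rightarrow> complex) \<Rightarrow> bool"
  where "absolutely_continuous_on a b f \<longleftrightarrow>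
    (\<forall>\<epsilon>>0. \<exists>\<delta>>0. \<forall>(k::nat) u v.
      (\<forall>i<k. a \<le> u i \<and> u i \<le> v i \<and> v i \<le> b) \<longrightarrow>
      disjoint_family_on (\<lambda>i. {u i<..<v i}) {..<k} \<longrightarrow>
      (\<Sum>i<k. v i - u i) < \<delta> \<longrightarrow>
      (\<Sum>i<k. norm (f (v i) - f (u i))) < \<epsilon>)"

definition deriv_on :: "real \<Rightarrow> real \<Rightarrow> (real \<Rightarrow> complex) \<Rightarrow> real \<Rightarrow> complex"
  where "deriv_on a b y t = vector_derivative y (at t within {a..b})"

definition Ck_on :: "nat \<Rightarrow> real \<Rightarrow> real \<Rightarrow> (real \<Rightarrow> complex) \<Rightarrow> bool"
  where "Ck_on k a b y \<longleftrightarrow>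
    (\<forall>s<k. \<forall>t\<in>{a..b}. (deriv_on a b ^^ s) y differentiable (at t within {a..b})) \<and>
    (\<forall>s\<le>k. continuous_on {a..b} ((deriv_on a b ^^ s) y))"

text \<open>
  For \<open>l \<ge> 1\<close>; the top derivative exists only almost everywhere, and the values that
  \<^const>\<open>vector_derivative\<close> takes at the exceptional points do not affect its class.
\<close>

definition sobolev_fun :: "ennreal \<Rightarrow> nat \<Rightarrow> real \<Rightarrow> real \<Rightarrow> (real \<Rightarrow> complex) \<Rightarrow> bool"
  where "sobolev_fun p l a b y \<longleftrightarrow>
    Ck_on (l - 1) a b y \<and>
    absolutely_continuous_on a b ((deriv_on a b ^^ (l - 1)) y) \<and>
    (AE t in lebesgue_on {a..b}. (deriv_on a b ^^ (l - 1)) y differentiable (at t within {a..b})) \<and>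
    Lp_fun p (lebesgue_on {a..b}) ((deriv_on a b ^^ l) y)"

definition sobolev :: "ennreal \<Rightarrow> nat \<Rightarrow> real \<Rightarrow> real \<Rightarrow> aefun set"
  where "sobolev p l a b =
    (if l = 0 then Lp p a b else {class_on a b y | y. sobolev_fun p l a b y})"

text \<open>
  Derivatives of a class are computed from its continuous representative on \<open>[a,b]\<close>, which is unique
  when it exists and \<open>a < b\<close>.
\<close>

definition cont_rep :: "real \<Rightarrow> real \<Rightarrow> aefun \<Rightarrow> real \<Rightarrow> complex"
  where "cont_rep a b Y =
    (THE y. continuous_on {a..b} y \<and> (\<forall>t. t \<notin> {a..b} \<longrightarrow> y t = 0) \<and> class_on a b y = Y)"

definition nth_deriv :: "real \<Rightarrow> real \<Rightarrow> nat \<Rightarrow> aefun \<Rightarrow> aefun"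
  where "nth_deriv a b s Y =
    (if s = 0 then Y else class_on a b ((deriv_on a b ^^ s) (cont_rep a b Y)))"

definition sobolev_norm :: "ennreal \<Rightarrow> nat \<Rightarrow> real \<Rightarrow> real \<Rightarrow> aefun \<Rightarrow> real"
  where "sobolev_norm p l a b Y = (\<Sum>s\<le>l. Lp_norm p a b (nth_deriv a b s Y))"

definition sobolev_vec :: "ennreal \<Rightarrow> nat \<Rightarrow> real \<Rightarrow> real \<Rightarrow> (aefun ^ 'm) set"
  where "sobolev_vec p l a b = {y. \<forall>i. y $ i \<in> sobolev p l a b}"

definition sobolev_vec_norm :: "ennreal \<Rightarrow> nat \<Rightarrow> real \<Rightarrow> real \<Rightarrow> aefun ^ 'm \<Rightarrow> real"
  where "sobolev_vec_norm p l a b y = (\<Sum>i\<in>UNIV. sobolev_norm p l a b (y $ i))"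

definition sobolev_mat :: "ennreal \<Rightarrow> nat \<Rightarrow> real \<Rightarrow> real \<Rightarrow> (aefun ^ 'm ^ 'm) set"
  where "sobolev_mat p l a b = {A. \<forall>i j. A $ i $ j \<in> sobolev p l a b}"


section \<open>The boundary-value problem\<close>

definition nth_deriv_vec :: "real \<Rightarrow> real \<Rightarrow> nat \<Rightarrow> aefun ^ 'm \<Rightarrow> aefun ^ 'm"
  where "nth_deriv_vec a b s y = (\<chi> i. nth_deriv a b s (y $ i))"

text \<open>Products of classes in \<open>*v\<close> are classes of pointwise products.\<close>

definition diff_op :: "real \<Rightarrow> real \<Rightarrow> nat \<Rightarrow> (nat \<Rightarrow> aefun ^ 'm ^ 'm) \<Rightarrow> aefun ^ 'm \<Rightarrow> aefun ^ 'm"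
  where "diff_op a b r A y =
    nth_deriv_vec a b r y + (\<Sum>l = 1..r. A (r - l) *v nth_deriv_vec a b (r - l) y)"

end

theory Submission
  imports Defs
begin

text \<open>
  Let \<open>J\<close> be the operator taking a class to its primitive vanishing at \<open>a\<close>.  Sobolev classes of order
  \<open>l + 1\<close> are exactly the sums of a constant and \<open>J D\<close> with \<open>D\<close> of order \<open>l\<close>; this rests on Lebesgue's
  fundamental theorem of calculus for absolutely continuous functions.  Substituting \<open>y = y\<^sub>0 + J\<^sup>r u\<close>, where
  \<open>y\<^sub>0\<close> carries prescribed initial values, turns \<open>L y = f\<close> into the Volterra equation
  \<open>u + (\<Sum>l. A\<^bsub>r - l\<^esub> J\<^sup>l u) = g\<close> in \<open>L\<^sub>1\<close>.  It is uniquely solvable because the corresponding map for \<open>J u\<close> is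
  a contraction in a sup norm with exponential weight, and the solution inherits the regularity of \<open>g\<close>
  and of the coefficients.  Hence \<open>y \<mapsto> (L y, initial values of y)\<close> is bijective, and replacing the
  initial values by any linear \<open>B\<close> with values in the same finite-dimensional space changes kernel and cokernel
  by those of a square matrix, which have equal dimensions.
\<close>

section \<open>Finite-dimensional perturbation of a bijection\<close>

text \<open>The hard case is p = 1, n = 0: a coefficient is then merely integrable, so no sup-norm
  bound on it is available, and u is only a class in L_1. Hence the fixed point is sought for the
  continuous function v = J u, and the rate c of the weight exp (c (t - a)) comes from cutting the
  coefficients into a bounded part and a part of small integral. Solving in L_1 and recovering
  smoothness afterwards lets one fixed-point argument serve all p and n.

  Classes have no point values, so derivatives are handled algebraically: if Y = c + J D, then c is
  the initial value and D the derivative of Y. Linearity, the product rule and the norm bounds thus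
  become inductions on the order.

  On the side of linear algebra, let G c solve L y = 0 with initial values c. The square matrix is c
  \<mapsto> B (G c). G carries its kernel onto the kernel of (L, B); and subtracting the image of a
  solution of L y = f reduces (f, d) to a vector (0, d') modulo the range, so that the cokernel of
  the matrix is that of (L, B).\<close>

lemma vcoset_eq_iff:
  assumes "complex_vector.subspace U"
  shows "vcoset U v = vcoset U w \<longleftrightarrow> v - w \<in> U"
proof
  assume "vcoset U v = vcoset U w"
  moreover have "v \<in> vcoset U v"
    using complex_vector.subspace_0[OF assms] by (force simp: vcoset_def)
  ultimately obtain u where "v = w + u" "u \<in> U"
    by (auto simp: vcoset_def)
  then show "v - w \<in> U"
    by simp
next
  have *: "vcoset U v \<subseteq> vcoset U w" if "v - w \<in> U" for v w
  proof
    fix x assume "x \<in> vcoset U v"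
    then obtain u where "x = v + u" "u \<in> U" by (auto simp: vcoset_def)
    moreover have "x = w + ((v - w) + u)" using \<open>x = v + u\<close> by simp
    ultimately show "x \<in> vcoset U w"
      using complex_vector.subspace_add[OF assms that] unfolding vcoset_def by blast
  qed
  assume "v - w \<in> U"
  moreover from this have "w - v \<in> U"
    using complex_vector.subspace_neg[OF assms] by fastforce
  ultimately show "vcoset U v = vcoset U w"
    using * by blast
qed

text \<open>Equality of cosets becomes membership in U, and unique existence of coefficients splits
  into spanning and independence modulo U. The coefficient families on the right are unconstrained
  from index d on, which spares later proofs the normalization built into
  \<open>quotient_basis\<close>.\<close>

lemma quotient_basis_iff:
  assumes U: "complex_vector.subspace U" and "U \<subseteq> V"
    and V: "complex_vector.subspace V"
  shows "quotient_basis V U d b \<longleftrightarrow>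
    (\<forall>i<d. b i \<in> V) \<and>
    (\<forall>v\<in>V. \<exists>c. v - (\<Sum>i<d. c i *\<^sub>C b i) \<in> U) \<and>
    (\<forall>c. (\<Sum>i<d. c i *\<^sub>C b i) \<in> U \<longrightarrow> (\<forall>i<d. c i = 0))"
    (is "?L \<longleftrightarrow> ?R1 \<and> ?R2 \<and> ?R3")
proof -
  have L: "?L \<longleftrightarrow> ?R1 \<and>
      (\<forall>v\<in>V. \<exists>!c. (\<forall>i\<ge>d. c i = 0) \<and> v - (\<Sum>i<d. c i *\<^sub>C b i) \<in> U)"
    unfolding quotient_basis_def quotient_space_def by (simp add: vcoset_eq_iff[OF U])
  show ?thesis
  proof
    assume ?L
    with L have R1: ?R1
      and ex: "\<And>v. v \<in> V \<Longrightarrow> \<exists>!c. (\<forall>i\<ge>d. c i = 0) \<and> v - (\<Sum>i<d. c i *\<^sub>C b i) \<in> U"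
      by auto
    have ?R2
      using ex by blast
    moreover have ?R3
    proof (intro allI impI)
      fix c i assume c: "(\<Sum>i<d. c i *\<^sub>C b i) \<in> U" and "i < d"
      have "0 \<in> V"
        using complex_vector.subspace_0[OF V] .
      \<comment> \<open>Uniqueness speaks only of families that vanish from d on. Both the cut-off
        family and the zero family represent the zero coset, hence coincide.\<close>
      define c' where "c' = (\<lambda>i. if i < d then c i else 0)"
      obtain c0 where c0: "\<And>e. \<lbrakk>\<forall>i\<ge>d. e i = 0; 0 - (\<Sum>i<d. e i *\<^sub>C b i) \<in> U\<rbrakk> \<Longrightarrow> e = c0"
        using ex[OF \<open>0 \<in> V\<close>] by (elim ex1E) blast
      have "(\<Sum>i<d. c' i *\<^sub>C b i) = (\<Sum>i<d. c i *\<^sub>C b i)"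
        by (simp add: c'_def)
      then have "c' = c0"
        using complex_vector.subspace_neg[OF U c] by (intro c0) (simp_all add: c'_def)
      moreover have "(\<lambda>_. 0) = c0"
        using complex_vector.subspace_0[OF U] by (intro c0) simp_all
      ultimately have "c' i = 0"
        by metis
      then show "c i = 0"
        using \<open>i < d\<close> by (simp add: c'_def)
    qed
    ultimately show "?R1 \<and> ?R2 \<and> ?R3"
      using R1 by blast
  next
    assume R: "?R1 \<and> ?R2 \<and> ?R3"
    have "\<exists>!c. (\<forall>i\<ge>d. c i = 0) \<and> v - (\<Sum>i<d. c i *\<^sub>C b i) \<in> U" if v: "v \<in> V" for v
    proof -
      obtain c where c: "v - (\<Sum>i<d. c i *\<^sub>C b i) \<in> U"
        using R v by blast
      define c' where "c' = (\<lambda>i. if i < d then c i else 0)"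
      have c': "v - (\<Sum>i<d. c' i *\<^sub>C b i) \<in> U" "\<forall>i\<ge>d. c' i = 0"
        using c by (simp_all add: c'_def)
      have "e = c'" if e: "v - (\<Sum>i<d. e i *\<^sub>C b i) \<in> U" "\<forall>i\<ge>d. e i = 0" for e
      proof
        fix i
        have "(v - (\<Sum>i<d. c' i *\<^sub>C b i)) - (v - (\<Sum>i<d. e i *\<^sub>C b i)) \<in> U"
          using complex_vector.subspace_diff[OF U c'(1) e(1)] .
        then have "(\<Sum>i<d. (\<lambda>i. e i - c' i) i *\<^sub>C b i) \<in> U"
          by (simp add: complex_vector.scale_left_diff_distrib sum_subtractf)
        then have "\<forall>i<d. e i - c' i = 0"
          using conjunct2[OF conjunct2[OF R], rule_format, of "\<lambda>i. e i - c' i"] by blast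
        then show "e i = c' i"
          using e(2) c'(2) by (cases "i < d") auto
      qed
      then show ?thesis
        using c' by blast
    qed
    then show ?L
      using L conjunct1[OF R] by simp
  qed
qed

text \<open>The exchange argument modulo U: each b' j is congruent to a combination p j of the b i,
  and the p j remain independent because a relation among them is a relation among the b' j modulo
  U. The bound is then the usual one for independent vectors in a finite span.\<close>

lemma quotient_basis_card_le:
  assumes U: "complex_vector.subspace U" and UV: "U \<subseteq> V"
    and V: "complex_vector.subspace V"
    and b: "quotient_basis V U d b" and b': "quotient_basis V U d' b'"
  shows "d' \<le> d"
proof -
  have bV: "\<forall>i<d. b i \<in> V" and ex: "\<forall>v\<in>V. \<exists>c. v - (\<Sum>i<d. c i *\<^sub>C b i) \<in> U"
    using b unfolding quotient_basis_iff[OF U UV V] by blast+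
  have b'V: "\<forall>i<d'. b' i \<in> V"
    and ind: "\<forall>c. (\<Sum>i<d'. c i *\<^sub>C b' i) \<in> U \<longrightarrow> (\<forall>i<d'. c i = 0)"
    using b' unfolding quotient_basis_iff[OF U UV V] by blast+
  have "\<forall>j. \<exists>c. j < d' \<longrightarrow> b' j - (\<Sum>i<d. c i *\<^sub>C b i) \<in> U"
    using ex b'V by blast
  from choice[OF this] obtain C where C: "\<And>j. j < d' \<Longrightarrow> b' j - (\<Sum>i<d. C j i *\<^sub>C b i) \<in> U"
    by blast
  define p where "p j = (\<Sum>i<d. C j i *\<^sub>C b i)" for j
  have zero: "\<forall>j<d'. e j = 0" if e: "(\<Sum>j<d'. e j *\<^sub>C p j) = 0" for e
  proof -
    have "(\<Sum>j<d'. e j *\<^sub>C (b' j - p j)) \<in> U"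
      using C by (auto simp: p_def intro!: complex_vector.subspace_sum[OF U] complex_vector.subspace_scale[OF U])
    also have "(\<Sum>j<d'. e j *\<^sub>C (b' j - p j)) = (\<Sum>j<d'. e j *\<^sub>C b' j)"
      using e by (simp add: complex_vector.scale_right_diff_distrib sum_subtractf)
    finally show ?thesis
      using ind by blast
  qed
  have inj: "inj_on p {..<d'}"
  proof (rule inj_onI)
    fix j k assume jk: "j \<in> {..<d'}" "k \<in> {..<d'}" "p j = p k"
    \<comment> \<open>The coefficients of p j - p k. Independence is a property of sets, so
      repetitions have to be excluded before counting; for j \<noteq> k the entry e j would be
      1.\<close>
    define e :: "nat \<Rightarrow> complex" where "e = (\<lambda>i. (if i = j then 1 else 0) - (if i = k then 1 else 0))"
    have "(\<Sum>i<d'. e i *\<^sub>C p i) = (\<Sum>i<d'. (if i = j then 1 else 0) *\<^sub>C p i) - (\<Sum>i<d'. (if i = k then 1 else 0) *\<^sub>C p i)"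
      by (simp add: e_def complex_vector.scale_left_diff_distrib sum_subtractf)
    also have "\<dots> = p j - p k"
      using jk by (simp add: if_distrib[where f = "\<lambda>c. c *\<^sub>C _"] sum.delta scaleC_one cong: if_cong)
    also have "\<dots> = 0"
      using jk by simp
    finally have "e j = 0"
      using zero jk by blast
    then show "j = k"
      by (auto simp: e_def split: if_splits)
  qed
  have "complex_vector.independent (p ` {..<d'})"
  proof (rule complex_vector.independent_if_scalars_zero)
    fix f x assume s: "(\<Sum>x\<in>p ` {..<d'}. f x *\<^sub>C x) = 0" and "x \<in> p ` {..<d'}"
    from s have "(\<Sum>j<d'. f (p j) *\<^sub>C p j) = 0"
      by (simp add: sum.reindex[OF inj])
    with zero[of "\<lambda>j. f (p j)"] \<open>x \<in> p ` {..<d'}\<close> show "f x = 0"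
      by auto
  qed simp
  moreover have "p ` {..<d'} \<subseteq> complex_vector.span (b ` {..<d})"
  proof (rule image_subsetI)
    show "p j \<in> complex_vector.span (b ` {..<d})" for j
      unfolding p_def
      by (rule complex_vector.span_sum, rule complex_vector.span_scale, rule complex_vector.span_base) simp
  qed
  ultimately have "card (p ` {..<d'}) \<le> card (b ` {..<d})"
    using complex_vector.independent_span_bound[of "b ` {..<d}" "p ` {..<d'}"] by simp
  then show ?thesis
    using card_image[OF inj] card_image_le[of "{..<d}" b] by simp
qed

text \<open>Any two bases bound each other in length, so the definite description in
  \<open>quotient_dim\<close> denotes.\<close>

lemma quotient_dim_eq:
  assumes "complex_vector.subspace U" "U \<subseteq> V" "complex_vector.subspace V"
    and "quotient_basis V U d b"
  shows "quotient_dim V U = d"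
  unfolding quotient_dim_def
proof (rule the_equality)
  show "\<exists>b. quotient_basis V U d b"
    using assms(4) by blast
  show "d' = d" if "\<exists>b. quotient_basis V U d' b" for d'
    using that quotient_basis_card_le[OF assms(1-3)] assms(4) by (metis le_antisym)
qed

section \<open>Kernel and cokernel of a square matrix\<close>

lemma scaleC_vec_complex: "(scaleC :: complex \<Rightarrow> complex ^ 'k \<Rightarrow> _) = (*s)"
  by (intro ext) (simp add: scaleC_vec_def vec_eq_iff scaleC_complex_def)

text \<open>The representations of a common vector over A and over B are both its representation
  over A \<union> B, so its coefficients are supported in A and in B at once.\<close>

lemma (in vector_space) span_disjoint_independent:
  assumes "independent (A \<union> B)" "A \<inter> B = {}"
  shows "span A \<inter> span B = {0}"
proof -
  have "x = 0" if x: "x \<in> span A" "x \<in> span B" for x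
  proof -
    have "representation (A \<union> B) x = representation A x" 
      by (rule representation_extend[OF assms(1) x(1)]) simp
    moreover have "representation (A \<union> B) x = representation B x"
      by (rule representation_extend[OF assms(1) x(2)]) simp
    ultimately have "representation A x b = 0" for b
      using assms(2) representation_ne_zero[of A x b] representation_ne_zero[of B x b] by auto
    then show "x = 0"
      using sum_nonzero_representation_eq[OF independent_mono[OF assms(1), of A] x(1)] by simp
  qed
  then show ?thesis
    using span_zero by auto
qed

lemma square_matrix_kernel_cokernel:
  fixes M :: "complex ^ 'k \<Rightarrow> complex ^ 'k"
  assumes M: "Vector_Spaces.linear scaleC scaleC M"
  obtains C Q where "finite C" "finite Q" "card Q = card C"
    "complex_vector.independent C" "complex_vector.span C = {c. M c = 0}"
    "complex_vector.independent Q" "complex_vector.span Q \<inter> range M = {0}"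
    "\<And>c. \<exists>q\<in>complex_vector.span Q. c - q \<in> range M"
proof -
  interpret fd: finite_dimensional_vector_space "scaleC :: complex \<Rightarrow> complex ^ 'k \<Rightarrow> _" cart_basis
    by (simp only: scaleC_vec_complex) (rule vec.finite_dimensional_vector_space_axioms)
  interpret M: Vector_Spaces.linear scaleC scaleC M
    by (rule M)
  obtain C where C: "C \<subseteq> {c. M c = 0}" "complex_vector.independent C" "{c. M c = 0} \<subseteq> complex_vector.span C"
    using complex_vector.maximal_independent_subset[of "{c. M c = 0}"] .
  have spanC: "complex_vector.span C = {c. M c = 0}"
    using C complex_vector.span_minimal[OF C(1) M.subspace_kernel] by (intro subset_antisym)
  obtain C' where C': "C \<subseteq> C'" "complex_vector.independent C'" "complex_vector.span C' = UNIV"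
    using complex_vector.maximal_independent_subset_extend[OF subset_UNIV C(2)] by (auto simp: top_unique)
  define P where "P = C' - C"
  have "P \<subseteq> C'"
    by (auto simp: P_def)
  then have P: "complex_vector.independent P" "P \<subseteq> C'"
    by (simp_all add: complex_vector.independent_mono[OF C'(2)])
  have fin: "finite C'" "finite C" "finite P"
    using fd.finiteI_independent[OF C'(2)] fd.finiteI_independent[OF C(2)] fd.finiteI_independent[OF P(1)] .
  have injP: "inj_on M (complex_vector.span P)"
    unfolding M.inj_on_iff_eq_0[OF complex_vector.subspace_span]
  proof (intro ballI impI)
    fix x assume x: "x \<in> complex_vector.span P" "M x = 0"
    then have "x \<in> complex_vector.span C" using spanC by simp
    have "complex_vector.span C \<inter> complex_vector.span P = {0}"
      using C'(1,2) by (intro complex_vector.span_disjoint_independent) (auto simp: P_def Un_absorb1)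
    then show "x = 0" using x \<open>x \<in> complex_vector.span C\<close> by blast
  qed
  have indMP: "complex_vector.independent (M ` P)"
    using M.independent_injective_image[OF P(1) injP] .
  have cardMP: "card (M ` P) = card P"
    using inj_on_subset[OF injP complex_vector.span_superset] by (rule card_image)
  have "range M = complex_vector.span (M ` C')"
    unfolding M.span_image C'(3) ..
  also have "\<dots> = complex_vector.span (M ` P)"
  proof (rule antisym)
    have "M x \<in> complex_vector.span (M ` P)" if "x \<in> C'" for x
    proof (cases "x \<in> C")
      case True
      then have "M x = 0"
        using C(1) by blast
      then show ?thesis
        using complex_vector.span_zero by simp
    next
      case False
      then show ?thesis
        using that by (intro complex_vector.span_base) (simp add: P_def)
    qed
    then have "M ` C' \<subseteq> complex_vector.span (M ` P)"
      by (rule image_subsetI)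
    then show "complex_vector.span (M ` C') \<subseteq> complex_vector.span (M ` P)"
      by (rule complex_vector.span_minimal) (rule complex_vector.subspace_span)
    show "complex_vector.span (M ` P) \<subseteq> complex_vector.span (M ` C')"
      by (rule complex_vector.span_mono) (rule image_mono[OF P(2)])
  qed
  finally have rangeM: "range M = complex_vector.span (M ` P)" .
  obtain D where D: "M ` P \<subseteq> D" "complex_vector.independent D" "complex_vector.span D = UNIV"
    using complex_vector.maximal_independent_subset_extend[OF subset_UNIV indMP] by (auto simp: top_unique)
  define Q where "Q = D - M ` P"
  have "card D = card C'"
    using complex_vector.dim_span_eq_card_independent[OF D(2)]
      complex_vector.dim_span_eq_card_independent[OF C'(2)] D(3) C'(3) by simp
  moreover have "finite D"
    using D(2) by (rule fd.finiteI_independent)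
  ultimately have "card Q = card C"
    using fin C'(1) D(1) cardMP card_mono[of C' C] by (simp add: Q_def P_def card_Diff_subset finite_subset)
  show ?thesis
  proof (rule that[of C Q])
    have DQ: "Q \<union> M ` P = D"
      using D(1) by (auto simp: Q_def)
    show "complex_vector.span Q \<inter> range M = {0}"
      unfolding rangeM
      by (rule complex_vector.span_disjoint_independent) (use D(2) in \<open>simp_all add: DQ\<close>, auto simp: Q_def)
    show "\<exists>q\<in>complex_vector.span Q. c - q \<in> range M" for c
    proof -
      have "c \<in> complex_vector.span (Q \<union> M ` P)"
        using D(3) by (simp add: DQ)
      then obtain q r where "c = q + r" "q \<in> complex_vector.span Q" "r \<in> range M"
        unfolding complex_vector.span_Un rangeM by blast
      then show ?thesis
        by (intro bexI[of _ q]) simp_all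
    qed
    show "complex_vector.independent Q"
      by (rule complex_vector.independent_mono[OF D(2)]) (simp add: Q_def)
    show "finite Q"
      using \<open>finite D\<close> by (simp add: Q_def)
    show "finite C" "card Q = card C" "complex_vector.independent C" "complex_vector.span C = {c. M c = 0}"
      by fact+
  qed
qed

text \<open>The algebraic core of the Fredholm statement, free of norms: (L, \<Lambda>) is a
  bijection of E onto F x C^k, and B takes the place of \<Lambda>. Both have the target C^k, so the
  matrix that compares them is square.\<close>

lemma fredholm_index_zero_if_bijective:
  fixes L :: "'a::complex_vector \<Rightarrow> 'b::complex_vector" and \<Lambda> B :: "'a \<Rightarrow> complex ^ 'k"
  assumes E: "complex_vector.subspace E" and F: "complex_vector.subspace F"
    and L: "\<And>x y. \<lbrakk>x \<in> E; y \<in> E\<rbrakk> \<Longrightarrow> L (x + y) = L x + L y" "\<And>c x. x \<in> E \<Longrightarrow> L (c *\<^sub>C x) = c *\<^sub>C L x"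
    and LF: "\<And>x. x \<in> E \<Longrightarrow> L x \<in> F"
    and \<Lambda>: "\<And>x y. \<lbrakk>x \<in> E; y \<in> E\<rbrakk> \<Longrightarrow> \<Lambda> (x + y) = \<Lambda> x + \<Lambda> y" "\<And>c x. x \<in> E \<Longrightarrow> \<Lambda> (c *\<^sub>C x) = c *\<^sub>C \<Lambda> x"
    and B: "\<And>x y. \<lbrakk>x \<in> E; y \<in> E\<rbrakk> \<Longrightarrow> B (x + y) = B x + B y" "\<And>c x. x \<in> E \<Longrightarrow> B (c *\<^sub>C x) = c *\<^sub>C B x"
    and bij: "\<And>f c. f \<in> F \<Longrightarrow> \<exists>!x. x \<in> E \<and> L x = f \<and> \<Lambda> x = c"
  defines "T \<equiv> \<lambda>x. (L x, B x)"
  shows "\<exists>S. finite S \<and> kernel_on E T \<subseteq> complex_vector.span S"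
    and "quotient_finite_dim (F \<times> UNIV) (T ` E)"
    and "fredholm_index E (F \<times> UNIV) T = 0"
proof -
  define sol where "sol f c = (THE x. x \<in> E \<and> L x = f \<and> \<Lambda> x = c)" for f c
  have sol: "sol f c \<in> E" "L (sol f c) = f" "\<Lambda> (sol f c) = c" if "f \<in> F" for f c
    using theI'[OF bij[OF that, of c]] by (simp_all add: sol_def)
  have sol_eq: "x = sol f c" if "x \<in> E" "L x = f" "\<Lambda> x = c" for x f c
    using the1_equality[OF bij[OF LF[OF that(1)], of c]] that by (auto simp: sol_def)
  have F0: "0 \<in> F"
    using F by (rule complex_vector.subspace_0)
  note Eadd = complex_vector.subspace_add[OF E] and Escale = complex_vector.subspace_scale[OF E]
  define G where "G = sol 0"
  have G: "G c \<in> E" "L (G c) = 0" "\<Lambda> (G c) = c" for c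
    using sol[OF F0] by (simp_all add: G_def)
  have G_eq: "x = G c" if "x \<in> E" "L x = 0" "\<Lambda> x = c" for x c
    using sol_eq that by (simp add: G_def)
  have linG: "Vector_Spaces.linear scaleC scaleC G"
    by unfold_locales (auto intro!: G_eq[symmetric] simp: L \<Lambda> G Eadd Escale)
  interpret G: Vector_Spaces.linear scaleC scaleC G
    by (rule linG)
  have "Vector_Spaces.linear scaleC scaleC (\<lambda>c. B (G c))"
    by unfold_locales (simp_all add: G.add G.scale B G)
  then obtain C Q where CQ: "finite C" "finite Q" "card Q = card C"
    "complex_vector.independent C" "complex_vector.span C = {c. B (G c) = 0}"
    "complex_vector.independent Q" "complex_vector.span Q \<inter> range (\<lambda>c. B (G c)) = {0}"
    "\<And>c. \<exists>q\<in>complex_vector.span Q. c - q \<in> range (\<lambda>c. B (G c))"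
    by (rule square_matrix_kernel_cokernel) blast
  have injG: "inj G"
    by (rule injI) (metis G(3))
  have ker: "kernel_on E T = complex_vector.span (G ` C)"
  proof -
    have "x \<in> G ` {c. B (G c) = 0}" if "x \<in> E" "L x = 0" "B x = 0" for x
      using G_eq[of x "\<Lambda> x"] that by auto
    then show ?thesis
      unfolding G.span_image CQ(5) kernel_on_def T_def using G by (auto simp: zero_prod_def)
  qed
  then show "\<exists>S. finite S \<and> kernel_on E T \<subseteq> complex_vector.span S"
    using CQ(1) by blast
  have "complex_vector.independent (G ` C)"
    by (rule G.independent_inj_image[OF CQ(4) injG])
  then have dimker: "complex_vector.dim (kernel_on E T) = card C"
    unfolding ker using complex_vector.dim_span_eq_card_independent[of "G ` C"] card_image[OF inj_on_subset[OF injG subset_UNIV]]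
    by simp
  have Tadd: "T (x + y) = T x + T y" if "x \<in> E" "y \<in> E" for x y
    using that by (simp add: T_def L B)
  have Tscale: "T (c *\<^sub>C x) = c *\<^sub>C T x" if "x \<in> E" for c x
    using that by (simp add: T_def L B scaleC_prod_def)
  have U: "complex_vector.subspace (T ` E)"
  proof (rule complex_vector.subspaceI)
    have "T 0 = 0"
      using Tscale[of 0 0] complex_vector.subspace_0[OF E] by simp
    then show "0 \<in> T ` E"
      using complex_vector.subspace_0[OF E] by (metis image_eqI)
    show "x + y \<in> T ` E" if xy: "x \<in> T ` E" "y \<in> T ` E" for x y
    proof -
      obtain x' y' where "x = T x'" "y = T y'" "x' \<in> E" "y' \<in> E"
        using xy by blast
      then show ?thesis
        using Tadd[of x' y'] Eadd[of x' y'] by (metis image_eqI)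
    qed
    show "c *\<^sub>C x \<in> T ` E" if x: "x \<in> T ` E" for c x
    proof -
      obtain x' where "x = T x'" "x' \<in> E"
        using x by blast
      then show ?thesis
        using Tscale[of x' c] Escale[of x' c] by (metis image_eqI)
    qed
  qed
  have V: "complex_vector.subspace (F \<times> (UNIV :: (complex ^ 'k) set))"
    using F by (auto simp: complex_vector.subspace_def scaleC_prod_def zero_prod_def)
  have UV: "T ` E \<subseteq> F \<times> UNIV"
    using LF by (auto simp: T_def)
  obtain q where q: "bij_betw q {..<card C} Q"
    using ex_bij_betw_nat_finite[OF CQ(2)] CQ(3) by (auto simp: atLeast0LessThan)
  have in_U: "(0, c) \<in> T ` E \<longleftrightarrow> c \<in> range (\<lambda>c. B (G c))" for c
  proof
    assume "(0, c) \<in> T ` E"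
    then obtain x where "x \<in> E" "L x = 0" "c = B x"
      by (auto simp: T_def)
    then show "c \<in> range (\<lambda>c. B (G c))"
      using G_eq[of x "\<Lambda> x"] by (metis rangeI)
  next
    assume "c \<in> range (\<lambda>c. B (G c))"
    then show "(0, c) \<in> T ` E"
      using G by (force simp: T_def)
  qed
  define b where "b i = (0 :: 'b, q i)" for i
  have bsum: "(\<Sum>i<card C. c i *\<^sub>C b i) = (0, \<Sum>i<card C. c i *\<^sub>C q i)" for c
    by (simp add: b_def scaleC_prod_def prod_eq_iff fst_sum snd_sum)
  have basis: "quotient_basis (F \<times> UNIV) (T ` E) (card C) b"
    unfolding quotient_basis_iff[OF U UV V]
  proof (intro conjI ballI allI impI)
    show "b i \<in> F \<times> UNIV" for i
      using F0 by (simp add: b_def)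
  next
    fix v assume "v \<in> F \<times> (UNIV :: (complex ^ 'k) set)"
    then obtain f d where v: "v = (f, d)" "f \<in> F"
      by auto
    obtain s where s: "s \<in> complex_vector.span Q" "d - B (sol f 0) - s \<in> range (\<lambda>c. B (G c))"
      using CQ(8) by blast
    from s(1) obtain u where u: "s = (\<Sum>x\<in>Q. u x *\<^sub>C x)"
      unfolding complex_vector.span_finite[OF CQ(2)] by auto
    have "s = (\<Sum>i<card C. u (q i) *\<^sub>C q i)"
      unfolding u using sum.reindex_bij_betw[OF q, of "\<lambda>x. u x *\<^sub>C x"] by simp
    \<comment> \<open>The solution with \<Lambda>-value 0 accounts for the first component f; what
      remains lies in 0 x C^k, where \<open>in_U\<close> decides membership in the range.\<close>
    then have "v - (\<Sum>i<card C. u (q i) *\<^sub>C b i) = T (sol f 0) + (0, d - B (sol f 0) - s)"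
      using v sol[OF v(2)] by (simp add: bsum T_def)
    also have "\<dots> \<in> T ` E"
      using sol(1)[OF v(2)] s(2) in_U by (intro complex_vector.subspace_add[OF U]) simp_all
    finally show "\<exists>c. v - (\<Sum>i<card C. c i *\<^sub>C b i) \<in> T ` E"
      by (intro exI[of _ "\<lambda>i. u (q i)"])
  next
    fix c :: "nat \<Rightarrow> complex" and i
    assume c: "(\<Sum>i<card C. c i *\<^sub>C b i) \<in> T ` E" and i: "i < card C"
    define s where "s = (\<Sum>i<card C. c i *\<^sub>C q i)"
    have qQ: "q j \<in> Q" if "j < card C" for j
      using q that by (auto dest: bij_betwE)
    have "s \<in> complex_vector.span Q"
      unfolding s_def
      by (intro complex_vector.span_sum complex_vector.span_scale complex_vector.span_base qQ) simp
    moreover have "s \<in> range (\<lambda>c. B (G c))"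
      using c in_U by (simp add: bsum s_def)
    ultimately have "s = 0"
      using CQ(7) by blast
    \<comment> \<open>Independence of Q concerns coefficient functions on Q, so c is transported
      along the enumeration q.\<close>
    define u where "u x = c (the_inv_into {..<card C} q x)" for x
    have u: "u (q j) = c j" if "j < card C" for j
      using that q by (simp add: u_def the_inv_into_f_f bij_betw_def)
    have "(\<Sum>x\<in>Q. u x *\<^sub>C x) = (\<Sum>i<card C. u (q i) *\<^sub>C q i)"
      using sum.reindex_bij_betw[OF q, of "\<lambda>x. u x *\<^sub>C x"] by simp
    also have "\<dots> = 0"
      using \<open>s = 0\<close> by (simp add: s_def u)
    finally have "u (q i) = 0"
      using complex_vector.independentD[OF CQ(6) CQ(2) order_refl] qQ[OF i] by blast
    then show "c i = 0"
      using u i by simp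
  qed
  then show "quotient_finite_dim (F \<times> UNIV) (T ` E)"
    by (auto simp: quotient_finite_dim_def)
  show "fredholm_index E (F \<times> UNIV) T = 0"
    unfolding fredholm_index_def dimker quotient_dim_eq[OF U UV V basis] by simp
qed

section \<open>Absolutely continuous functions\<close>

text \<open>The definition numbers intervals by an initial segment of the naturals. Arbitrary finite
  index sets are needed because the intervals of a tagged division are indexed by the division
  itself.\<close>

lemma absolutely_continuous_on_finite:
  assumes "absolutely_continuous_on a b f" "0 < e"
  shows "\<exists>d>0. \<forall>(I::'i set) u v. finite I \<longrightarrow> (\<forall>i\<in>I. a \<le> u i \<and> u i \<le> v i \<and> v i \<le> b) \<longrightarrow>
      disjoint_family_on (\<lambda>i. {u i<..<v i}) I \<longrightarrow> (\<Sum>i\<in>I. v i - u i) < d \<longrightarrow>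
      (\<Sum>i\<in>I. norm (f (v i) - f (u i))) < e"
proof -
  obtain d where "0 < d" and d: "\<And>(k::nat) u v. \<lbrakk>\<forall>i<k. a \<le> u i \<and> u i \<le> v i \<and> v i \<le> b;
      disjoint_family_on (\<lambda>i. {u i<..<v i}) {..<k}; (\<Sum>i<k. v i - u i) < d\<rbrakk>
      \<Longrightarrow> (\<Sum>i<k. norm (f (v i) - f (u i))) < e"
    using assms unfolding absolutely_continuous_on_def by meson
  show ?thesis
  proof (intro exI[of _ d] conjI allI impI \<open>0 < d\<close>)
    fix I :: "'i set" and u v
    assume I: "finite I" "\<forall>i\<in>I. a \<le> u i \<and> u i \<le> v i \<and> v i \<le> b"
      "disjoint_family_on (\<lambda>i. {u i<..<v i}) I" "(\<Sum>i\<in>I. v i - u i) < d"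
    obtain h where h: "bij_betw h {..<card I} I"
      using ex_bij_betw_nat_finite[OF I(1)] by (auto simp: atLeast0LessThan)
    have hI: "h j \<in> I" if "j < card I" for j
      using h that by (auto dest: bij_betwE)
    have "(\<Sum>j<card I. norm (f (v (h j)) - f (u (h j)))) < e"
    proof (rule d)
      show "\<forall>j<card I. a \<le> u (h j) \<and> u (h j) \<le> v (h j) \<and> v (h j) \<le> b"
        using I(2) hI by blast
      show "(\<Sum>j<card I. v (h j) - u (h j)) < d"
        using I(4) sum.reindex_bij_betw[OF h, of "\<lambda>i. v i - u i"] by simp
      show "disjoint_family_on (\<lambda>j. {u (h j)<..<v (h j)}) {..<card I}"
        unfolding disjoint_family_on_def
      proof (intro ballI impI)
        fix j k assume "j \<in> {..<card I}" "k \<in> {..<card I}" "j \<noteq> k"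
        then have "h j \<noteq> h k" "h j \<in> I" "h k \<in> I"
          using h hI by (auto simp: bij_betw_def inj_on_def)
        then show "{u (h j)<..<v (h j)} \<inter> {u (h k)<..<v (h k)} = {}"
          using disjoint_family_onD[OF I(3)] by blast
      qed
    qed
    then show "(\<Sum>i\<in>I. norm (f (v i) - f (u i))) < e"
      using sum.reindex_bij_betw[OF h, of "\<lambda>i. norm (f (v i) - f (u i))"] by simp
  qed
qed

lemma absolutely_continuous_on_imp_continuous_on:
  assumes "absolutely_continuous_on a b f"
  shows "continuous_on {a..b} f"
  unfolding continuous_on_iff
proof (intro ballI allI impI)
  fix x and e :: real assume x: "x \<in> {a..b}" and "0 < e"
  obtain d where "0 < d" and d: "\<forall>(I::unit set) u v. finite I \<longrightarrow> (\<forall>i\<in>I. a \<le> u i \<and> u i \<le> v i \<and> v i \<le> b) \<longrightarrow>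
      disjoint_family_on (\<lambda>i. {u i<..<v i}) I \<longrightarrow> (\<Sum>i\<in>I. v i - u i) < d \<longrightarrow>
      (\<Sum>i\<in>I. norm (f (v i) - f (u i))) < e"
    using absolutely_continuous_on_finite[OF assms \<open>0 < e\<close>] by (elim exE conjE) (rule that)
  have *: "norm (f t - f s) < e" if "a \<le> s" "s \<le> t" "t \<le> b" "t - s < d" for s t
    using d[rule_format, of "{()}" "\<lambda>_. s" "\<lambda>_. t"] that by (simp add: disjoint_family_on_def)
  have "dist (f y) (f x) < e" if "y \<in> {a..b}" "dist y x < d" for y
    using *[of x y] *[of y x] that x by (cases "x \<le> y") (auto simp: dist_norm norm_minus_commute)
  then show "\<exists>d>0. \<forall>x'\<in>{a..b}. dist x' x < d \<longrightarrow> dist (f x') (f x) < e"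
    using \<open>0 < d\<close> by blast
qed

text \<open>The common source of the stability results: a function whose increments are controlled
  by those of f and g can use the smaller of their two \<delta>.\<close>

lemma absolutely_continuous_on_dominated:
  assumes f: "absolutely_continuous_on a b f" and g: "absolutely_continuous_on a b g" and "0 \<le> M"
    and le: "\<And>s t. \<lbrakk>a \<le> s; s \<le> t; t \<le> b\<rbrakk> \<Longrightarrow>
      norm (h t - h s) \<le> M * (norm (f t - f s) + norm (g t - g s))"
  shows "absolutely_continuous_on a b h"
  unfolding absolutely_continuous_on_def
proof (intro allI impI)
  fix e :: real assume "0 < e"
  \<comment> \<open>The sums for f and g together give M * (2 e'). With M + 1 in the denominator
    this is strictly less than e, also for M = 0.\<close>
  define e' where "e' = e / (2 * (M + 1))"
  have "0 < e'"
    using \<open>0 < e\<close> \<open>0 \<le> M\<close> by (simp add: e'_def)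
  obtain d1 where "0 < d1" and d1: "\<And>(k::nat) u v. \<lbrakk>\<forall>i<k. a \<le> u i \<and> u i \<le> v i \<and> v i \<le> b;
      disjoint_family_on (\<lambda>i. {u i<..<v i}) {..<k}; (\<Sum>i<k. v i - u i) < d1\<rbrakk>
      \<Longrightarrow> (\<Sum>i<k. norm (f (v i) - f (u i))) < e'"
    using f \<open>0 < e'\<close> unfolding absolutely_continuous_on_def by meson
  obtain d2 where "0 < d2" and d2: "\<And>(k::nat) u v. \<lbrakk>\<forall>i<k. a \<le> u i \<and> u i \<le> v i \<and> v i \<le> b;
      disjoint_family_on (\<lambda>i. {u i<..<v i}) {..<k}; (\<Sum>i<k. v i - u i) < d2\<rbrakk>
      \<Longrightarrow> (\<Sum>i<k. norm (g (v i) - g (u i))) < e'"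
    using g \<open>0 < e'\<close> unfolding absolutely_continuous_on_def by meson
  have "(\<Sum>i<k. norm (h (v i) - h (u i))) < e"
    if uv: "\<forall>i<k. a \<le> u i \<and> u i \<le> v i \<and> v i \<le> b"
      "disjoint_family_on (\<lambda>i. {u i<..<v i}) {..<k}" "(\<Sum>i<k. v i - u i) < min d1 d2"
    for k :: nat and u v
  proof -
    have "(\<Sum>i<k. norm (h (v i) - h (u i)))
        \<le> (\<Sum>i<k. M * (norm (f (v i) - f (u i)) + norm (g (v i) - g (u i))))"
      using uv(1) by (intro sum_mono le) auto
    also have "\<dots> = M * ((\<Sum>i<k. norm (f (v i) - f (u i))) + (\<Sum>i<k. norm (g (v i) - g (u i))))"
      by (simp add: sum_distrib_left sum.distrib algebra_simps)
    also have "\<dots> \<le> M * (e' + e')"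
      using d1[OF uv(1,2)] d2[OF uv(1,2)] uv(3) \<open>0 \<le> M\<close> by (intro mult_left_mono add_mono) auto
    also have "\<dots> < (M + 1) * (e' + e')"
      using \<open>0 < e'\<close> by (intro mult_strict_right_mono) auto
    also have "\<dots> = (2 * (M + 1)) * e'"
      by (simp add: algebra_simps)
    also have "\<dots> = e"
      using \<open>0 \<le> M\<close> by (simp add: e'_def)
    finally show ?thesis .
  qed
  moreover have "0 < min d1 d2"
    using \<open>0 < d1\<close> \<open>0 < d2\<close> by simp
  ultimately show "\<exists>\<delta>>0. \<forall>(k::nat) u v. (\<forall>i<k. a \<le> u i \<and> u i \<le> v i \<and> v i \<le> b) \<longrightarrow>
      disjoint_family_on (\<lambda>i. {u i<..<v i}) {..<k} \<longrightarrow> (\<Sum>i<k. v i - u i) < \<delta> \<longrightarrow>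
      (\<Sum>i<k. norm (h (v i) - h (u i))) < e"
    by meson
qed

lemma absolutely_continuous_on_cong_diff:
  assumes "absolutely_continuous_on a b f"
    and "\<And>s t. \<lbrakk>s \<in> {a..b}; t \<in> {a..b}\<rbrakk> \<Longrightarrow> g t - g s = f t - f s"
  shows "absolutely_continuous_on a b g"
  using assms(2) by (intro absolutely_continuous_on_dominated[OF assms(1) assms(1), of 1]) auto

lemma absolutely_continuous_on_mult:
  assumes f: "absolutely_continuous_on a b f" and g: "absolutely_continuous_on a b g"
  shows "absolutely_continuous_on a b (\<lambda>t. f t * g t)"
proof -
  have "bounded (f ` {a..b} \<union> g ` {a..b})"
    using f g by (auto intro!: compact_imp_bounded compact_continuous_image absolutely_continuous_on_imp_continuous_on)
  then obtain M where M: "\<And>x. x \<in> f ` {a..b} \<union> g ` {a..b} \<Longrightarrow> norm x \<le> M"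
    unfolding bounded_iff by blast
  show ?thesis
  proof (rule absolutely_continuous_on_dominated[OF f g, of "\<bar>M\<bar>"])
    fix s t assume st: "a \<le> s" "s \<le> t" "t \<le> b"
    have "f t * g t - f s * g s = g t * (f t - f s) + f s * (g t - g s)"
      by (simp add: algebra_simps)
    also have "norm \<dots> \<le> \<bar>M\<bar> * norm (f t - f s) + \<bar>M\<bar> * norm (g t - g s)"
      unfolding norm_mult[symmetric]
    proof (rule norm_triangle_mono)
      have "norm (g t) \<le> \<bar>M\<bar>" "norm (f s) \<le> \<bar>M\<bar>"
        using M[of "g t"] M[of "f s"] st by auto
      then show "norm (g t * (f t - f s)) \<le> \<bar>M\<bar> * norm (f t - f s)"
        "norm (f s * (g t - g s)) \<le> \<bar>M\<bar> * norm (g t - g s)"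
        by (simp_all add: norm_mult mult_right_mono)
    qed
    finally show "norm (f t * g t - f s * g s) \<le> \<bar>M\<bar> * (norm (f t - f s) + norm (g t - g s))"
      by (simp add: algebra_simps)
  qed simp
qed

section \<open>Primitives and the fundamental theorem of calculus\<close>

text \<open>The excess of |f| over n is dominated by |f| and vanishes pointwise for large n, so its
  integral tends to 0. The splitting |f| \<le> C + g with g of small integral yields both the
  absolute continuity of primitives and the choice of the exponential weight.\<close>

lemma absolutely_integrable_truncation:
  fixes f :: "real \<Rightarrow> 'a::euclidean_space"
  assumes f: "f absolutely_integrable_on {a..b}" and "0 < e"
  obtains C where "0 \<le> C" "(\<lambda>t. max 0 (norm (f t) - C)) integrable_on {a..b}"
    "integral {a..b} (\<lambda>t. max 0 (norm (f t) - C)) < e"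
proof -
  define g where "g n t = max 0 (norm (f t) - real n)" for n t
  have nf: "(\<lambda>t. norm (f t)) absolutely_integrable_on {a..b}"
    using f[THEN absolutely_integrable_norm] by (simp add: o_def)
  have g: "g n absolutely_integrable_on {a..b}" for n
    unfolding g_def
    by (intro absolutely_integrable_max_1 set_integral_diff nf absolutely_integrable_continuous_real continuous_on_const)
  have "(\<lambda>n. integral {a..b} (g n)) \<longlonglongrightarrow> integral {a..b} (\<lambda>t. 0)"
  proof (rule dominated_convergence(2))
    show "g n integrable_on {a..b}" for n
      using g by (rule set_lebesgue_integral_eq_integral(1))
    show "(\<lambda>t. norm (f t)) integrable_on {a..b}"
      using nf by (rule set_lebesgue_integral_eq_integral(1))
    show "norm (g n t) \<le> norm (f t)" for n t
      by (simp add: g_def)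
    show "(\<lambda>n. g n t) \<longlonglongrightarrow> 0" for t
    proof (rule tendsto_eventually)
      obtain m :: nat where "norm (f t) \<le> real m"
        using real_arch_simple by blast
      then show "\<forall>\<^sub>F n in sequentially. g n t = 0"
        unfolding eventually_sequentially g_def by (intro exI[of _ m]) auto
    qed
  qed
  then have "(\<lambda>n. integral {a..b} (g n)) \<longlonglongrightarrow> 0"
    by simp
  then have "\<forall>\<^sub>F n in sequentially. integral {a..b} (g n) < e"
    using \<open>0 < e\<close> by (rule order_tendstoD)
  then obtain n where n: "integral {a..b} (g n) < e"
    by (auto simp: eventually_sequentially)
  show ?thesis
  proof (rule that[of "real n"])
    show "(\<lambda>t. max 0 (norm (f t) - real n)) integrable_on {a..b}"
      "integral {a..b} (\<lambda>t. max 0 (norm (f t) - real n)) < e"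
      using g[THEN set_lebesgue_integral_eq_integral(1), of n] n unfolding g_def by simp_all
  qed simp
qed

text \<open>The closed intervals meet at most in end points, so the left side is the integral of g
  over their union.\<close>

lemma sum_integral_disjoint_le:
  fixes g :: "real \<Rightarrow> real"
  assumes g: "g integrable_on {a..b}" and nonneg: "\<And>t. 0 \<le> g t" and "finite I"
    and uv: "\<And>i. i \<in> I \<Longrightarrow> a \<le> u i \<and> u i \<le> v i \<and> v i \<le> b"
    and disj: "disjoint_family_on (\<lambda>i. {u i<..<v i}) I"
  shows "(\<Sum>i\<in>I. integral {u i..v i} g) \<le> integral {a..b} g"
proof -
  have gi: "g integrable_on {u i..v i}" if "i \<in> I" for i
    using integrable_on_subinterval[OF g] uv[OF that] by auto
  have "(g has_integral (\<Sum>i\<in>I. integral {u i..v i} g)) (\<Union>i\<in>I. {u i..v i})"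
  proof (rule has_integral_UN[OF \<open>finite I\<close>])
    show "(g has_integral integral {u i..v i} g) {u i..v i}" if "i \<in> I" for i
      using gi[OF that] by (rule integrable_integral)
    show "pairwise (\<lambda>i i'. negligible ({u i..v i} \<inter> {u i'..v i'})) I"
    proof (rule pairwiseI)
      fix i j assume ij: "i \<in> I" "j \<in> I" "i \<noteq> j"
      have "{u i..v i} \<inter> {u j..v j} \<subseteq> {u i, v i, u j, v j} \<union> ({u i<..<v i} \<inter> {u j<..<v j})"
        by auto
      then have "{u i..v i} \<inter> {u j..v j} \<subseteq> {u i, v i, u j, v j}"
        using disjoint_family_onD[OF disj ij] by blast
      then show "negligible ({u i..v i} \<inter> {u j..v j})"
        by (rule negligible_subset[rotated]) (rule negligible_finite, simp)
    qed
  qed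
  then show ?thesis
    by (rule has_integral_subset_le[rotated, OF _ integrable_integral[OF g]]) (use uv nonneg in force)+
qed

text \<open>By the splitting |f| \<le> C + g, the increments sum to at most C times the total length
  plus the integral of g.\<close>

lemma absolutely_continuous_on_integral:
  fixes f :: "real \<Rightarrow> complex"
  assumes f: "f absolutely_integrable_on {a..b}"
  shows "absolutely_continuous_on a b (\<lambda>t. integral {a..t} f)"
  unfolding absolutely_continuous_on_def
proof (intro allI impI)
  fix e :: real assume "0 < e"
  obtain C where C: "0 \<le> C" "(\<lambda>t. max 0 (norm (f t) - C)) integrable_on {a..b}"
    "integral {a..b} (\<lambda>t. max 0 (norm (f t) - C)) < e / 2"
    using absolutely_integrable_truncation[OF f, of "e / 2"] \<open>0 < e\<close> by auto
  define g where "g t = max 0 (norm (f t) - C)" for t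
  have g: "g integrable_on {a..b}" "integral {a..b} g < e / 2"
    using C unfolding g_def by auto
  \<comment> \<open>Chosen so that (C + 1) d = e / 2; the summand 1 covers C = 0 and makes the final
    inequality strict.\<close>
  define d where "d = e / (2 * (C + 1))"
  have "0 < d"
    using \<open>0 < e\<close> C(1) by (simp add: d_def)
  have "(\<Sum>i<k. norm (integral {a..v i} f - integral {a..u i} f)) < e"
    if uv: "\<forall>i<k. a \<le> u i \<and> u i \<le> v i \<and> v i \<le> b"
      "disjoint_family_on (\<lambda>i. {u i<..<v i}) {..<k}" "(\<Sum>i<k. v i - u i) < d"
    for k :: nat and u v
  proof -
    have *: "norm (integral {a..v i} f - integral {a..u i} f) \<le> C * (v i - u i) + integral {u i..v i} g"
      if "i < k" for i
    proof -
      have i: "a \<le> u i" "u i \<le> v i" "v i \<le> b"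
        using uv(1) that by auto
      have fi: "f integrable_on {s..t}" if "a \<le> s" "t \<le> b" for s t
        using integrable_on_subinterval[OF set_lebesgue_integral_eq_integral(1)[OF f]] that by auto
      have gi: "g integrable_on {u i..v i}"
        using integrable_on_subinterval[OF g(1)] i by auto
      have "integral {a..v i} f - integral {a..u i} f = integral {u i..v i} f"
        using Henstock_Kurzweil_Integration.integral_combine[OF i(1,2), of f] fi i by (simp add: algebra_simps)
      also have "norm \<dots> \<le> integral {u i..v i} (\<lambda>t. C + g t)"
      proof (rule integral_norm_bound_integral)
        show "(\<lambda>t. C + g t) integrable_on {u i..v i}"
          by (intro integrable_add integrable_const_ivl gi)
      qed (use fi i in \<open>auto simp: g_def\<close>)
      also have "\<dots> = C * (v i - u i) + integral {u i..v i} g"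
        using gi i by (subst Henstock_Kurzweil_Integration.integral_add) (auto simp: mult.commute)
      finally show ?thesis .
    qed
    have "(\<Sum>i<k. norm (integral {a..v i} f - integral {a..u i} f))
        \<le> (\<Sum>i<k. C * (v i - u i) + integral {u i..v i} g)"
      using * by (intro sum_mono) auto
    also have "\<dots> = C * (\<Sum>i<k. v i - u i) + (\<Sum>i<k. integral {u i..v i} g)"
      by (simp add: sum.distrib sum_distrib_left)
    also have "\<dots> \<le> C * d + integral {a..b} g"
      using uv C(1) by (intro add_mono mult_left_mono sum_integral_disjoint_le[OF g(1)]) (auto simp: g_def)
    also have "\<dots> < (C + 1) * d + e / 2"
      using g(2) \<open>0 < d\<close> by (intro add_strict_mono) auto
    also have "\<dots> = e"
      using C(1) by (simp add: d_def field_simps)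
    finally show ?thesis .
  qed
  then show "\<exists>\<delta>>0. \<forall>(k::nat) u v. (\<forall>i<k. a \<le> u i \<and> u i \<le> v i \<and> v i \<le> b) \<longrightarrow>
      disjoint_family_on (\<lambda>i. {u i<..<v i}) {..<k} \<longrightarrow> (\<Sum>i<k. v i - u i) < \<delta> \<longrightarrow>
      (\<Sum>i<k. norm (integral {a..v i} f - integral {a..u i} f)) < e"
    using \<open>0 < d\<close> by meson
qed

text \<open>Lebesgue differentiation. \<open>integrable_ccontinuous_explicit\<close> controls means
  over intervals to the right of a point; means to the left are means to the right for the reflected
  function, which is why the exceptional set is N1 together with the reflection of N2.\<close>

lemma has_vector_derivative_integral_AE:
  fixes f :: "real \<Rightarrow> complex"
  assumes f: "f absolutely_integrable_on {a..b}"
  obtains N where "negligible N"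
    "\<And>t. t \<in> {a..b} - N \<Longrightarrow> ((\<lambda>t. integral {a..t} f) has_vector_derivative f t) (at t within {a..b})"
proof -
  \<comment> \<open>Extension by zero, since the differentiation theorem asks for integrability on
    every bounded interval, also beyond [a,b].\<close>
  define f0 where "f0 t = (if t \<in> {a..b} then f t else 0)" for t
  have fi: "f integrable_on {s..t}" if "a \<le> s" "t \<le> b" for s t
    using integrable_on_subinterval[OF set_lebesgue_integral_eq_integral(1)[OF f]] that by auto
  have f0U: "f0 integrable_on UNIV"
    unfolding f0_def integrable_restrict_UNIV by (rule fi) simp_all
  then have f0: "f0 integrable_on cbox s t" for s t
    by (rule integrable_on_subcbox) simp
  have f0': "(\<lambda>t. f0 (- t)) integrable_on cbox s t" for s t
    using f0[of "- t" "- s"] integrable_reflect[where f = f0 and a = "- t" and b = "- s"] by simp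
  obtain N1 where N1: "negligible N1" "\<And>x e. \<lbrakk>x \<notin> N1; 0 < e\<rbrakk> \<Longrightarrow> \<exists>d>0. \<forall>h. 0 < h \<and> h < d \<longrightarrow>
      norm (integral (cbox x (x + h *\<^sub>R One)) f0 /\<^sub>R h ^ DIM(real) - f0 x) < e"
    using integrable_ccontinuous_explicit[of f0] f0 by blast
  obtain N2 where N2: "negligible N2" "\<And>x e. \<lbrakk>x \<notin> N2; 0 < e\<rbrakk> \<Longrightarrow> \<exists>d>0. \<forall>h. 0 < h \<and> h < d \<longrightarrow>
      norm (integral (cbox x (x + h *\<^sub>R One)) (\<lambda>t. f0 (- t)) /\<^sub>R h ^ DIM(real) - f0 (- x)) < e"
    using integrable_ccontinuous_explicit[of "\<lambda>t. f0 (- t)"] f0' by blast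
  have scale: "norm (X - h *\<^sub>R y) \<le> e * h" if "norm (X /\<^sub>R h - y) < e" "0 < h" for X y :: complex and h e :: real
  proof -
    have "X - h *\<^sub>R y = h *\<^sub>R (X /\<^sub>R h - y)"
      using that(2) by (simp add: algebra_simps)
    then have "norm (X - h *\<^sub>R y) = h * norm (X /\<^sub>R h - y)"
      using that(2) by (metis abs_of_pos norm_scaleR)
    then show ?thesis
      using that by (simp add: mult.commute mult_left_mono)
  qed
  show ?thesis
  proof (rule that[of "N1 \<union> uminus ` N2"])
    show "negligible (N1 \<union> uminus ` N2)"
      using N1(1) N2(1) by (intro negligible_Un negligible_differentiable_image_negligible) (auto intro!: derivative_intros)
    fix t assume t: "t \<in> {a..b} - (N1 \<union> uminus ` N2)"
    then have tN: "t \<notin> N1" "- t \<notin> N2" "a \<le> t" "t \<le> b"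
      by (auto simp: image_iff)
    show "((\<lambda>t. integral {a..t} f) has_vector_derivative f t) (at t within {a..b})"
      unfolding has_vector_derivative_def has_derivative_within_alt
    proof (intro conjI allI impI)
      show "bounded_linear (\<lambda>x. x *\<^sub>R f t)"
        by (rule bounded_linear_scaleR_left)
      fix e :: real assume "0 < e"
      obtain d1 where d1: "0 < d1" "\<And>h. \<lbrakk>0 < h; h < d1\<rbrakk> \<Longrightarrow>
          norm (integral {t..t + h} f0 /\<^sub>R h - f0 t) < e"
        using N1(2)[OF tN(1) \<open>0 < e\<close>] by auto
      obtain d2 where d2: "0 < d2" "\<And>h. \<lbrakk>0 < h; h < d2\<rbrakk> \<Longrightarrow>
          norm (integral {- t..- t + h} (\<lambda>t. f0 (- t)) /\<^sub>R h - f0 t) < e"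
        using N2(2)[OF tN(2) \<open>0 < e\<close>] by auto
      have "norm (integral {a..s} f - integral {a..t} f - (s - t) *\<^sub>R f t) \<le> e * norm (s - t)"
        if s: "s \<in> {a..b}" "norm (s - t) < min d1 d2" for s
      proof (cases s t rule: linorder_cases)
        case greater
        have "integral {a..s} f - integral {a..t} f = integral {t..s} f"
          using Henstock_Kurzweil_Integration.integral_combine[of a t s f] fi[of a s] greater tN s by (simp add: algebra_simps)
        also have "\<dots> = integral {t..s} f0"
          using tN s by (intro Henstock_Kurzweil_Integration.integral_cong) (auto simp: f0_def)
        finally show ?thesis
          using scale[OF d1(2)[of "s - t"]] greater s tN by (simp add: f0_def)
      next
        case less
        have "integral {a..t} f - integral {a..s} f = integral {s..t} f"
          using Henstock_Kurzweil_Integration.integral_combine[of a s t f] fi[of a t] less tN s by (simp add: algebra_simps)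
        also have "\<dots> = integral {s..t} f0"
          using tN s by (intro Henstock_Kurzweil_Integration.integral_cong) (auto simp: f0_def)
        also have "\<dots> = integral {- t..- s} (\<lambda>t. f0 (- t))"
          by simp
        finally have "norm (integral {a..t} f - integral {a..s} f - (t - s) *\<^sub>R f t) \<le> e * (t - s)"
          using scale[OF d2(2)[of "t - s"]] less s tN by (simp add: f0_def)
        moreover have "integral {a..s} f - integral {a..t} f - (s - t) *\<^sub>R f t
            = - (integral {a..t} f - integral {a..s} f - (t - s) *\<^sub>R f t)"
          by (simp add: algebra_simps)
        ultimately show ?thesis
          using less by (metis norm_minus_cancel abs_minus_commute abs_of_pos diff_gt_0_iff_gt real_norm_def)
      qed simp
      then show "\<exists>d>0. \<forall>y\<in>{a..b}. norm (y - t) < d \<longrightarrow>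
          norm (integral {a..y} f - integral {a..t} f - (y - t) *\<^sub>R f t) \<le> e * norm (y - t)"
        using d1(1) d2(1) by (intro exI[of _ "min d1 d2"]) auto
    qed
  qed
qed

text \<open>Lebesgue's fundamental theorem by means of the gauge integral. Intervals tagged outside
  N are controlled by differentiability at the tag. Those tagged in N are forced into an open set of
  small measure, so their total length is small and absolute continuity bounds the sum of their
  increments.\<close>

lemma absolutely_continuous_on_has_integral:
  fixes y y' :: "real \<Rightarrow> complex"
  assumes "a \<le> b" and ac: "absolutely_continuous_on a b y" and N: "negligible N"
    and deriv: "\<And>t. t \<in> {a..b} - N \<Longrightarrow> (y has_vector_derivative y' t) (at t within {a..b})"
  shows "(y' has_integral (y b - y a)) {a..b}"
proof -
  \<comment> \<open>With value 0 on N, a tag in N contributes to the error only the increment of y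
    over its interval.\<close>
  define g where "g t = (if t \<in> N then 0 else y' t)" for t
  have "(g has_integral (y b - y a)) {a..b}"
    unfolding has_integral_real
  proof (intro allI impI)
    fix e :: real assume "0 < e"
    \<comment> \<open>The errors at good tags add up to e1 * (b - a), which must not exceed e / 2;
      the summand 1 keeps the quotient defined for a = b.\<close>
    define e1 where "e1 = e / (2 * (b - a + 1))"
    have "0 < e1" and e1: "e1 * (b - a) \<le> e / 2"
      using \<open>0 < e\<close> \<open>a \<le> b\<close> by (auto simp: e1_def field_simps)
    obtain d where "0 < d" and d: "\<forall>(I::(real \<times> real set) set) u v. finite I \<longrightarrow>
        (\<forall>i\<in>I. a \<le> u i \<and> u i \<le> v i \<and> v i \<le> b) \<longrightarrow>
        disjoint_family_on (\<lambda>i. {u i<..<v i}) I \<longrightarrow> (\<Sum>i\<in>I. v i - u i) < d \<longrightarrow>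
        (\<Sum>i\<in>I. norm (y (v i) - y (u i))) < e / 2"
      using absolutely_continuous_on_finite[OF ac half_gt_zero[OF \<open>0 < e\<close>]]
      by (elim exE conjE) (rule that)
    obtain T where T: "open T" "N \<subseteq> T" "T - N \<in> lmeasurable" "emeasure lebesgue (T - N) < ennreal d"
      by (rule sets_lebesgue_outer_open[OF negligible_imp_sets[OF N] \<open>0 < d\<close>])
    have Tl: "T \<in> lmeasurable"
      using fmeasurable.Un[OF T(3) negligible_imp_measurable[OF N]] T(2) by (simp add: Un_absorb2)
    have "measure lebesgue T = measure lebesgue (T - N)"
      using N Tl by (simp add: measure_Diff_null_set negligible_iff_null_sets fmeasurableD)
    also have "\<dots> < d"
      using T(3,4) \<open>0 < d\<close> by (simp add: emeasure_eq_measure2 ennreal_less_iff)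
    finally have Td: "measure lebesgue T < d" .
    have "\<exists>r. t \<in> {a..b} - N \<longrightarrow> 0 < r \<and>
        (\<forall>s\<in>{a..b}. norm (s - t) < r \<longrightarrow> norm (y s - y t - (s - t) *\<^sub>R g t) \<le> e1 * norm (s - t))" for t
    proof (cases "t \<in> {a..b} - N")
      case True
      then have "(y has_derivative (\<lambda>x. x *\<^sub>R g t)) (at t within {a..b})"
        using deriv[OF True] by (simp add: has_vector_derivative_def g_def)
      then show ?thesis
        unfolding has_derivative_within_alt using \<open>0 < e1\<close> by blast
    qed auto
    then obtain r where r: "\<And>t. t \<in> {a..b} - N \<Longrightarrow> 0 < r t"
      "\<And>t s. \<lbrakk>t \<in> {a..b} - N; s \<in> {a..b}; norm (s - t) < r t\<rbrakk> \<Longrightarrow>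
        norm (y s - y t - (s - t) *\<^sub>R g t) \<le> e1 * norm (s - t)"
      by metis
    \<comment> \<open>On N the gauge is the open set T itself, of measure below d: the disjoint
      intervals tagged in N then lie in T. At the other points of [a,b] it is the ball on which the
      derivative approximates y.\<close>
    define G where "G t = (if t \<in> N then T else if t \<in> {a..b} then ball t (r t) else UNIV)" for t
    have "gauge G"
      unfolding gauge_def G_def using T(1,2) r(1) by auto
    have est: "norm ((\<Sum>(x,K)\<in>p. measure lborel K *\<^sub>R g x) - (y b - y a)) < e"
      if p: "p tagged_division_of {a..b}" and fine: "G fine p" for p
    proof -
      note pD = tagged_division_ofD[OF p]
      define u v :: "real \<times> real set \<Rightarrow> real" where "u i = Inf (snd i)" and "v i = Sup (snd i)" for i
      have K: "snd i = {u i..v i}" "fst i \<in> {u i..v i}" "a \<le> u i" "u i \<le> v i" "v i \<le> b"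
        "measure lborel (snd i) = v i - u i" "{u i..v i} \<subseteq> G (fst i)" if i: "i \<in> p" for i
      proof -
        obtain x K where xK: "i = (x, K)"
          by (cases i)
        obtain s t where st: "K = cbox s t"
          using pD(4) i xK by blast
        have "x \<in> K" "K \<subseteq> {a..b}"
          using pD(2,3) i xK by blast+
        then have "s \<le> t" "a \<le> s" "t \<le> b"
          using st by auto
        moreover have "u i = s" "v i = t"
          using \<open>s \<le> t\<close> by (simp_all add: u_def v_def xK st)
        moreover have "K \<subseteq> G x"
          using fine i xK by (auto simp: fine_def)
        ultimately show "snd i = {u i..v i}" "fst i \<in> {u i..v i}" "a \<le> u i" "u i \<le> v i" "v i \<le> b"
          "measure lborel (snd i) = v i - u i" "{u i..v i} \<subseteq> G (fst i)"
          using \<open>x \<in> K\<close> by (simp_all add: xK st)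
      qed
      have disj: "disjoint_family_on (\<lambda>i. {u i<..<v i}) p"
        unfolding disjoint_family_on_def
      proof (intro ballI impI)
        fix i j assume ij: "i \<in> p" "j \<in> p" "i \<noteq> j"
        then have "interior (snd i) \<inter> interior (snd j) = {}"
          using pD(5)[of "fst i" "snd i" "fst j" "snd j"] by auto
        then show "{u i<..<v i} \<inter> {u j<..<v j} = {}"
          using K(1) ij by simp
      qed
      define err where "err i = measure lborel (snd i) *\<^sub>R g (fst i) - (y (v i) - y (u i))" for i
      define pN where "pN = {i \<in> p. fst i \<in> N}"
      have fin: "finite p" "finite pN"
        using pD(1) by (simp_all add: pN_def)
      have good: "norm (err i) \<le> e1 * measure lborel (snd i)" if i: "i \<in> p - pN" for i
      proof -
        let ?x = "fst i"
        have ip: "i \<in> p"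
          using i by simp
        have x: "?x \<in> {a..b} - N"
          using i K[OF ip] by (auto simp: pN_def)
        then have G: "G ?x = ball ?x (r ?x)"
          by (simp add: G_def)
        have uv: "u i \<in> ball ?x (r ?x)" "v i \<in> ball ?x (r ?x)"
          using K(4,7)[OF ip] unfolding G by auto
        have 1: "norm (y (v i) - y ?x - (v i - ?x) *\<^sub>R g ?x) \<le> e1 * (v i - ?x)"
          using r(2)[OF x, of "v i"] uv(2) K[OF ip] by (simp add: dist_norm norm_minus_commute)
        have 2: "norm (y (u i) - y ?x - (u i - ?x) *\<^sub>R g ?x) \<le> e1 * (?x - u i)"
          using r(2)[OF x, of "u i"] uv(1) K[OF ip] by (simp add: dist_norm norm_minus_commute)
        \<comment> \<open>The tag lies between the end points, so the two one-sided errors have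
          bounds that add up to e1 times the length of the whole interval.\<close>
        have "err i = (y (u i) - y ?x - (u i - ?x) *\<^sub>R g ?x) - (y (v i) - y ?x - (v i - ?x) *\<^sub>R g ?x)"
          by (simp add: err_def K(6)[OF ip] algebra_simps)
        also have "norm \<dots> \<le> e1 * (?x - u i) + e1 * (v i - ?x)"
          by (rule order_trans[OF norm_triangle_ineq4 add_mono[OF 2 1]])
        also have "\<dots> = e1 * measure lborel (snd i)"
          by (simp add: K(6)[OF ip] algebra_simps)
        finally show ?thesis .
      qed
      have "(\<Sum>i\<in>p - pN. norm (err i)) \<le> (\<Sum>i\<in>p - pN. e1 * measure lborel (snd i))"
        by (intro sum_mono good)
      also have "\<dots> \<le> (\<Sum>i\<in>p. e1 * measure lborel (snd i))"
        using fin \<open>0 < e1\<close> by (intro sum_mono2) auto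
      also have "\<dots> = e1 * (b - a)"
        using additive_content_tagged_division[of p a b] p \<open>a \<le> b\<close>
        by (simp add: sum_distrib_left[symmetric] case_prod_unfold)
      finally have 1: "(\<Sum>i\<in>p - pN. norm (err i)) \<le> e / 2"
        using e1 by simp
      have "(\<Sum>i\<in>pN. norm (y (v i) - y (u i))) < e / 2"
      proof (rule d[rule_format, OF fin(2)])
        show dN: "disjoint_family_on (\<lambda>i. {u i<..<v i}) pN"
          using disj by (rule disjoint_family_on_mono[rotated]) (simp add: pN_def)
        show "a \<le> u i \<and> u i \<le> v i \<and> v i \<le> b" if "i \<in> pN" for i
          using K that by (simp add: pN_def)
        have "(\<Sum>i\<in>pN. v i - u i) = (\<Sum>i\<in>pN. measure lebesgue {u i<..<v i})"
          using K(4) by (intro sum.cong) (auto simp: pN_def)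
        also have "\<dots> = measure lebesgue (\<Union>i\<in>pN. {u i<..<v i})"
        proof (rule measure_finite_Union[symmetric, OF fin(2) _ dN])
          show "emeasure lebesgue {u i<..<v i} \<noteq> \<infinity>" if "i \<in> pN" for i
            using K(4)[of i] that by (simp add: pN_def)
        qed auto
        also have "\<dots> \<le> measure lebesgue T"
        proof (rule measure_mono_fmeasurable[OF _ _ Tl])
          show "(\<Union>i\<in>pN. {u i<..<v i}) \<subseteq> T"
          proof (rule UN_least)
            fix i assume "i \<in> pN"
            then have "{u i..v i} \<subseteq> T"
              using K(7)[of i] by (simp add: pN_def G_def)
            then show "{u i<..<v i} \<subseteq> T"
              by force
          qed
          show "(\<Union>i\<in>pN. {u i<..<v i}) \<in> sets lebesgue"
            using fin(2) by (intro sets.finite_UN) auto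
        qed
        finally show "(\<Sum>i\<in>pN. v i - u i) < d"
          using Td by simp
      qed
      moreover have "(\<Sum>i\<in>pN. norm (err i)) = (\<Sum>i\<in>pN. norm (y (v i) - y (u i)))"
        by (intro sum.cong) (auto simp: err_def pN_def g_def norm_minus_commute)
      ultimately have 2: "(\<Sum>i\<in>pN. norm (err i)) < e / 2"
        by simp
      have "(\<Sum>(x,K)\<in>p. measure lborel K *\<^sub>R g x) - (y b - y a) = (\<Sum>i\<in>p. err i)"
        using additive_tagged_division_1[OF \<open>a \<le> b\<close> p, of y]
        by (simp add: err_def sum_subtractf case_prod_unfold u_def v_def)
      also have "norm \<dots> \<le> (\<Sum>i\<in>p. norm (err i))"
        by (rule norm_sum)
      also have "\<dots> = (\<Sum>i\<in>p - pN. norm (err i)) + (\<Sum>i\<in>pN. norm (err i))"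
        using fin by (intro sum.subset_diff) (auto simp: pN_def)
      finally show ?thesis
        using 1 2 by simp
    qed
    show "\<exists>\<gamma>. gauge \<gamma> \<and> (\<forall>\<D>. \<D> tagged_division_of {a..b} \<and> \<gamma> fine \<D> \<longrightarrow>
        norm ((\<Sum>(x,k)\<in>\<D>. measure lborel k *\<^sub>R g x) - (y b - y a)) < e)"
    proof (intro exI[of _ G] conjI allI impI \<open>gauge G\<close>)
      fix D assume "D tagged_division_of {a..b} \<and> G fine D"
      then show "norm ((\<Sum>(x,k)\<in>D. measure lborel k *\<^sub>R g x) - (y b - y a)) < e"
        by (intro est) simp_all
    qed
  qed
  then show ?thesis
    by (rule has_integral_spike[OF N, rotated]) (simp add: g_def)
qed

lemma absolutely_continuous_on_subset:
  assumes "absolutely_continuous_on a b f" "a \<le> c" "d \<le> b"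
  shows "absolutely_continuous_on c d f"
  unfolding absolutely_continuous_on_def
proof (intro allI impI)
  fix e :: real assume "0 < e"
  obtain r where r: "0 < r" "\<forall>(k::nat) u v. (\<forall>i<k. a \<le> u i \<and> u i \<le> v i \<and> v i \<le> b) \<longrightarrow>
      disjoint_family_on (\<lambda>i. {u i<..<v i}) {..<k} \<longrightarrow> (\<Sum>i<k. v i - u i) < r \<longrightarrow>
      (\<Sum>i<k. norm (f (v i) - f (u i))) < e"
    using assms(1)[unfolded absolutely_continuous_on_def, THEN spec, THEN mp, OF \<open>0 < e\<close>]
    by (elim exE conjE) (rule that)
  show "\<exists>\<delta>>0. \<forall>(k::nat) u v. (\<forall>i<k. c \<le> u i \<and> u i \<le> v i \<and> v i \<le> d) \<longrightarrow>
      disjoint_family_on (\<lambda>i. {u i<..<v i}) {..<k} \<longrightarrow> (\<Sum>i<k. v i - u i) < \<delta> \<longrightarrow>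
      (\<Sum>i<k. norm (f (v i) - f (u i))) < e"
  proof (intro exI[of _ r] conjI allI impI r(1))
    fix k :: nat and u v
    assume uv: "\<forall>i<k. c \<le> u i \<and> u i \<le> v i \<and> v i \<le> d"
      "disjoint_family_on (\<lambda>i. {u i<..<v i}) {..<k}" "(\<Sum>i<k. v i - u i) < r"
    have "a \<le> u i \<and> u i \<le> v i \<and> v i \<le> b" if "i < k" for i
      using uv(1) that assms(2,3) by fastforce
    then show "(\<Sum>i<k. norm (f (v i) - f (u i))) < e"
      using uv(2,3) by (intro r(2)[rule_format]) simp_all
  qed
qed

section \<open>Lebesgue norms\<close>

lemma absolutely_integrable_iff_integrable_lebesgue_on:
  fixes f :: "real \<Rightarrow> 'b::euclidean_space"
  shows "f absolutely_integrable_on {a..b} \<longleftrightarrow> integrable (lebesgue_on {a..b}) f"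
  by (simp add: set_integrable_def integrable_restrict_space)

lemma Lp_fun_top_norm_le:
  assumes "f \<in> borel_measurable M" "AE t in M. norm (f t) \<le> C" "0 \<le> C" "emeasure M (space M) \<noteq> 0"
  shows "Lp_fun \<infinity> M f" "Lp_fun_norm \<infinity> M f \<le> C"
proof -
  have [measurable]: "f \<in> borel_measurable M"
    by fact
  have "esssup M (\<lambda>t. ereal (norm (f t))) \<le> ereal C"
    using assms(2) by (intro esssup_I) auto
  then show "Lp_fun \<infinity> M f" "Lp_fun_norm \<infinity> M f \<le> C"
    using assms(1,3) by (auto simp: Lp_fun_def Lp_fun_norm_def real_le_ereal_iff)
qed

text \<open>On a space of positive measure the essential supremum of a nonnegative function cannot
  be negative, so it is a real number and survives the conversion
  \<open>real_of_ereal\<close>.\<close>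

lemma Lp_fun_top_AE:
  assumes "Lp_fun \<infinity> M f" "emeasure M (space M) \<noteq> 0"
  shows "AE t in M. norm (f t) \<le> Lp_fun_norm \<infinity> M f" "0 \<le> Lp_fun_norm \<infinity> M f"
proof -
  let ?s = "esssup M (\<lambda>t. ereal (norm (f t)))"
  have AE: "AE t in M. ereal (norm (f t)) \<le> ?s"
    by (rule esssup_AE)
  have fin: "?s < \<infinity>"
    using assms(1) by (simp add: Lp_fun_def)
  have nn: "0 \<le> ?s"
  proof (rule ccontr)
    assume "\<not> 0 \<le> ?s"
    then have "AE t in M. False"
      using AE by (auto elim!: eventually_mono) (meson ereal_less_eq(5) norm_ge_zero order_trans)
    then show False
      using assms(2) by (simp add: eventually_False ae_filter_eq_bot_iff)
  qed
  obtain c where c: "?s = ereal c"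
    using fin nn by (cases ?s) auto
  show "AE t in M. norm (f t) \<le> Lp_fun_norm \<infinity> M f"
    using AE unfolding c by (simp add: Lp_fun_norm_def c)
  show "0 \<le> Lp_fun_norm \<infinity> M f"
    using nn by (simp add: Lp_fun_norm_def c)
qed

section \<open>Quasi-norm properties of L_p on a bounded interval\<close>

context
  fixes a b :: real and p :: ennreal and M :: "real measure"
  assumes ab: "a < b" and p: "1 \<le> p" and M_def: "M = lebesgue_on {a..b}"
begin

lemma emeasure_interval_nonzero: "emeasure M (space M) \<noteq> 0"
  using ab by (simp add: M_def space_restrict_space emeasure_restrict_space)

lemma finite_exponent_ge_1: "p \<noteq> \<infinity> \<Longrightarrow> 1 \<le> enn2real p"
  using p by (metis enn2real_1 enn2real_mono ennreal_top_neq_one infinity_ennreal_def top.not_eq_extremum)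

lemma Lp_fun_measurable: "Lp_fun p M f \<Longrightarrow> f \<in> borel_measurable M"
  by (simp add: Lp_fun_def)

lemma Lp_fun_norm_nonneg: "Lp_fun p M f \<Longrightarrow> 0 \<le> Lp_fun_norm p M f"
  using Lp_fun_top_AE(2)[OF _ emeasure_interval_nonzero] by (cases "p = \<infinity>") (auto simp: Lp_fun_norm_def)

text \<open>One domination principle serves bounded functions and products with bounded factors,
  giving the norm estimate along with membership. For finite exponent q the factor passes through
  because (C^q)^(1/q) = C.\<close>

lemma Lp_fun_mono:
  assumes f: "Lp_fun p M f" and g: "g \<in> borel_measurable M"
    and le: "AE t in M. norm (g t) \<le> C * norm (f t)" and "0 \<le> C"
  shows "Lp_fun p M g" "Lp_fun_norm p M g \<le> C * Lp_fun_norm p M f"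
proof -
  have "Lp_fun p M g \<and> Lp_fun_norm p M g \<le> C * Lp_fun_norm p M f"
  proof (cases "p = \<infinity>")
    case True
    have "AE t in M. norm (g t) \<le> C * Lp_fun_norm p M f"
      using le Lp_fun_top_AE(1)[OF f[unfolded True] emeasure_interval_nonzero]
      by eventually_elim (metis True \<open>0 \<le> C\<close> mult_left_mono order_trans)
    then show ?thesis
      using Lp_fun_top_norm_le[OF g _ _ emeasure_interval_nonzero] Lp_fun_norm_nonneg[OF f] \<open>0 \<le> C\<close> True by simp
  next
    case False
    define q where "q = enn2real p"
    have q: "1 \<le> q"
      using finite_exponent_ge_1[OF False] by (simp add: q_def)
    have fi: "integrable M (\<lambda>t. norm (f t) powr q)"
      using f False by (simp add: Lp_fun_def q_def)
    have le': "AE t in M. norm (g t) powr q \<le> C powr q * norm (f t) powr q"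
      using le by eventually_elim
        (use q \<open>0 \<le> C\<close> in \<open>simp add: powr_mult[symmetric] powr_mono2\<close>)
    have gi: "integrable M (\<lambda>t. norm (g t) powr q)"
    proof (rule Bochner_Integration.integrable_bound)
      show "integrable M (\<lambda>t. C powr q * norm (f t) powr q)"
        using fi by simp
      show "(\<lambda>t. norm (g t) powr q) \<in> borel_measurable M"
        using g by measurable
    qed (use le' in simp)
    have "(\<integral>t. norm (g t) powr q \<partial>M) \<le> C powr q * (\<integral>t. norm (f t) powr q \<partial>M)"
      using integral_mono_AE[OF gi _ le'] fi by simp
    then have "(\<integral>t. norm (g t) powr q \<partial>M) powr (1 / q) \<le> (C powr q * (\<integral>t. norm (f t) powr q \<partial>M)) powr (1 / q)"
      using q by (intro powr_mono2) auto
    also have "\<dots> = C * (\<integral>t. norm (f t) powr q \<partial>M) powr (1 / q)"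
      using q \<open>0 \<le> C\<close> by (subst powr_mult) (auto simp: powr_powr)
    finally show ?thesis
      using gi g False by (simp add: Lp_fun_def Lp_fun_norm_def q_def)
  qed
  then show "Lp_fun p M g" "Lp_fun_norm p M g \<le> C * Lp_fun_norm p M f"
    by auto
qed

text \<open>Boundedness of operators only needs a quasi-norm; the constant \<open>4\<close> spares Minkowski's inequality.\<close>

lemma Lp_fun_add:
  assumes f: "Lp_fun p M f" and g: "Lp_fun p M g"
  shows "Lp_fun p M (\<lambda>t. f t + g t)"
    "Lp_fun_norm p M (\<lambda>t. f t + g t) \<le> 4 * (Lp_fun_norm p M f + Lp_fun_norm p M g)"
proof -
  have meas: "(\<lambda>t. f t + g t) \<in> borel_measurable M"
    using Lp_fun_measurable[OF f] Lp_fun_measurable[OF g] by measurable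
  have "Lp_fun p M (\<lambda>t. f t + g t) \<and>
      Lp_fun_norm p M (\<lambda>t. f t + g t) \<le> 4 * (Lp_fun_norm p M f + Lp_fun_norm p M g)"
  proof (cases "p = \<infinity>")
    case True
    have nn: "0 \<le> Lp_fun_norm p M f" "0 \<le> Lp_fun_norm p M g"
      using Lp_fun_norm_nonneg f g by auto
    have "AE t in M. norm (f t + g t) \<le> Lp_fun_norm p M f + Lp_fun_norm p M g"
      using Lp_fun_top_AE(1)[OF f[unfolded True] emeasure_interval_nonzero] Lp_fun_top_AE(1)[OF g[unfolded True] emeasure_interval_nonzero]
      by eventually_elim (metis True add_mono norm_triangle_le)
    then show ?thesis
      using Lp_fun_top_norm_le[OF meas _ _ emeasure_interval_nonzero, of "Lp_fun_norm p M f + Lp_fun_norm p M g"] nn True by simp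
  next
    case False
    define q where "q = enn2real p"
    have q: "1 \<le> q"
      using finite_exponent_ge_1[OF False] by (simp add: q_def)
    define I where "I h = (\<integral>t. norm (h t) powr q \<partial>M)" for h :: "real \<Rightarrow> complex"
    have I0: "0 \<le> I h" for h
      by (simp add: I_def)
    have fi: "integrable M (\<lambda>t. norm (f t) powr q)" and gi: "integrable M (\<lambda>t. norm (g t) powr q)"
      using f g False by (simp_all add: Lp_fun_def q_def)
    have le: "norm (f t + g t) powr q \<le> 2 powr q * (norm (f t) powr q + norm (g t) powr q)" for t
    proof -
      \<comment> \<open>Estimating the sum by twice the maximum makes the power distribute over the
        two summands.\<close>
      have "norm (f t + g t) powr q \<le> (2 * max (norm (f t)) (norm (g t))) powr q"
        using q norm_triangle_ineq[of "f t" "g t"] by (intro powr_mono2) (auto simp: max_def)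
      also have "\<dots> = 2 powr q * max (norm (f t)) (norm (g t)) powr q"
        by (simp add: powr_mult)
      also have "\<dots> \<le> 2 powr q * (norm (f t) powr q + norm (g t) powr q)"
        by (intro mult_left_mono) (auto simp: max_def)
      finally show ?thesis .
    qed
    have int: "integrable M (\<lambda>t. 2 powr q * (norm (f t) powr q + norm (g t) powr q))"
      using fi gi by simp
    have si: "integrable M (\<lambda>t. norm (f t + g t) powr q)"
    proof (rule Bochner_Integration.integrable_bound[OF int])
      show "(\<lambda>t. norm (f t + g t) powr q) \<in> borel_measurable M"
        using meas by measurable
    qed (use le in simp)
    have "I (\<lambda>t. f t + g t) \<le> 2 powr q * (I f + I g)"
      using integral_mono[OF si int le] fi gi by (simp add: I_def)
    also have "\<dots> \<le> 2 powr q * (2 * max (I f) (I g))"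
      by (intro mult_left_mono) auto
    finally have "I (\<lambda>t. f t + g t) powr (1 / q) \<le> (2 powr q * (2 * max (I f) (I g))) powr (1 / q)"
      using q I0 by (intro powr_mono2) auto
    also have "\<dots> = 2 * (2 powr (1 / q) * max (I f) (I g) powr (1 / q))"
      using q I0 by (simp add: powr_mult powr_powr le_max_iff_disj)
    \<comment> \<open>Here 2^(1/q) \<le> 2 since q \<ge> 1. One factor 2 stems from the pointwise
      estimate, the other from I f + I g \<le> 2 max; together they make up the 4.\<close>
    also have "\<dots> \<le> 2 * (2 * max (I f) (I g) powr (1 / q))"
    proof -
      have "2 powr (1 / q) \<le> (2::real) powr 1"
        using q by (intro powr_mono) auto
      then show ?thesis
        by (intro mult_left_mono mult_right_mono) auto
    qed
    also have "\<dots> \<le> 4 * (I f powr (1 / q) + I g powr (1 / q))"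
      by (simp add: max_def)
    finally show ?thesis
      using si meas False by (simp add: Lp_fun_def Lp_fun_norm_def q_def I_def)
  qed
  then show "Lp_fun p M (\<lambda>t. f t + g t)"
    "Lp_fun_norm p M (\<lambda>t. f t + g t) \<le> 4 * (Lp_fun_norm p M f + Lp_fun_norm p M g)"
    by auto
qed

lemma Lp_fun_bounded:
  assumes "f \<in> borel_measurable M" "\<And>t. t \<in> {a..b} \<Longrightarrow> norm (f t) \<le> C"
  shows "Lp_fun p M f"
proof -
  have "Lp_fun p M (\<lambda>t. 1)"
  proof (cases "p = \<infinity>")
    case True
    then show ?thesis
      using Lp_fun_top_norm_le(1)[of "\<lambda>_. 1" M 1] emeasure_interval_nonzero by simp
  next
    case False
    then show ?thesis
      by (simp add: Lp_fun_def M_def)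
  qed
  moreover have "AE t in M. norm (f t) \<le> \<bar>C\<bar> * norm (1::complex)"
  proof (rule AE_I2)
    fix t assume "t \<in> space M"
    then show "norm (f t) \<le> \<bar>C\<bar> * norm (1::complex)"
      using assms(2)[of t] by (simp add: M_def space_restrict_space)
  qed
  ultimately show ?thesis
    using Lp_fun_mono(1)[of "\<lambda>_. 1" f "\<bar>C\<bar>"] assms(1) by simp
qed

text \<open>For x = |f| / N with N the norm of f, the elementary bound x \<le> 1 + x^q integrates to
  (b - a) + 1, which explains the constant. Since N is a divisor, N = 0 is separate: then f vanishes
  almost everywhere.\<close>

lemma Lp_fun_integrable:
  assumes f: "Lp_fun p M f"
  shows "integrable M f" "(\<integral>t. norm (f t) \<partial>M) \<le> (b - a + 1) * Lp_fun_norm p M f"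
proof -
  have meas: "f \<in> borel_measurable M"
    using f by (rule Lp_fun_measurable)
  have one: "integrable M (\<lambda>t. c :: real)" "(\<integral>t. c \<partial>M) = (b - a) * c" for c
    using ab by (simp_all add: M_def measure_restrict_space space_restrict_space)
  define N where "N = Lp_fun_norm p M f"
  have N0: "0 \<le> N"
    using Lp_fun_norm_nonneg[OF f] by (simp add: N_def)
  have "integrable M (\<lambda>t. norm (f t)) \<and> (\<integral>t. norm (f t) \<partial>M) \<le> (b - a + 1) * N"
  proof (cases "p = \<infinity>")
    case True
    have AE: "AE t in M. norm (f t) \<le> N"
      using Lp_fun_top_AE(1)[OF f[unfolded True] emeasure_interval_nonzero] True by (simp add: N_def)
    have i: "integrable M (\<lambda>t. norm (f t))"
      by (rule Bochner_Integration.integrable_bound[OF one(1)[of N]]) (use meas AE N0 in auto)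
    then show ?thesis
      using integral_mono_AE[OF i one(1) AE] one(2)[of N] N0 by (simp add: algebra_simps)
  next
    case False
    define q where "q = enn2real p"
    have q: "1 \<le> q"
      using finite_exponent_ge_1[OF False] by (simp add: q_def)
    have fi: "integrable M (\<lambda>t. norm (f t) powr q)"
      using f False by (simp add: Lp_fun_def q_def)
    have N: "N = (\<integral>t. norm (f t) powr q \<partial>M) powr (1 / q)"
      using False by (simp add: N_def Lp_fun_norm_def q_def)
    then have Nq: "N powr q = (\<integral>t. norm (f t) powr q \<partial>M)"
      using q by (simp add: powr_powr)
    show ?thesis
    proof (cases "N = 0")
      case True
      then have "AE t in M. norm (f t) powr q = 0"
        using integral_nonneg_eq_0_iff_AE[OF fi] Nq q by simp
      then have AE: "AE t in M. norm (f t) = 0"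
        by eventually_elim simp
      have i: "integrable M (\<lambda>t. norm (f t))"
        by (rule Bochner_Integration.integrable_bound[OF one(1)[of 0]]) (use meas AE in auto)
      moreover have "(\<integral>t. norm (f t) \<partial>M) = 0"
        using integral_nonneg_eq_0_iff_AE[OF i] AE by simp
      ultimately show ?thesis
        using True by simp
    next
      case False
      then have "0 < N"
        using N0 by simp
      have le: "norm (f t) \<le> N * (1 + norm (f t) powr q / N powr q)" for t
      proof -
        define x where "x = norm (f t) / N"
        have "0 \<le> x"
          using N0 by (simp add: x_def)
        have "x \<le> 1 + x powr q"
        proof (cases "x \<le> 1")
          case False
          then have "x powr 1 \<le> x powr q"
            using q by (intro powr_mono) auto
          then show ?thesis
            using \<open>0 \<le> x\<close> by simp
        qed (use \<open>0 \<le> x\<close> in \<open>simp add: add_increasing2\<close>)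
        then have "N * x \<le> N * (1 + x powr q)"
          using N0 by (rule mult_left_mono)
        then show ?thesis
          using \<open>0 < N\<close> by (simp add: x_def powr_divide)
      qed
      have int: "integrable M (\<lambda>t. N * (1 + norm (f t) powr q / N powr q))"
        using fi one(1)[of 1] by simp
      have i: "integrable M (\<lambda>t. norm (f t))"
        by (rule Bochner_Integration.integrable_bound[OF int]) (use meas le N0 in auto)
      have "(\<integral>t. norm (f t) \<partial>M) \<le> (\<integral>t. N * (1 + norm (f t) powr q / N powr q) \<partial>M)"
        using i int le by (rule integral_mono)
      also have "\<dots> = N * ((b - a) + (\<integral>t. norm (f t) powr q \<partial>M) / N powr q)"
        using fi one(1)[of 1] one(2)[of 1] by simp
      also have "\<dots> = (b - a + 1) * N"
        using \<open>0 < N\<close> unfolding Nq[symmetric] by (simp add: algebra_simps)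
      finally show ?thesis
        using i by simp
    qed
  qed
  then show "integrable M f" "(\<integral>t. norm (f t) \<partial>M) \<le> (b - a + 1) * Lp_fun_norm p M f"
    using integrable_norm_cancel[of M f] meas by (auto simp: N_def)
qed

end

lemma Lp_fun_1_iff: "Lp_fun 1 M f \<longleftrightarrow> integrable M f"
  by (auto simp: Lp_fun_def integrable_norm_iff)

section \<open>Sobolev classes as iterated primitives\<close>

lemma AE_lebesgue_iff_negligible: "(AE t in lebesgue. P t) \<longleftrightarrow> negligible {t. \<not> P t}"
  by (auto simp: eventually_ae_filter negligible_iff_null_sets[symmetric] intro: negligible_subset)

lemma class_on_eq_iff:
  "class_on a b f = class_on a b g \<longleftrightarrow> (AE t in lebesgue. t \<in> {a..b} \<longrightarrow> f t = g t)"
proof -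
  have "((if t \<in> {a..b} then f t else 0) = (if t \<in> {a..b} then g t else 0)) \<longleftrightarrow>
      (t \<in> {a..b} \<longrightarrow> f t = g t)" for t
    by auto
  then show ?thesis
    unfolding class_on_def aefun.abs_eq_iff by simp
qed

lemma class_on_cong: "(\<And>t. t \<in> {a..b} \<Longrightarrow> f t = g t) \<Longrightarrow> class_on a b f = class_on a b g"
  by (simp add: class_on_eq_iff)

lemma class_on_zero: "class_on a b (\<lambda>_. 0) = 0"
  by (simp add: class_on_def zero_aefun_def)

lemma class_on_plus: "class_on a b f + class_on a b g = class_on a b (\<lambda>t. f t + g t)"
  unfolding class_on_def plus_aefun.abs_eq by (rule arg_cong[of _ _ abs_aefun]) auto

lemma class_on_times: "class_on a b f * class_on a b g = class_on a b (\<lambda>t. f t * g t)"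
  unfolding class_on_def times_aefun.abs_eq by (rule arg_cong[of _ _ abs_aefun]) auto

lemma class_on_scaleC: "c *\<^sub>C class_on a b f = class_on a b (\<lambda>t. c * f t)"
  unfolding class_on_def scaleC_aefun.abs_eq by (rule arg_cong[of _ _ abs_aefun]) auto

text \<open>A chosen representative is arbitrary on a null set and need not vanish outside [a,b] at
  every point; for integrals this equality almost everywhere is enough.\<close>

lemma rep_class_on:
  "AE t in lebesgue. rep_aefun (class_on a b f) t = (if t \<in> {a..b} then f t else 0)"
proof -
  have "abs_aefun (rep_aefun (class_on a b f)) = class_on a b f"
    by (rule Quotient3_abs_rep[OF Quotient3_aefun])
  also have "\<dots> = abs_aefun (\<lambda>t. if t \<in> {a..b} then f t else 0)"
    by (simp add: class_on_def)
  finally show ?thesis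
    unfolding aefun.abs_eq_iff .
qed

lemma Lp_fun_cong:
  assumes eq: "\<And>t. t \<in> space M \<Longrightarrow> f t = g t"
  shows "Lp_fun p M f = Lp_fun p M g" "Lp_fun_norm p M f = Lp_fun_norm p M g"
proof -
  have m: "f \<in> borel_measurable M \<longleftrightarrow> g \<in> borel_measurable M"
    "(\<lambda>t. ereal (norm (f t))) \<in> borel_measurable M \<longleftrightarrow> (\<lambda>t. ereal (norm (g t))) \<in> borel_measurable M"
    using eq by (auto intro!: measurable_cong)
  have s: "esssup M (\<lambda>t. ereal (norm (f t))) = esssup M (\<lambda>t. ereal (norm (g t)))"
    unfolding esssup_def m(2) using eq by (auto intro!: Limsup_eq AE_I2)
  have i: "integrable M (\<lambda>t. norm (f t) powr q) = integrable M (\<lambda>t. norm (g t) powr q)"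
    "(\<integral>t. norm (f t) powr q \<partial>M) = (\<integral>t. norm (g t) powr q \<partial>M)" for q
    using eq by (auto intro!: Bochner_Integration.integrable_cong Bochner_Integration.integral_cong)
  show "Lp_fun p M f = Lp_fun p M g" "Lp_fun_norm p M f = Lp_fun_norm p M g"
    unfolding Lp_fun_def Lp_fun_norm_def m s i by simp_all
qed

lemma Lp_fun_AE_cong:
  assumes f: "Lp_fun p M f" and g: "g \<in> borel_measurable M" and eq: "AE t in M. f t = g t"
  shows "Lp_fun p M g"
proof -
  have [measurable]: "f \<in> borel_measurable M" "g \<in> borel_measurable M"
    using f g by (simp_all add: Lp_fun_def)
  have "esssup M (\<lambda>t. ereal (norm (f t))) = esssup M (\<lambda>t. ereal (norm (g t)))"
    using eq by (intro esssup_AE_cong) (auto elim: eventually_mono)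
  moreover have "integrable M (\<lambda>t. norm (f t) powr q) = integrable M (\<lambda>t. norm (g t) powr q)" for q
    using eq by (intro integrable_cong_AE) (auto elim: eventually_mono)
  ultimately show ?thesis
    using f g by (simp add: Lp_fun_def split: if_splits)
qed

lemma Lp_norm_class_on: "Lp_norm p a b (class_on a b f) = Lp_fun_norm p (lebesgue_on {a..b}) f"
  unfolding class_on_def Lp_norm.abs_eq by (rule Lp_fun_cong(2)) (simp add: space_restrict_space)

lemma deriv_on_cong:
  assumes "\<And>t. t \<in> {a..b} \<Longrightarrow> f t = g t" "t \<in> {a..b}"
  shows "deriv_on a b f t = deriv_on a b g t"
proof -
  have "(f has_vector_derivative D) (at t within {a..b}) \<longleftrightarrow> (g has_vector_derivative D) (at t within {a..b})" for D
    unfolding has_vector_derivative_def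
    using assms by (intro iffI; elim has_derivative_transform[rotated 2]) auto
  then show ?thesis
    by (simp add: deriv_on_def vector_derivative_def)
qed

lemma deriv_on_funpow_cong:
  assumes "\<And>t. t \<in> {a..b} \<Longrightarrow> f t = g t" "t \<in> {a..b}"
  shows "(deriv_on a b ^^ s) f t = (deriv_on a b ^^ s) g t"
  using assms(2)
proof (induction s arbitrary: t)
  case (Suc s)
  then show ?case
    using deriv_on_cong[of a b "(deriv_on a b ^^ s) f" "(deriv_on a b ^^ s) g" t] by simp
qed (simp add: assms(1))

lemma differentiable_within_cong:
  fixes f g :: "real \<Rightarrow> complex"
  assumes "\<And>t. t \<in> S \<Longrightarrow> f t = g t" "t \<in> S" "f differentiable (at t within S)"
  shows "g differentiable (at t within S)"
  using assms has_derivative_transform[of t S g f] unfolding differentiable_def by auto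

text \<open>Derivatives within [a,b] see only values there. This permits replacing the derivative of
  a primitive by its integrand, with which it agrees on [a,b].\<close>

lemma sobolev_fun_cong:
  assumes y: "sobolev_fun p l a b y" and eq: "\<And>t. t \<in> {a..b} \<Longrightarrow> y t = z t"
  shows "sobolev_fun p l a b z"
proof -
  have eqs: "(deriv_on a b ^^ s) y t = (deriv_on a b ^^ s) z t" if "t \<in> {a..b}" for s t
    using deriv_on_funpow_cong[OF eq that] .
  have diff: "(deriv_on a b ^^ s) z differentiable (at t within {a..b})"
    if "(deriv_on a b ^^ s) y differentiable (at t within {a..b})" "t \<in> {a..b}" for s t
    using differentiable_within_cong[OF eqs that(2,1)] .
  show ?thesis
    unfolding sobolev_fun_def
  proof (intro conjI)
    show "Ck_on (l - 1) a b z"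
      unfolding Ck_on_def
    proof (intro conjI allI impI ballI)
      show "(deriv_on a b ^^ s) z differentiable (at t within {a..b})" if "s < l - 1" "t \<in> {a..b}" for s t
        using y that by (intro diff) (auto simp: sobolev_fun_def Ck_on_def)
      show "continuous_on {a..b} ((deriv_on a b ^^ s) z)" if "s \<le> l - 1" for s
      proof -
        have "continuous_on {a..b} ((deriv_on a b ^^ s) y)"
          using y that by (simp add: sobolev_fun_def Ck_on_def)
        then show ?thesis
          by (rule continuous_on_eq) (rule eqs)
      qed
    qed
    show "absolutely_continuous_on a b ((deriv_on a b ^^ (l - 1)) z)"
    proof (rule absolutely_continuous_on_cong_diff)
      show "absolutely_continuous_on a b ((deriv_on a b ^^ (l - 1)) y)"
        using y by (simp add: sobolev_fun_def)
    qed (simp only: eqs)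
    show "AE t in lebesgue_on {a..b}. (deriv_on a b ^^ (l - 1)) z differentiable (at t within {a..b})"
    proof -
      have "AE t in lebesgue_on {a..b}. t \<in> {a..b} \<and> (deriv_on a b ^^ (l - 1)) y differentiable (at t within {a..b})"
        using y by (auto simp: sobolev_fun_def AE_restrict_space_iff)
      then show ?thesis
        by (rule eventually_mono) (elim conjE, rule diff)
    qed
    show "Lp_fun p (lebesgue_on {a..b}) ((deriv_on a b ^^ l) z)"
      using y Lp_fun_cong(1)[of "lebesgue_on {a..b}" "(deriv_on a b ^^ l) y" "(deriv_on a b ^^ l) z" p] eqs
      by (simp add: sobolev_fun_def space_restrict_space)
  qed
qed

text \<open>The first derivative is split off, not the last, so that an induction can pass from y to
  its derivative.\<close>

lemma Ck_on_Suc: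
  "Ck_on (Suc k) a b y \<longleftrightarrow> (\<forall>t\<in>{a..b}. y differentiable (at t within {a..b})) \<and>
    continuous_on {a..b} y \<and> Ck_on k a b (deriv_on a b y)"
  unfolding Ck_on_def less_Suc_eq_le[symmetric] All_less_Suc2 funpow_Suc_right by auto

text \<open>The recursion starts at order 2: for order 1 the derivative is only an L_p function,
  known almost everywhere. This is why the passage between orders l and l + 1 treats l = 0
  separately.\<close>

lemma sobolev_fun_Suc_Suc:
  "sobolev_fun p (Suc (Suc l)) a b y \<longleftrightarrow> (\<forall>t\<in>{a..b}. y differentiable (at t within {a..b})) \<and>
    continuous_on {a..b} y \<and> sobolev_fun p (Suc l) a b (deriv_on a b y)"
  unfolding sobolev_fun_def diff_Suc_1 Ck_on_Suc funpow_Suc_right o_def by auto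

lemma sobolev_fun_imp_continuous_on: "sobolev_fun p l a b y \<Longrightarrow> continuous_on {a..b} y"
  unfolding sobolev_fun_def Ck_on_def by (metis funpow_0 zero_le)

locale sobolev_interval =
  fixes a b :: real and p :: ennreal
  assumes ab: "a < b" and p: "1 \<le> p"
begin

abbreviation "leb \<equiv> lebesgue_on {a..b}"
abbreviation "cl \<equiv> class_on a b"
abbreviation "W l \<equiv> sobolev p l a b"
abbreviation "L1 \<equiv> Lp 1 a b"

text \<open>The operator J. The choice made by \<open>rep_aefun\<close> is harmless because
  integrals ignore null sets.\<close>

definition prim :: "aefun \<Rightarrow> aefun"
  where "prim D = cl (\<lambda>t. integral {a..t} (rep_aefun D))"

text \<open>Initial values of higher order need no definition of their own: they are
  \<open>init\<close> of derivative classes.\<close>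

definition init :: "aefun \<Rightarrow> complex"
  where "init Y = cont_rep a b Y a"

lemmas Lp_leb_norm_nonneg = Lp_fun_norm_nonneg[OF ab p refl]
lemmas Lp_leb_mono = Lp_fun_mono[OF ab p refl]
lemmas Lp_leb_add = Lp_fun_add[OF ab p refl]
lemmas Lp_leb_bounded = Lp_fun_bounded[OF ab p refl]
lemmas Lp_leb_integrable = Lp_fun_integrable[OF ab p refl]

lemma Lp_fun_absolutely_integrable: "Lp_fun p leb f \<Longrightarrow> f absolutely_integrable_on {a..b}"
  unfolding absolutely_integrable_iff_integrable_lebesgue_on by (rule Lp_fun_integrable(1)[OF ab p refl])

lemma L1_iff: "D \<in> L1 \<longleftrightarrow> (\<exists>f. f absolutely_integrable_on {a..b} \<and> D = cl f)"
  by (auto simp: Lp_def Lp_fun_1_iff absolutely_integrable_iff_integrable_lebesgue_on)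

lemma Lp_subset_L1: "Lp p a b \<subseteq> L1"
  unfolding L1_iff subset_eq using Lp_fun_absolutely_integrable by (auto simp: Lp_def)

text \<open>A nonnegative continuous function with integral 0 over a nondegenerate interval
  vanishes. Hence the description in \<open>cont_rep\<close> denotes whenever a continuous
  representative exists.\<close>

lemma continuous_class_eq:
  assumes "continuous_on {a..b} f" "continuous_on {a..b} g" "cl f = cl g" "t \<in> {a..b}"
  shows "f t = g t"
proof -
  have c: "continuous_on {a..b} (\<lambda>t. norm (f t - g t))"
    using assms by (intro continuous_intros)
  have "negligible {t. \<not> (t \<in> {a..b} \<longrightarrow> f t = g t)}"
    using assms(3) unfolding class_on_eq_iff AE_lebesgue_iff_negligible .
  then have "((\<lambda>t. norm (f t - g t)) has_integral 0) {a..b}"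
    by (rule has_integral_spike[OF _ _ has_integral_0]) auto
  then have "integral {a..b} (\<lambda>t. norm (f t - g t)) = 0"
    by (rule integral_unique)
  then show ?thesis
    using integral_eq_0_iff[OF c ab] assms(4) by simp
qed

lemma cont_rep_class:
  assumes "continuous_on {a..b} y"
  shows "cont_rep a b (cl y) = (\<lambda>t. if t \<in> {a..b} then y t else 0)"
  unfolding cont_rep_def
proof (rule the_equality, intro conjI)
  show "continuous_on {a..b} (\<lambda>t. if t \<in> {a..b} then y t else 0)"
    using assms by (rule continuous_on_eq) simp
  show "cl (\<lambda>t. if t \<in> {a..b} then y t else 0) = cl y"
    by (rule class_on_cong) simp
  show "z = (\<lambda>t. if t \<in> {a..b} then y t else 0)"
    if "continuous_on {a..b} z \<and> (\<forall>t. t \<notin> {a..b} \<longrightarrow> z t = 0) \<and> cl z = cl y" for z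
    using that continuous_class_eq[OF _ assms, of z] by (intro ext) auto
qed auto

lemma init_class: "continuous_on {a..b} y \<Longrightarrow> init (cl y) = y a"
  using ab by (simp add: init_def cont_rep_class)

lemma nth_deriv_class:
  assumes "continuous_on {a..b} y"
  shows "nth_deriv a b s (cl y) = cl ((deriv_on a b ^^ s) y)"
proof (cases "s = 0")
  case False
  then show ?thesis
    unfolding nth_deriv_def cont_rep_class[OF assms]
    by (auto intro!: class_on_cong deriv_on_funpow_cong)
qed (simp add: nth_deriv_def)

lemma nth_deriv_0: "nth_deriv a b 0 Y = Y"
  by (simp add: nth_deriv_def)

lemma prim_class:
  shows "prim (cl f) = cl (\<lambda>t. integral {a..t} f)"
  unfolding prim_def
proof (rule class_on_cong)
  fix t assume "t \<in> {a..b}"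
  show "integral {a..t} (rep_aefun (cl f)) = integral {a..t} f"
  proof (rule integral_spike)
    show "negligible {t. \<not> rep_aefun (cl f) t = (if t \<in> {a..b} then f t else 0)}"
      using rep_class_on unfolding AE_lebesgue_iff_negligible .
  qed (use \<open>t \<in> {a..b}\<close> in auto)
qed

lemma continuous_on_prim:
  fixes f :: "real \<Rightarrow> complex"
  shows "f absolutely_integrable_on {a..b} \<Longrightarrow> continuous_on {a..b} (\<lambda>t. integral {a..t} f)"
  by (rule absolutely_continuous_on_imp_continuous_on) (rule absolutely_continuous_on_integral)

lemma prim_add: "D \<in> L1 \<Longrightarrow> E \<in> L1 \<Longrightarrow> prim (D + E) = prim D + prim E"
proof -
  assume "D \<in> L1" "E \<in> L1"
  then obtain f g where fg: "f absolutely_integrable_on {a..b}" "D = cl f"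
    "g absolutely_integrable_on {a..b}" "E = cl g"
    unfolding L1_iff by auto
  have "integral {a..t} (\<lambda>t. f t + g t) = integral {a..t} f + integral {a..t} g" if "t \<in> {a..b}" for t
  proof (rule Henstock_Kurzweil_Integration.integral_add)
    show "f integrable_on {a..t}" "g integrable_on {a..t}"
      using fg(1,3)[THEN set_lebesgue_integral_eq_integral(1)] that
      by (auto intro: integrable_on_subinterval)
  qed
  then show ?thesis
    unfolding fg class_on_plus prim_class by (rule class_on_cong)
qed

lemma prim_scaleC: "prim (c *\<^sub>C cl f) = c *\<^sub>C prim (cl f)"
  unfolding class_on_scaleC prim_class by (rule class_on_cong) simp

lemma prim_0: "prim 0 = 0"
  unfolding class_on_zero[of a b, symmetric] prim_class by simp

lemma class_const_plus_prim:
  "cl (\<lambda>_. c) + prim (cl f) = cl (\<lambda>t. c + integral {a..t} f)"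
  unfolding prim_class class_on_plus ..

text \<open>For l = 0 differentiability holds only almost everywhere, and absolute continuity
  recovers y from its derivative. For l > 0 the derivative is continuous on all of [a,b], and the
  classical fundamental theorem suffices.\<close>

lemma sobolev_fun_Suc_imp:
  assumes y: "sobolev_fun p (Suc l) a b y"
  shows "deriv_on a b y absolutely_integrable_on {a..b}"
    "\<And>t. t \<in> {a..b} \<Longrightarrow> y t = y a + integral {a..t} (deriv_on a b y)"
    "cl (deriv_on a b y) \<in> W l"
    "cl y = cl (\<lambda>_. y a) + prim (cl (deriv_on a b y))"
proof -
  have *: "deriv_on a b y absolutely_integrable_on {a..b} \<and>
    (\<forall>t\<in>{a..b}. (deriv_on a b y has_integral (y t - y a)) {a..t}) \<and> cl (deriv_on a b y) \<in> W l"
  proof (cases l)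
    case 0
    have Lp: "Lp_fun p leb (deriv_on a b y)" and ac: "absolutely_continuous_on a b y"
      and diff: "AE t in leb. y differentiable (at t within {a..b})"
      using y unfolding 0 sobolev_fun_def by simp_all
    define N where "N = {t. \<not> (t \<in> {a..b} \<longrightarrow> y differentiable (at t within {a..b}))}"
    have N: "negligible N"
      using diff unfolding N_def AE_lebesgue_iff_negligible[symmetric] by (simp add: AE_restrict_space_iff)
    have "(deriv_on a b y has_integral (y t - y a)) {a..t}" if t: "t \<in> {a..b}" for t
    proof (rule absolutely_continuous_on_has_integral[OF _ _ N])
      show "absolutely_continuous_on a t y"
        using absolutely_continuous_on_subset[OF ac] t by auto
      fix s assume s: "s \<in> {a..t} - N"
      then have "(y has_vector_derivative deriv_on a b y s) (at s within {a..b})"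
        using t by (auto simp: N_def deriv_on_def vector_derivative_works[symmetric])
      then show "(y has_vector_derivative deriv_on a b y s) (at s within {a..t})"
        by (rule has_vector_derivative_within_subset) (use t in auto)
    qed (use t in auto)
    then show ?thesis
      using Lp_fun_absolutely_integrable[OF Lp] Lp by (auto simp: 0 sobolev_def Lp_def)
  next
    case (Suc k)
    have diff: "\<forall>t\<in>{a..b}. y differentiable (at t within {a..b})"
      and y': "sobolev_fun p (Suc k) a b (deriv_on a b y)"
      using y unfolding Suc sobolev_fun_Suc_Suc by auto
    have "(deriv_on a b y has_integral (y t - y a)) {a..t}" if t: "t \<in> {a..b}" for t
    proof (rule fundamental_theorem_of_calculus)
      fix s assume s: "s \<in> {a..t}"
      then have "(y has_vector_derivative deriv_on a b y s) (at s within {a..b})"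
        using t diff by (auto simp: deriv_on_def vector_derivative_works[symmetric])
      then show "(y has_vector_derivative deriv_on a b y s) (at s within {a..t})"
        by (rule has_vector_derivative_within_subset) (use t in auto)
    qed (use t in auto)
    moreover have "deriv_on a b y absolutely_integrable_on {a..b}"
      using sobolev_fun_imp_continuous_on[OF y'] by (rule absolutely_integrable_continuous_real)
    ultimately show ?thesis
      using y' by (auto simp: Suc sobolev_def)
  qed
  then show "deriv_on a b y absolutely_integrable_on {a..b}" "cl (deriv_on a b y) \<in> W l"
    by auto
  show eq: "y t = y a + integral {a..t} (deriv_on a b y)" if "t \<in> {a..b}" for t
    using * that by (metis add_diff_cancel_left' diff_add_cancel integral_unique)
  show "cl y = cl (\<lambda>_. y a) + prim (cl (deriv_on a b y))"
    unfolding class_const_plus_prim by (rule class_on_cong) (rule eq)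
qed

lemma sobolev_SucE:
  assumes "Y \<in> W (Suc l)"
  obtains y where "sobolev_fun p (Suc l) a b y" "Y = cl y"
  using assms by (auto simp: sobolev_def)

text \<open>The converse: a primitive with prescribed value at a gains one order. For l = 0 the
  integrand is recovered almost everywhere by Lebesgue differentiation, for l > 0 everywhere by
  continuity.\<close>

lemma sobolev_prim:
  assumes D: "D \<in> W l"
  obtains F where "sobolev_fun p (Suc l) a b F" "cl F = cl (\<lambda>_. c) + prim D" "F a = c"
    "cl (deriv_on a b F) = D"
proof (cases l)
  case 0
  obtain d where d: "D = cl d" "Lp_fun p leb d"
    using D by (auto simp: 0 sobolev_def Lp_def)
  define F where "F t = c + integral {a..t} d" for t
  have ai: "d absolutely_integrable_on {a..b}"
    using d by (rule_tac Lp_fun_absolutely_integrable)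
  obtain N where N: "negligible N"
    "\<And>t. t \<in> {a..b} - N \<Longrightarrow> ((\<lambda>t. integral {a..t} d) has_vector_derivative d t) (at t within {a..b})"
    by (rule has_vector_derivative_integral_AE[OF ai]) (rule that)
  have der: "(F has_vector_derivative d t) (at t within {a..b})" if "t \<in> {a..b} - N" for t
    unfolding F_def using has_vector_derivative_add[OF has_vector_derivative_const N(2)[OF that]] by simp
  have der': "deriv_on a b F t = d t" if "t \<in> {a..b} - N" for t
    unfolding deriv_on_def
    using der[OF that] ab that by (intro vector_derivative_within_cbox[of a b, unfolded box_real]) auto
  have AE: "AE t in leb. t \<notin> N"
    using N(1) by (auto simp: AE_restrict_space_iff AE_lebesgue_iff_negligible intro: negligible_subset)
  have AE': "AE t in leb. t \<in> {a..b} - N"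
    using AE by (auto simp: AE_restrict_space_iff elim: eventually_mono)
  have ac: "absolutely_continuous_on a b F"
    unfolding F_def by (rule absolutely_continuous_on_cong_diff[OF absolutely_continuous_on_integral[OF ai]]) simp
  show ?thesis
  proof (rule that[of F])
    have "Lp_fun p leb (deriv_on a b F)"
    proof (rule Lp_fun_AE_cong[OF d(2)])
      show eq: "AE t in leb. d t = deriv_on a b F t"
        using AE' by (rule eventually_mono) (simp add: der')
      \<comment> \<open>The values of \<open>deriv_on\<close> on the exceptional set are
        uncontrolled, so measurability is transferred from d along equality almost
        everywhere.\<close>
      show "deriv_on a b F \<in> borel_measurable leb"
      proof -
        have d0: "(\<lambda>t. if t \<in> {a..b} then d t else 0) \<in> borel_measurable lebesgue"
          using d(2) borel_measurable_if[of "{a..b}" d] by (simp add: Lp_fun_def del: atLeastAtMost_iff)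
        have "(\<lambda>t. if t \<in> {a..b} then deriv_on a b F t else 0) \<in> borel_measurable lebesgue"
          by (rule borel_measurable_AE[OF d0]) (use eq in \<open>auto simp: AE_restrict_space_iff elim: eventually_mono\<close>)
        then show ?thesis
          using borel_measurable_if[of "{a..b}" "deriv_on a b F"] by (simp del: atLeastAtMost_iff)
      qed
    qed
    moreover have "AE t in leb. F differentiable (at t within {a..b})"
      using AE' by (rule eventually_mono) (use der in \<open>auto intro: differentiableI_vector\<close>)
    ultimately show "sobolev_fun p (Suc l) a b F"
      using ac absolutely_continuous_on_imp_continuous_on[OF ac] by (simp add: 0 sobolev_fun_def Ck_on_def)
    show "cl F = cl (\<lambda>_. c) + prim D"
      unfolding d(1) class_const_plus_prim F_def ..
    show "F a = c"
      by (simp add: F_def)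
    show "cl (deriv_on a b F) = D"
      unfolding d(1) class_on_eq_iff using AE der'
      by (auto simp: AE_restrict_space_iff elim!: eventually_mono)
  qed
next
  case (Suc k)
  obtain d where d: "D = cl d" "sobolev_fun p (Suc k) a b d"
    using D by (auto simp: Suc sobolev_def)
  define F where "F t = c + integral {a..t} d" for t
  have cont: "continuous_on {a..b} d"
    using d(2) by (rule sobolev_fun_imp_continuous_on)
  have der: "(F has_vector_derivative d t) (at t within {a..b})" if "t \<in> {a..b}" for t
    unfolding F_def
    using has_vector_derivative_add[OF has_vector_derivative_const integral_has_vector_derivative[OF cont that]] by simp
  have der': "deriv_on a b F t = d t" if "t \<in> {a..b}" for t
    unfolding deriv_on_def
    using der[OF that] ab that by (intro vector_derivative_within_cbox[of a b, unfolded box_real]) auto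
  show ?thesis
  proof (rule that[of F])
    show "sobolev_fun p (Suc l) a b F"
      unfolding Suc sobolev_fun_Suc_Suc
    proof (intro conjI ballI)
      show diff: "F differentiable (at t within {a..b})" if "t \<in> {a..b}" for t
        using der[OF that] by (rule differentiableI_vector)
      show "continuous_on {a..b} F"
        using diff by (auto intro: differentiable_imp_continuous_on simp: differentiable_on_def)
      show "sobolev_fun p (Suc k) a b (deriv_on a b F)"
        by (rule sobolev_fun_cong[OF d(2)]) (simp add: der')
    qed
    show "cl F = cl (\<lambda>_. c) + prim D"
      unfolding d(1) class_const_plus_prim F_def ..
    show "F a = c"
      by (simp add: F_def)
    show "cl (deriv_on a b F) = D"
      unfolding d(1) by (rule class_on_cong) (rule der')
  qed
qed


abbreviation "nd \<equiv> nth_deriv a b"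

lemma sobolev_0: "W 0 = Lp p a b"
  by (simp add: sobolev_def)

lemma continuous_on_norm_bounded:
  fixes z :: "real \<Rightarrow> complex"
  assumes "continuous_on {a..b} z"
  shows "\<exists>C. \<forall>t\<in>{a..b}. norm (z t) \<le> C"
proof -
  have "bounded (z ` {a..b})"
    using assms by (intro compact_imp_bounded compact_continuous_image) auto
  then show ?thesis
    by (simp add: bounded_iff)
qed

lemma Lp_fun_continuous:
  assumes "continuous_on {a..b} z"
  shows "Lp_fun p leb z"
proof -
  obtain C where "\<forall>t\<in>{a..b}. norm (z t) \<le> C"
    using continuous_on_norm_bounded[OF assms] by auto
  moreover have "z \<in> borel_measurable leb"
    using assms by (rule continuous_imp_measurable_on_sets_lebesgue) simp
  ultimately show ?thesis
    using Lp_leb_bounded by blast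
qed

text \<open>The algebraic recursion, constants plus primitives, that supports the inductions on the
  order.\<close>

lemma sobolev_Suc_iff: "Y \<in> W (Suc l) \<longleftrightarrow> (\<exists>c. \<exists>D\<in>W l. Y = cl (\<lambda>_. c) + prim D)"
proof
  assume "Y \<in> W (Suc l)"
  then obtain y where "sobolev_fun p (Suc l) a b y" "Y = cl y"
    by (rule sobolev_SucE)
  then show "\<exists>c. \<exists>D\<in>W l. Y = cl (\<lambda>_. c) + prim D"
    using sobolev_fun_Suc_imp(3,4)[of l y] by auto
next
  assume "\<exists>c. \<exists>D\<in>W l. Y = cl (\<lambda>_. c) + prim D"
  then obtain c D where D: "D \<in> W l" and Y: "Y = cl (\<lambda>_. c) + prim D"
    by auto
  obtain F where "sobolev_fun p (Suc l) a b F" "cl F = cl (\<lambda>_. c) + prim D"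
    using sobolev_prim[OF D, of c] by metis
  then show "Y \<in> W (Suc l)"
    unfolding Y sobolev_def by (auto intro!: exI[of _ F])
qed

lemma sobolev_SucI: "D \<in> W l \<Longrightarrow> cl (\<lambda>_. c) + prim D \<in> W (Suc l)"
  using sobolev_Suc_iff by auto

text \<open>Analysis enters only at the bottom, where continuous functions are bounded and thus in
  L_p; higher inclusions arise by applying J to lower ones.\<close>

lemma sobolev_Suc_subset: "W (Suc l) \<subseteq> W l"
proof (induction l)
  case 0
  show ?case
  proof
    fix Y assume "Y \<in> W (Suc 0)"
    then obtain y where "sobolev_fun p (Suc 0) a b y" "Y = cl y"
      by (rule sobolev_SucE)
    then show "Y \<in> W 0"
      using Lp_fun_continuous[OF sobolev_fun_imp_continuous_on] by (auto simp: sobolev_0 Lp_def)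
  qed
next
  case (Suc l)
  show ?case
  proof
    fix Y assume "Y \<in> W (Suc (Suc l))"
    then obtain c D where "D \<in> W (Suc l)" "Y = cl (\<lambda>_. c) + prim D"
      unfolding sobolev_Suc_iff[of _ "Suc l"] by auto
    then show "Y \<in> W (Suc l)"
      using sobolev_SucI[of D l c] Suc.IH by auto
  qed
qed

lemma sobolev_mono: "k \<le> l \<Longrightarrow> W l \<subseteq> W k"
  by (rule lift_Suc_antimono_le[of W]) (rule sobolev_Suc_subset)

lemma sobolev_subset_Lp: "W l \<subseteq> Lp p a b"
  using sobolev_mono[of 0 l] by (simp add: sobolev_0)

lemma sobolev_subset_L1: "W l \<subseteq> L1"
  using sobolev_subset_Lp Lp_subset_L1 by (rule order_trans)

lemma sobolev_SucD:
  assumes "Y \<in> W (Suc l)"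
  obtains y where "continuous_on {a..b} y" "Y = cl y"
  using assms by (rule sobolev_SucE) (rule that, erule sobolev_fun_imp_continuous_on)

text \<open>Differentiation inverts J and forgets the constant. For s > 0 the condition s \<le> l
  makes the derivative of F continuous, so it is the representative from which the derivatives of D
  are computed.\<close>

lemma nth_deriv_Suc:
  assumes D: "D \<in> W l" and "s \<le> l"
  shows "nd (Suc s) (cl (\<lambda>_. c) + prim D) = nd s D"
proof -
  obtain F where F: "sobolev_fun p (Suc l) a b F" "cl F = cl (\<lambda>_. c) + prim D" "cl (deriv_on a b F) = D"
    using sobolev_prim[OF D, of c] by metis
  have "nd (Suc s) (cl (\<lambda>_. c) + prim D) = cl ((deriv_on a b ^^ s) (deriv_on a b F))"
    unfolding F(2)[symmetric] nth_deriv_class[OF sobolev_fun_imp_continuous_on[OF F(1)]] funpow_Suc_right o_def ..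
  also have "\<dots> = nd s D"
  proof (cases s)
    case 0
    then show ?thesis
      by (simp add: F(3) nth_deriv_0)
  next
    case (Suc k)
    then obtain l' where "l = Suc l'"
      using \<open>s \<le> l\<close> by (cases l) auto
    then have "continuous_on {a..b} (deriv_on a b F)"
      using F(1) sobolev_fun_imp_continuous_on[of p "Suc l'" a b "deriv_on a b F"]
      by (simp add: sobolev_fun_Suc_Suc)
    then show ?thesis
      by (simp add: nth_deriv_class F(3)[symmetric])
  qed
  finally show ?thesis .
qed

lemma init_const_plus_prim:
  assumes "D \<in> L1"
  shows "init (cl (\<lambda>_. c) + prim D) = c"
proof -
  obtain f where f: "f absolutely_integrable_on {a..b}" "D = cl f"
    using assms L1_iff by auto
  have "continuous_on {a..b} (\<lambda>t. c + integral {a..t} f)"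
    using continuous_on_prim[OF f(1)] by (intro continuous_intros)
  then show ?thesis
    unfolding f(2) class_const_plus_prim by (simp add: init_class)
qed

text \<open>Constant and integrand in Y = c + J D are determined by Y, as its initial value and its
  derivative.\<close>

lemma sobolev_Suc_decomp:
  assumes "Y \<in> W (Suc l)"
  shows "nd 1 Y \<in> W l" "Y = cl (\<lambda>_. init Y) + prim (nd 1 Y)"
proof -
  obtain c D where D: "D \<in> W l" "Y = cl (\<lambda>_. c) + prim D"
    using assms sobolev_Suc_iff by auto
  have "nd 1 Y = D"
    using nth_deriv_Suc[OF D(1), of 0 c] by (simp add: D(2) nth_deriv_0)
  moreover have "init Y = c"
    using init_const_plus_prim[of D c] D sobolev_subset_L1[of l] by auto
  ultimately show "nd 1 Y \<in> W l" "Y = cl (\<lambda>_. init Y) + prim (nd 1 Y)"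
    using D by auto
qed

lemma nth_deriv_Suc':
  assumes Y: "Y \<in> W (Suc l)" and "s \<le> l"
  shows "nd (Suc s) Y = nd s (nd 1 Y)"
  using nth_deriv_Suc[OF sobolev_Suc_decomp(1)[OF Y] assms(2), of "init Y"] sobolev_Suc_decomp(2)[OF Y]
  by simp

section \<open>Linear structure of the Sobolev classes\<close>

lemma Lp_plus:
  assumes "X \<in> Lp p a b" "Y \<in> Lp p a b"
  shows "X + Y \<in> Lp p a b" "Lp_norm p a b (X + Y) \<le> 4 * (Lp_norm p a b X + Lp_norm p a b Y)"
proof -
  obtain f g where fg: "X = cl f" "Y = cl g" "Lp_fun p leb f" "Lp_fun p leb g"
    using assms by (auto simp: Lp_def)
  show "X + Y \<in> Lp p a b" "Lp_norm p a b (X + Y) \<le> 4 * (Lp_norm p a b X + Lp_norm p a b Y)"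
    unfolding fg(1,2) class_on_plus Lp_norm_class_on
    using Lp_leb_add[OF fg(3,4)] by (auto simp: Lp_def)
qed

lemma Lp_times_continuous:
  assumes "D \<in> Lp p a b" and z: "continuous_on {a..b} z"
  shows "D * cl z \<in> Lp p a b"
    "(\<And>t. t \<in> {a..b} \<Longrightarrow> norm (z t) \<le> C) \<Longrightarrow> Lp_norm p a b (D * cl z) \<le> C * Lp_norm p a b D"
proof -
  obtain f where f: "D = cl f" "Lp_fun p leb f"
    using assms by (auto simp: Lp_def)
  have z_meas: "z \<in> borel_measurable leb"
    using z by (rule continuous_imp_measurable_on_sets_lebesgue) simp
  have meas: "(\<lambda>t. f t * z t) \<in> borel_measurable leb"
    using f(2) z_meas unfolding Lp_fun_def by (intro borel_measurable_times) auto
  have *: "cl (\<lambda>t. f t * z t) \<in> Lp p a b \<and> Lp_norm p a b (cl (\<lambda>t. f t * z t)) \<le> C * Lp_norm p a b D"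
    if C: "\<And>t. t \<in> {a..b} \<Longrightarrow> norm (z t) \<le> C" for C
  proof -
    have "0 \<le> C"
      using order_trans[OF norm_ge_zero C[of a]] ab by simp
    have "AE t in leb. norm (f t * z t) \<le> C * norm (f t)"
    proof (rule AE_I2)
      fix t assume "t \<in> space leb"
      then have "norm (z t) * norm (f t) \<le> C * norm (f t)"
        using C by (intro mult_right_mono) (auto simp: space_restrict_space)
      then show "norm (f t * z t) \<le> C * norm (f t)"
        by (simp add: norm_mult mult.commute)
    qed
    then show ?thesis
      using Lp_leb_mono[OF f(2) meas _ \<open>0 \<le> C\<close>] by (auto simp: Lp_def f(1) Lp_norm_class_on)
  qed
  obtain B where B: "\<forall>t\<in>{a..b}. norm (z t) \<le> B"
    using continuous_on_norm_bounded[OF z] by auto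
  from *[OF B[rule_format]] show "D * cl z \<in> Lp p a b"
    unfolding f(1) class_on_times by simp
  show "Lp_norm p a b (D * cl z) \<le> C * Lp_norm p a b D" if "\<And>t. t \<in> {a..b} \<Longrightarrow> norm (z t) \<le> C"
    using *[OF that] unfolding f(1) class_on_times by simp
qed

text \<open>Scaling is multiplication by a constant function, so the results on continuous factors
  cover it.\<close>

lemma scaleC_eq_times: "D \<in> Lp p a b \<Longrightarrow> c *\<^sub>C D = D * cl (\<lambda>_. c)"
  by (auto simp: Lp_def class_on_times class_on_scaleC mult.commute)

lemma prim_scaleC_L1: "D \<in> L1 \<Longrightarrow> prim (c *\<^sub>C D) = c *\<^sub>C prim D"
  unfolding L1_iff using prim_scaleC by auto

lemma sobolev_plus: "X \<in> W l \<Longrightarrow> Y \<in> W l \<Longrightarrow> X + Y \<in> W l"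
proof (induction l arbitrary: X Y)
  case 0
  then show ?case
    using Lp_plus by (simp add: sobolev_0)
next
  case (Suc l)
  obtain c D e E where XY: "D \<in> W l" "X = cl (\<lambda>_. c) + prim D" "E \<in> W l" "Y = cl (\<lambda>_. e) + prim E"
    using Suc.prems unfolding sobolev_Suc_iff by auto
  have "X + Y = cl (\<lambda>_. c + e) + prim (D + E)"
    using XY sobolev_subset_L1[of l] by (simp add: prim_add subsetD class_on_plus[symmetric] algebra_simps)
  then show ?case
    using Suc.IH XY sobolev_SucI by simp
qed

lemma sobolev_scaleC: "X \<in> W l \<Longrightarrow> c *\<^sub>C X \<in> W l"
proof (induction l arbitrary: X)
  case 0
  then show ?case
    using Lp_times_continuous(1)[of X "\<lambda>_. c"] by (simp add: sobolev_0 scaleC_eq_times)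
next
  case (Suc l)
  obtain e D where X: "D \<in> W l" "X = cl (\<lambda>_. e) + prim D"
    using Suc.prems unfolding sobolev_Suc_iff by auto
  have "c *\<^sub>C X = cl (\<lambda>_. c * e) + prim (c *\<^sub>C D)"
    using X sobolev_subset_L1[of l] by (simp add: prim_scaleC_L1 subsetD class_on_scaleC scaleC_add_right)
  then show ?case
    using Suc.IH X sobolev_SucI by simp
qed

lemma sobolev_zero: "0 \<in> W l"
proof (induction l)
  case 0
  have "cl (\<lambda>_. 0) \<in> Lp p a b"
    using Lp_fun_continuous[of "\<lambda>_. 0"] by (auto simp: Lp_def)
  then show ?case
    by (simp add: sobolev_0 class_on_zero)
next
  case (Suc l)
  then show ?case
    using sobolev_SucI[of 0 l 0] by (simp add: class_on_zero prim_0)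
qed

lemma sobolev_subspace: "complex_vector.subspace (W l)"
  by (simp add: complex_vector.subspace_def sobolev_zero sobolev_plus sobolev_scaleC)

lemma nth_deriv_plus:
  "X \<in> W l \<Longrightarrow> Y \<in> W l \<Longrightarrow> s \<le> l \<Longrightarrow> nd s (X + Y) = nd s X + nd s Y"
proof (induction s arbitrary: l X Y)
  case (Suc s)
  then obtain k where l: "l = Suc k" "s \<le> k"
    by (cases l) auto
  obtain c D e E where XY: "D \<in> W k" "X = cl (\<lambda>_. c) + prim D" "E \<in> W k" "Y = cl (\<lambda>_. e) + prim E"
    using Suc.prems unfolding l sobolev_Suc_iff by auto
  have "X + Y = cl (\<lambda>_. c + e) + prim (D + E)"
    using XY sobolev_subset_L1[of k] by (simp add: prim_add subsetD class_on_plus[symmetric] algebra_simps)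
  then show ?case
    using Suc.IH[OF XY(1,3) l(2)] nth_deriv_Suc[OF _ l(2)] XY sobolev_plus by simp
qed (simp add: nth_deriv_0)

lemma nth_deriv_scaleC:
  "X \<in> W l \<Longrightarrow> s \<le> l \<Longrightarrow> nd s (c *\<^sub>C X) = c *\<^sub>C nd s X"
proof (induction s arbitrary: l X)
  case (Suc s)
  then obtain k where l: "l = Suc k" "s \<le> k"
    by (cases l) auto
  obtain e D where X: "D \<in> W k" "X = cl (\<lambda>_. e) + prim D"
    using Suc.prems unfolding l sobolev_Suc_iff by auto
  have "c *\<^sub>C X = cl (\<lambda>_. c * e) + prim (c *\<^sub>C D)"
    using X sobolev_subset_L1[of k] by (simp add: prim_scaleC_L1 subsetD class_on_scaleC scaleC_add_right)
  then show ?case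
    using Suc.IH[OF X(1) l(2)] nth_deriv_Suc[OF _ l(2)] X sobolev_scaleC by simp
qed (simp add: nth_deriv_0)

lemma nth_deriv_mem: "Y \<in> W (l + s) \<Longrightarrow> nd s Y \<in> W l"
proof (induction s arbitrary: Y)
  case (Suc s)
  then have Y: "Y \<in> W (Suc (l + s))"
    by simp
  show ?case
    using Suc.IH[OF sobolev_Suc_decomp(1)[OF Y]] nth_deriv_Suc'[OF Y, of s] by simp
qed (simp add: nth_deriv_0)

lemma nth_deriv_nth_deriv: "Y \<in> W l \<Longrightarrow> s + t \<le> l \<Longrightarrow> nd s (nd t Y) = nd (s + t) Y"
proof (induction t arbitrary: Y l)
  case (Suc t)
  then obtain k where l: "l = Suc k" "s + t \<le> k"
    by (cases l) auto
  have Y: "Y \<in> W (Suc k)"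
    using Suc.prems l by simp
  show ?case
    using Suc.IH[OF sobolev_Suc_decomp(1)[OF Y] l(2)] nth_deriv_Suc'[OF Y, of t] nth_deriv_Suc'[OF Y, of "s + t"] l(2)
    by simp
qed (simp add: nth_deriv_0)

lemma init_plus:
  assumes "X \<in> W (Suc l)" "Y \<in> W (Suc l)"
  shows "init (X + Y) = init X + init Y"
proof -
  obtain x y where "continuous_on {a..b} x" "X = cl x" "continuous_on {a..b} y" "Y = cl y"
    using assms by (meson sobolev_SucD)
  then show ?thesis
    by (simp add: class_on_plus init_class continuous_on_add)
qed

lemma init_scaleC:
  assumes "X \<in> W (Suc l)"
  shows "init (c *\<^sub>C X) = c * init X"
proof -
  obtain x where "continuous_on {a..b} x" "X = cl x"
    using assms by (meson sobolev_SucD)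
  then show ?thesis
    by (simp add: class_on_scaleC init_class continuous_on_mult_left)
qed

section \<open>Initial values and iterated primitives\<close>

text \<open>U is integrated r times, each integration inserting one constant. The outermost constant
  is c 0; the inner function receives the remaining values, shifted by one.\<close>

lemma initial_values_exist:
  "U \<in> W n \<Longrightarrow> \<exists>Y\<in>W (n + r). nd r Y = U \<and> (\<forall>s<r. init (nd s Y) = c s)"
proof (induction r arbitrary: c)
  case 0
  then show ?case
    by (auto simp: nth_deriv_0)
next
  case (Suc r)
  obtain Y where Y: "Y \<in> W (n + r)" "nd r Y = U" "\<forall>s<r. init (nd s Y) = c (Suc s)"
    using Suc.IH[OF Suc.prems, of "\<lambda>s. c (Suc s)"] by auto
  let ?Z = "cl (\<lambda>_. c 0) + prim Y"
  have "init (nd s ?Z) = c s" if "s < Suc r" for s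
  proof (cases s)
    case 0
    then show ?thesis
      using Y(1) sobolev_subset_L1[of "n + r"] by (simp add: nth_deriv_0 init_const_plus_prim subsetD)
  next
    case (Suc k)
    then show ?thesis
      using Y that nth_deriv_Suc[OF Y(1), of k "c 0"] by simp
  qed
  moreover have "nd (Suc r) ?Z = U"
    using Y nth_deriv_Suc[OF Y(1), of r "c 0"] by simp
  moreover have "?Z \<in> W (n + Suc r)"
    using sobolev_SucI[OF Y(1)] by simp
  ultimately show ?case
    by (intro bexI[of _ ?Z]) simp_all
qed

text \<open>Vanishing initial values remove all constants of integration.\<close>

lemma eq_iterated_prim:
  "Y \<in> W (n + r) \<Longrightarrow> \<forall>s<r. init (nd s Y) = 0 \<Longrightarrow> Y = (prim ^^ r) (nd r Y)"
proof (induction r arbitrary: Y)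
  case (Suc r)
  have Y: "Y \<in> W (Suc (n + r))"
    using Suc.prems by simp
  let ?D = "nd 1 Y"
  have D: "?D \<in> W (n + r)"
    using sobolev_Suc_decomp(1)[OF Y] .
  have "init (nd s ?D) = 0" if "s < r" for s
    using Suc.prems(2)[rule_format, of "Suc s"] that nth_deriv_Suc'[OF Y, of s] by simp
  then have "?D = (prim ^^ r) (nd r ?D)"
    using Suc.IH[OF D] by simp
  moreover have "nd r ?D = nd (Suc r) Y"
    using nth_deriv_Suc'[OF Y, of r] by simp
  moreover have "Y = prim ?D"
  proof -
    have "init Y = 0"
      using Suc.prems(2)[rule_format, of 0] by (simp add: nth_deriv_0)
    then show ?thesis
      using sobolev_Suc_decomp(2)[OF Y] by (simp add: class_on_zero)
  qed
  ultimately show ?case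
    by simp
qed (simp add: nth_deriv_0)

lemma prim_in_sobolev: "D \<in> W l \<Longrightarrow> prim D \<in> W (Suc l)"
  using sobolev_SucI[of D l 0] by (simp add: class_on_zero)

lemma iterated_prim_in_sobolev: "U \<in> W n \<Longrightarrow> (prim ^^ r) U \<in> W (n + r)"
  by (induction r) (simp_all add: prim_in_sobolev)

lemma nth_deriv_iterated_prim:
  "U \<in> W n \<Longrightarrow> s \<le> r \<Longrightarrow> nd s ((prim ^^ r) U) = (prim ^^ (r - s)) U"
proof (induction s arbitrary: r)
  case (Suc s)
  then obtain k where r: "r = Suc k" "s \<le> k"
    by (cases r) auto
  have "nd (Suc s) ((prim ^^ r) U) = nd s ((prim ^^ k) U)"
    using nth_deriv_Suc[OF iterated_prim_in_sobolev[OF Suc.prems(1), of k], of s 0] r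
    by (simp add: class_on_zero)
  then show ?case
    using Suc.IH[OF Suc.prems(1) r(2)] r by simp
qed (simp add: nth_deriv_0)

text \<open>Since s < r, at least one J survives s differentiations, and a primitive vanishes at
  a.\<close>

lemma init_nth_deriv_iterated_prim:
  assumes "U \<in> W n" "s < r"
  shows "init (nd s ((prim ^^ r) U)) = 0"
proof -
  obtain k where k: "r - s = Suc k"
    using assms(2) by (metis Suc_diff_Suc)
  have "(prim ^^ k) U \<in> L1"
    using iterated_prim_in_sobolev[OF assms(1), of k] sobolev_subset_L1 by blast
  then have "init (prim ((prim ^^ k) U)) = 0"
    using init_const_plus_prim[of "(prim ^^ k) U" 0] by (simp add: class_on_zero)
  then show ?thesis
    using nth_deriv_iterated_prim[OF assms(1), of s r] assms(2) by (simp add: k)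
qed

section \<open>Products and bounds\<close>


abbreviation "N l \<equiv> sobolev_norm p l a b"

text \<open>The product rule in integrated form. The product F G of the absolutely continuous
  representatives has derivative h almost everywhere, so the fundamental theorem applies to it, and
  D Z + X E is the class of h.\<close>

lemma prim_times:
  fixes c e :: complex
  assumes D: "D \<in> L1" and E: "E \<in> L1"
  defines "X \<equiv> cl (\<lambda>_. c) + prim D" and "Z \<equiv> cl (\<lambda>_. e) + prim E"
  shows "X * Z = cl (\<lambda>_. c * e) + prim (D * Z + X * E)"
proof -
  obtain f g where f: "f absolutely_integrable_on {a..b}" "D = cl f"
    and g: "g absolutely_integrable_on {a..b}" "E = cl g"
    using D E unfolding L1_iff by auto
  define F where "F t = c + integral {a..t} f" for t
  define G where "G t = e + integral {a..t} g" for t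
  define h where "h t = f t * G t + F t * g t" for t
  have X: "X = cl F" and Z: "Z = cl G"
    by (simp_all add: X_def Z_def f(2) g(2) class_const_plus_prim F_def[abs_def] G_def[abs_def])
  have DZ: "D * Z + X * E = cl h"
    unfolding X Z f(2) g(2) class_on_times class_on_plus h_def ..
  have acF: "absolutely_continuous_on a b F"
    by (rule absolutely_continuous_on_cong_diff[OF absolutely_continuous_on_integral[OF f(1)]]) (simp add: F_def)
  have acG: "absolutely_continuous_on a b G"
    by (rule absolutely_continuous_on_cong_diff[OF absolutely_continuous_on_integral[OF g(1)]]) (simp add: G_def)
  obtain N1 where N1: "negligible N1"
    "\<And>t. t \<in> {a..b} - N1 \<Longrightarrow> ((\<lambda>t. integral {a..t} f) has_vector_derivative f t) (at t within {a..b})"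
    by (rule has_vector_derivative_integral_AE[OF f(1)]) (rule that)
  obtain N2 where N2: "negligible N2"
    "\<And>t. t \<in> {a..b} - N2 \<Longrightarrow> ((\<lambda>t. integral {a..t} g) has_vector_derivative g t) (at t within {a..b})"
    by (rule has_vector_derivative_integral_AE[OF g(1)]) (rule that)
  have "(h has_integral (F t * G t - F a * G a)) {a..t}" if t: "t \<in> {a..b}" for t
  proof (rule absolutely_continuous_on_has_integral[OF _ _ negligible_Un[OF N1(1) N2(1)]])
    show "absolutely_continuous_on a t (\<lambda>t. F t * G t)"
      using absolutely_continuous_on_subset[OF absolutely_continuous_on_mult[OF acF acG]] t by auto
    fix s assume s: "s \<in> {a..t} - (N1 \<union> N2)"
    have "(F has_vector_derivative f s) (at s within {a..b})" "(G has_vector_derivative g s) (at s within {a..b})"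
      unfolding F_def G_def
      using has_vector_derivative_add[OF has_vector_derivative_const N1(2)[of s]]
        has_vector_derivative_add[OF has_vector_derivative_const N2(2)[of s]] s t by auto
    from has_vector_derivative_mult[OF this]
    have "((\<lambda>t. F t * G t) has_vector_derivative h s) (at s within {a..b})"
      by (simp add: h_def add.commute)
    then show "((\<lambda>t. F t * G t) has_vector_derivative h s) (at s within {a..t})"
      by (rule has_vector_derivative_within_subset) (use t in auto)
  qed (use t in auto)
  then have eq: "F t * G t = c * e + integral {a..t} h" if "t \<in> {a..b}" for t
    using integral_unique[of h "F t * G t - F a * G a" "{a..t}"] that by (simp add: F_def G_def)
  have "X * Z = cl (\<lambda>t. F t * G t)"
    unfolding X Z class_on_times ..
  also have "\<dots> = cl (\<lambda>t. c * e + integral {a..t} h)"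
    by (rule class_on_cong) (rule eq)
  finally show ?thesis
    unfolding DZ class_const_plus_prim .
qed

text \<open>The extra order of Y compensates for the low order of A: at n = 0 it supplies a
  continuous factor. It is preserved in the induction, since both D Y and A E again pair an order n
  factor with one of order n + 1.\<close>

lemma sobolev_times: "A \<in> W n \<Longrightarrow> Y \<in> W (Suc n) \<Longrightarrow> A * Y \<in> W n"
proof (induction n arbitrary: A Y)
  case 0
  then show ?case
    using Lp_times_continuous(1) by (auto simp: sobolev_0 elim!: sobolev_SucD)
next
  case (Suc n)
  obtain c D e E where AY: "D \<in> W n" "A = cl (\<lambda>_. c) + prim D" "E \<in> W (Suc n)" "Y = cl (\<lambda>_. e) + prim E"
    using Suc.prems sobolev_Suc_iff by metis
  have L1: "D \<in> L1" "E \<in> L1"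
    using AY(1,3) sobolev_subset_L1 by blast+
  have "D * Y \<in> W n" "A * E \<in> W n"
    using Suc.IH[OF AY(1), of Y] Suc.IH[of A E] Suc.prems AY(3) sobolev_Suc_subset by blast+
  then show ?case
    using prim_times[OF L1, of c e] AY(2,4) sobolev_SucI[OF sobolev_plus] by metis
qed

text \<open>In positive order no extra derivative is lost: either factor of A Y can act as the
  smoother one, according to which of the two is differentiated.\<close>

lemma nth_deriv_1_times:
  assumes A: "A \<in> W (Suc n)" and Y: "Y \<in> W (Suc n)"
  shows "A * Y \<in> W (Suc n)" "nd 1 (A * Y) = nd 1 A * Y + A * nd 1 Y"
proof -
  let ?D = "nd 1 A" and ?E = "nd 1 Y"
  have DE: "?D \<in> W n" "?E \<in> W n"
    using sobolev_Suc_decomp(1) A Y by blast+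
  then have L1: "?D \<in> L1" "?E \<in> L1"
    using sobolev_subset_L1 by blast+
  have "?D * Y \<in> W n" "A * ?E \<in> W n"
    using sobolev_times[OF DE(1) Y] sobolev_times[OF DE(2) A] by (simp_all add: mult.commute)
  then have mem: "?D * Y + A * ?E \<in> W n"
    by (rule sobolev_plus)
  have eq: "A * Y = cl (\<lambda>_. init A * init Y) + prim (?D * Y + A * ?E)"
    using prim_times[OF L1, of "init A" "init Y"] sobolev_Suc_decomp(2)[OF A, symmetric]
      sobolev_Suc_decomp(2)[OF Y, symmetric] by simp
  show "A * Y \<in> W (Suc n)"
    unfolding eq by (rule sobolev_SucI[OF mem])
  have "nd 1 (A * Y) = nd 0 (?D * Y + A * ?E)"
    using nth_deriv_Suc[OF mem, of 0 "init A * init Y"] unfolding eq by simp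
  then show "nd 1 (A * Y) = nd 1 A * Y + A * nd 1 Y"
    by (simp add: nth_deriv_0)
qed

section \<open>Norm estimates for derivatives and products\<close>

lemma nth_deriv_in_Lp:
  assumes "Y \<in> W l" "s \<le> l"
  shows "nd s Y \<in> Lp p a b"
  using nth_deriv_mem[of Y "l - s" s] assms sobolev_subset_Lp by auto

lemma Lp_norm_nonneg: "X \<in> Lp p a b \<Longrightarrow> 0 \<le> Lp_norm p a b X"
  using Lp_leb_norm_nonneg by (auto simp: Lp_def Lp_norm_class_on)

lemma sobolev_norm_nonneg: "Y \<in> W l \<Longrightarrow> 0 \<le> N l Y"
  unfolding sobolev_norm_def by (intro sum_nonneg Lp_norm_nonneg nth_deriv_in_Lp) auto

lemma sobolev_norm_0: "N 0 Y = Lp_norm p a b Y"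
  by (simp add: sobolev_norm_def nth_deriv_0)

lemma sobolev_norm_Suc:
  assumes "Y \<in> W (Suc l)"
  shows "N (Suc l) Y = Lp_norm p a b Y + N l (nd 1 Y)"
proof -
  have "(\<Sum>s\<le>l. Lp_norm p a b (nd (Suc s) Y)) = N l (nd 1 Y)"
    unfolding sobolev_norm_def 
    by (intro sum.cong refl arg_cong[of _ _ "Lp_norm p a b"] nth_deriv_Suc'[OF assms]) simp
  then show ?thesis
    unfolding sobolev_norm_def sum.atMost_Suc_shift by (simp add: nth_deriv_0)
qed

lemma sobolev_norm_plus:
  assumes "X \<in> W l" "Y \<in> W l"
  shows "N l (X + Y) \<le> 4 * (N l X + N l Y)"
proof -
  have "N l (X + Y) \<le> (\<Sum>s\<le>l. 4 * (Lp_norm p a b (nd s X) + Lp_norm p a b (nd s Y)))"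
    unfolding sobolev_norm_def
  proof (rule sum_mono)
    fix s assume "s \<in> {..l}"
    then have s: "s \<le> l"
      by simp
    show "Lp_norm p a b (nd s (X + Y)) \<le> 4 * (Lp_norm p a b (nd s X) + Lp_norm p a b (nd s Y))"
      unfolding nth_deriv_plus[OF assms s]
      by (rule Lp_plus(2)[OF nth_deriv_in_Lp[OF assms(1) s] nth_deriv_in_Lp[OF assms(2) s]])
  qed
  then show ?thesis
    by (simp add: sobolev_norm_def sum_distrib_left sum.distrib algebra_simps)
qed

lemma sobolev_norm_nth_deriv:
  assumes "Y \<in> W (l + s)"
  shows "N l (nd s Y) \<le> N (l + s) Y"
proof -
  have "N l (nd s Y) = (\<Sum>t\<in>{0..l}. Lp_norm p a b (nd (t + s) Y))"
    unfolding sobolev_norm_def atMost_atLeast0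
    by (intro sum.cong) (simp_all add: nth_deriv_nth_deriv[OF assms])
  also have "\<dots> = (\<Sum>u\<in>{0 + s..l + s}. Lp_norm p a b (nd u Y))"
    by (simp only: sum.shift_bounds_cl_nat_ivl)
  also have "\<dots> \<le> N (l + s) Y"
    unfolding sobolev_norm_def
    by (intro sum_mono2) (auto intro!: Lp_norm_nonneg nth_deriv_in_Lp[OF assms])
  finally show ?thesis .
qed

lemma sobolev_norm_mono:
  assumes "Y \<in> W l" "k \<le> l"
  shows "N k Y \<le> N l Y"
  unfolding sobolev_norm_def using assms(2)
  by (intro sum_mono2) (auto intro!: Lp_norm_nonneg nth_deriv_in_Lp[OF assms(1)])

text \<open>The embedding into continuous functions. From |y t| \<le> |y s| + 2 \<integral>|y'|,
  averaging over s bounds |y t| by the mean of |y| plus twice the L_1 norm of y'; L_1 norms are then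
  bounded by L_p norms.\<close>

lemma sobolev_sup_bound:
  "\<exists>K\<ge>0. \<forall>Y\<in>W 1. \<exists>y. continuous_on {a..b} y \<and> Y = cl y \<and> (\<forall>t\<in>{a..b}. norm (y t) \<le> K * N 1 Y)"
proof -
  \<comment> \<open>The constant with which the L_p norm dominates the L_1 norm.\<close>
  define k where "k = b - a + 1"
  have k: "0 < k" "0 < b - a"
    using ab by (simp_all add: k_def)
  have "\<exists>y. continuous_on {a..b} y \<and> Y = cl y \<and> (\<forall>t\<in>{a..b}. norm (y t) \<le> (k / (b - a) + 2 * k) * N 1 Y)"
    if Y: "Y \<in> W 1" for Y
  proof -
    obtain y where y: "sobolev_fun p (Suc 0) a b y" "Y = cl y"
      using Y by (auto elim: sobolev_SucE)
    define d where "d = deriv_on a b y"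
    have cont: "continuous_on {a..b} y"
      by (rule sobolev_fun_imp_continuous_on[OF y(1)])
    have d: "d absolutely_integrable_on {a..b}" "\<And>t. t \<in> {a..b} \<Longrightarrow> y t = y a + integral {a..t} d"
      unfolding d_def by (rule sobolev_fun_Suc_imp(1)[OF y(1)], rule sobolev_fun_Suc_imp(2)[OF y(1)])
    have Lpd: "Lp_fun p leb d"
      using y(1) by (simp add: d_def sobolev_fun_def)
    have NY: "N 1 Y = Lp_fun_norm p leb y + Lp_fun_norm p leb d"
    proof -
      have "N (Suc 0) Y = Lp_norm p a b Y + Lp_norm p a b (nd 1 Y)"
        using sobolev_norm_Suc[of Y 0] Y unfolding sobolev_norm_0 by simp
      moreover have "nd 1 Y = cl d"
        unfolding y(2) nth_deriv_class[OF cont] by (simp add: d_def)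
      ultimately show ?thesis
        unfolding y(2) Lp_norm_class_on One_nat_def by (simp only: Lp_norm_class_on)
    qed
    have int: "(\<lambda>t. norm (d t)) integrable_on {a..b}" "(\<lambda>t. norm (y t)) integrable_on {a..b}"
      by (rule set_lebesgue_integral_eq_integral(1)[OF set_integrable_norm[OF d(1)]])
        (intro integrable_continuous_real continuous_intros cont)
    have le: "integral {a..b} (\<lambda>t. norm (z t)) \<le> k * Lp_fun_norm p leb z" if "Lp_fun p leb z" for z
      using Lp_leb_integrable[OF that] lebesgue_integral_eq_integral[of "{a..b}" "\<lambda>t. norm (z t)"]
      by (simp add: k_def)
    define Id where "Id = integral {a..b} (\<lambda>t. norm (d t))"
    have inc: "norm (integral {a..t} d) \<le> Id" if t: "t \<in> {a..b}" for t
    proof -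
      have i: "(\<lambda>t. norm (d t)) integrable_on {a..t}" "d integrable_on {a..t}"
        using integrable_on_subinterval[OF int(1)] integrable_on_subinterval[OF set_lebesgue_integral_eq_integral(1)[OF d(1)]] t
        by auto
      have "norm (integral {a..t} d) \<le> integral {a..t} (\<lambda>t. norm (d t))"
        by (rule integral_norm_bound_integral[OF i(2,1)]) simp
      also have "\<dots> \<le> Id"
        unfolding Id_def using t by (intro integral_subset_le i(1) int(1)) auto
      finally show ?thesis .
    qed
    have "norm (y t) \<le> (k / (b - a) + 2 * k) * N 1 Y" if t: "t \<in> {a..b}" for t
    proof -
      have "norm (y t) \<le> norm (y s) + 2 * Id" if s: "s \<in> {a..b}" for s
      proof -
        have "y t = y s + (integral {a..t} d - integral {a..s} d)"
          using d(2)[OF t] d(2)[OF s] by simp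
        then have "norm (y t) \<le> norm (y s) + norm (integral {a..t} d - integral {a..s} d)"
          by (metis norm_triangle_ineq)
        also have "norm (integral {a..t} d - integral {a..s} d) \<le> Id + Id"
          by (rule order_trans[OF norm_triangle_ineq4 add_mono[OF inc[OF t] inc[OF s]]])
        finally show ?thesis
          by simp
      qed
      \<comment> \<open>Integration over s replaces the unknown value |y s| by an L_1 norm; the
        factor b - a on the left is divided out afterwards.\<close>
      then have "integral {a..b} (\<lambda>s. norm (y t)) \<le> integral {a..b} (\<lambda>s. norm (y s) + 2 * Id)"
        by (intro integral_le integrable_add int(2)) (auto intro: integrable_const_ivl)
      also have "\<dots> = integral {a..b} (\<lambda>s. norm (y s)) + (b - a) * (2 * Id)"
        using int(2) ab by (subst Henstock_Kurzweil_Integration.integral_add) auto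
      finally have "(b - a) * norm (y t) \<le> k * Lp_fun_norm p leb y + (b - a) * (2 * (k * Lp_fun_norm p leb d))"
        using le[OF Lp_fun_continuous[OF cont]] mult_left_mono[OF le[OF Lpd], of "(b - a) * 2"] k ab
        by (simp add: Id_def algebra_simps)
      then have "norm (y t) \<le> (k * Lp_fun_norm p leb y + (b - a) * (2 * (k * Lp_fun_norm p leb d))) / (b - a)"
        using k by (simp add: pos_le_divide_eq mult.commute)
      also have "\<dots> = k / (b - a) * Lp_fun_norm p leb y + 2 * k * Lp_fun_norm p leb d"
        using k by (simp add: field_simps)
      also have "\<dots> \<le> (k / (b - a) + 2 * k) * Lp_fun_norm p leb y + (k / (b - a) + 2 * k) * Lp_fun_norm p leb d"
        using k Lp_leb_norm_nonneg[OF Lpd] Lp_leb_norm_nonneg[OF Lp_fun_continuous[OF cont]]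
        by (intro add_mono mult_right_mono) auto
      finally show ?thesis
        unfolding NY distrib_left .
    qed
    then show ?thesis
      using cont y(2) by blast
  qed
  moreover have "0 \<le> k / (b - a) + 2 * k"
    using k by simp
  ultimately show ?thesis
    by blast
qed

lemma Lp_times_bound:
  assumes "A \<in> Lp p a b"
  shows "\<exists>K\<ge>0. \<forall>Y\<in>W 1. Lp_norm p a b (A * Y) \<le> K * N 1 Y"
proof -
  obtain K where K: "0 \<le> K" "\<forall>Y\<in>W 1. \<exists>y. continuous_on {a..b} y \<and> Y = cl y \<and> (\<forall>t\<in>{a..b}. norm (y t) \<le> K * N 1 Y)"
    using sobolev_sup_bound by auto
  have "Lp_norm p a b (A * Y) \<le> (K * Lp_norm p a b A) * N 1 Y" if Y: "Y \<in> W 1" for Y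
  proof -
    obtain y where y: "continuous_on {a..b} y" "Y = cl y" "\<forall>t\<in>{a..b}. norm (y t) \<le> K * N 1 Y"
      using bspec[OF K(2) Y] by (elim exE conjE) (rule that)
    show ?thesis
      using Lp_times_continuous(2)[OF assms y(1), of "K * N 1 Y"] y(2,3) by (simp add: mult.commute mult.left_commute)
  qed
  then show ?thesis
    using K(1) Lp_norm_nonneg[OF assms] by (intro exI[of _ "K * Lp_norm p a b A"]) simp
qed

text \<open>The product rule reduces order n + 1 to two products of order n, so the induction
  hypothesis is used for A and for its derivative. In the constant, K0 bounds the product itself,
  and 4 is the quasi-norm factor for the two terms of its derivative.\<close>

lemma sobolev_times_bound: "A \<in> W n \<Longrightarrow> \<exists>K\<ge>0. \<forall>Y\<in>W (Suc n). N n (A * Y) \<le> K * N (Suc n) Y"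
proof (induction n arbitrary: A)
  case 0
  then show ?case
    using Lp_times_bound[of A] by (simp add: sobolev_0 sobolev_norm_0)
next
  case (Suc n)
  let ?D = "nd 1 A"
  have D: "?D \<in> W n" and A: "A \<in> W n"
    using sobolev_Suc_decomp(1)[OF Suc.prems] Suc.prems sobolev_Suc_subset by blast+
  obtain K0 where K0: "0 \<le> K0" "\<forall>Y\<in>W 1. Lp_norm p a b (A * Y) \<le> K0 * N 1 Y"
  proof -
    have "A \<in> Lp p a b"
      using A sobolev_subset_Lp by (rule subsetD[rotated])
    from Lp_times_bound[OF this] show ?thesis
      by (elim exE conjE) (rule that)
  qed
  obtain K1 where K1: "0 \<le> K1" "\<forall>Y\<in>W (Suc n). N n (?D * Y) \<le> K1 * N (Suc n) Y"
    using Suc.IH[OF D] by (elim exE conjE) (rule that)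
  obtain K2 where K2: "0 \<le> K2" "\<forall>Y\<in>W (Suc n). N n (A * Y) \<le> K2 * N (Suc n) Y"
    using Suc.IH[OF A] by (elim exE conjE) (rule that)
  have "N (Suc n) (A * Y) \<le> (K0 + 4 * (K1 + K2)) * N (Suc (Suc n)) Y" if Y: "Y \<in> W (Suc (Suc n))" for Y
  proof -
    let ?E = "nd 1 Y" and ?N = "N (Suc (Suc n)) Y"
    have Y': "Y \<in> W (Suc n)" "Y \<in> W 1"
      using Y sobolev_mono[of "Suc n" "Suc (Suc n)"] sobolev_mono[of 1 "Suc (Suc n)"] by auto
    have E: "?E \<in> W (Suc n)"
      using sobolev_Suc_decomp(1)[OF Y] .
    have mem: "?D * Y \<in> W n" "A * ?E \<in> W n"
      using sobolev_times D A Y' E by blast+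
    have "Lp_norm p a b (A * Y) \<le> K0 * ?N"
      using K0 Y' mult_left_mono[OF sobolev_norm_mono[OF Y, of 1] K0(1)] by fastforce
    moreover have "N n (?D * Y) \<le> K1 * ?N"
      using K1 Y' mult_left_mono[OF sobolev_norm_mono[OF Y, of "Suc n"] K1(1)] by fastforce
    moreover have "N n (A * ?E) \<le> K2 * ?N"
      using K2 E mult_left_mono[OF sobolev_norm_nth_deriv[of Y "Suc n" 1] K2(1)] Y by fastforce
    moreover have "N n (?D * Y + A * ?E) \<le> 4 * (N n (?D * Y) + N n (A * ?E))"
      using mem by (rule sobolev_norm_plus)
    moreover have "N (Suc n) (A * Y) = Lp_norm p a b (A * Y) + N n (?D * Y + A * ?E)"
      using sobolev_norm_Suc[OF nth_deriv_1_times(1)[OF Suc.prems Y'(1)]] nth_deriv_1_times(2)[OF Suc.prems Y'(1)] by simp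
    ultimately show ?thesis
      by (simp add: algebra_simps)
  qed
  then show ?case
    using K0(1) K1(1) K2(1) by (intro exI[of _ "K0 + 4 * (K1 + K2)"]) simp
qed

end

section \<open>Volterra equations\<close>

text \<open>
  Split \<open>\<bar>f\<bar>\<close> into a part bounded by \<open>C\<close>, damped by \<open>C / c\<close>, and a remainder of small integral.
\<close>

lemma exponential_weight:
  fixes f :: "real \<Rightarrow> real"
  assumes f: "f absolutely_integrable_on {a..b}" and "0 < \<theta>"
  shows "\<exists>c\<ge>1. \<forall>t\<in>{a..b}. integral {a..t} (\<lambda>s. \<bar>f s\<bar> * exp (c * (s - a))) \<le> \<theta> * exp (c * (t - a))"
proof -
  obtain C where C: "0 \<le> C" "(\<lambda>t. max 0 (norm (f t) - C)) integrable_on {a..b}"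
    "integral {a..b} (\<lambda>t. max 0 (norm (f t) - C)) < \<theta> / 2"
    by (rule absolutely_integrable_truncation[OF f half_gt_zero[OF \<open>0 < \<theta>\<close>]])
  define g where "g t = max 0 (norm (f t) - C)" for t
  have g: "g integrable_on {a..b}" "integral {a..b} g < \<theta> / 2"
    using C(2,3) by (simp_all add: g_def[abs_def])
  \<comment> \<open>L \<ge> 2 C / \<theta> gives C / L \<le> \<theta> / 2, and L \<ge> 1 keeps the
    rate positive when C = 0.\<close>
  define L where "L = max 1 (2 * C / \<theta>)"
  have L: "1 \<le> L" "C / L \<le> \<theta> / 2"
    using \<open>0 < \<theta>\<close> C(1) by (auto simp: L_def max_def field_simps)
  have "integral {a..t} (\<lambda>s. \<bar>f s\<bar> * exp (L * (s - a))) \<le> \<theta> * exp (L * (t - a))" if t: "t \<in> {a..b}" for t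
  proof (cases "(\<lambda>s. \<bar>f s\<bar> * exp (L * (s - a))) integrable_on {a..t}")
    \<comment> \<open>In the opposite case the integral is 0 by convention, and the bound is
      immediate.\<close>
    case True
    have gi: "g integrable_on {a..t}"
      using integrable_on_subinterval[OF g(1)] t by auto
    have h1: "((\<lambda>s. C * exp (L * (s - a))) has_integral (C / L * exp (L * (t - a)) - C / L * exp (L * (a - a)))) {a..t}"
      using t L(1) by (intro fundamental_theorem_of_calculus)
        (auto intro!: derivative_eq_intros simp: has_real_derivative_iff_has_vector_derivative[symmetric])
    have h2: "((\<lambda>s. exp (L * (t - a)) * g s) has_integral (exp (L * (t - a)) * integral {a..t} g)) {a..t}"
      by (intro has_integral_mult_right integrable_integral gi)
    have sum: "((\<lambda>s. C * exp (L * (s - a)) + exp (L * (t - a)) * g s) has_integral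
        (C / L * exp (L * (t - a)) - C / L + exp (L * (t - a)) * integral {a..t} g)) {a..t}"
      using has_integral_add[OF h1 h2] by simp
    have "integral {a..t} (\<lambda>s. \<bar>f s\<bar> * exp (L * (s - a)))
        \<le> C / L * exp (L * (t - a)) - C / L + exp (L * (t - a)) * integral {a..t} g"
    proof (rule has_integral_le[OF integrable_integral[OF True] sum])
      fix s assume s: "s \<in> {a..t}"
      have "\<bar>f s\<bar> * exp (L * (s - a)) \<le> (C + g s) * exp (L * (s - a))"
        by (intro mult_right_mono) (auto simp: g_def)
      \<comment> \<open>Only the remainder g takes the weight at the end point t. The bounded part
        keeps the weight under the integral, whose integration produces the gain 1 / L.\<close>
      also have "\<dots> \<le> C * exp (L * (s - a)) + exp (L * (t - a)) * g s"
        using s L(1) by (auto simp: algebra_simps g_def intro!: mult_right_mono mult_left_mono)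
      finally show "\<bar>f s\<bar> * exp (L * (s - a)) \<le> C * exp (L * (s - a)) + exp (L * (t - a)) * g s" .
    qed
    also have "\<dots> \<le> \<theta> / 2 * exp (L * (t - a)) - 0 + exp (L * (t - a)) * (\<theta> / 2)"
    proof (intro add_mono diff_mono mult_left_mono mult_right_mono L(2))
      have "integral {a..t} g \<le> integral {a..b} g"
        using t by (intro integral_subset_le gi g(1)) (auto simp: g_def)
      then show "integral {a..t} g \<le> \<theta> / 2"
        using g(2) by simp
      show "0 \<le> C / L"
        using C(1) L(1) by simp
    qed auto
    finally show ?thesis
      by (simp add: algebra_simps)
  qed (use \<open>0 < \<theta>\<close> in \<open>simp add: not_integrable_integral\<close>)
  then show ?thesis
    using L(1) by blast
qed

text \<open>Banach's theorem for the norm sup |v t| exp (- c (t - a)), transported to the complete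
  space of bounded continuous functions on the line: \<open>E\<close> multiplies by the weight and
  \<open>h\<close> divides by it. Values outside [a,b] carry no information, so equality is asserted
  on [a,b] only.\<close>

lemma weighted_contraction_fixpoint:
  fixes \<Phi> :: "(real \<Rightarrow> 'e::banach) \<Rightarrow> real \<Rightarrow> 'e"
  assumes "a \<le> b"
    and cont: "\<And>v. continuous_on {a..b} v \<Longrightarrow> continuous_on {a..b} (\<Phi> v)"
    and contr: "\<And>v w d t. \<lbrakk>continuous_on {a..b} v; continuous_on {a..b} w; 0 \<le> d;
      \<forall>s\<in>{a..b}. norm (v s - w s) \<le> d * exp (c * (s - a)); t \<in> {a..b}\<rbrakk> \<Longrightarrow>
      norm (\<Phi> v t - \<Phi> w t) \<le> d / 2 * exp (c * (t - a))"
  shows "\<exists>v. continuous_on {a..b} v \<and> (\<forall>t\<in>{a..b}. v t = \<Phi> v t)"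
    and "\<lbrakk>continuous_on {a..b} v; continuous_on {a..b} w; \<And>t. t \<in> {a..b} \<Longrightarrow> v t = \<Phi> v t;
      \<And>t. t \<in> {a..b} \<Longrightarrow> w t = \<Phi> w t; t \<in> {a..b}\<rbrakk> \<Longrightarrow> v t = w t"
proof -
  \<comment> \<open>A retraction of the line onto [a,b]: composing with it turns continuity on [a,b]
    into bounded continuity on the line.\<close>
  define k where "k t = max a (min t b)" for t
  have k: "k t \<in> {a..b}" "t \<in> {a..b} \<Longrightarrow> k t = t" for t
    using \<open>a \<le> b\<close> by (auto simp: k_def)
  have contk: "continuous_on UNIV k"
    unfolding k_def by (intro continuous_intros)
  define E where "E \<phi> t = exp (c * (t - a)) *\<^sub>R apply_bcontfun \<phi> t" for \<phi> :: "real \<Rightarrow>\<^sub>C 'e" and t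
  define h where "h \<phi> t = exp (- c * (t - a)) *\<^sub>R \<Phi> (E \<phi>) t" for \<phi> t
  have contE: "continuous_on {a..b} (E \<phi>)" for \<phi>
  proof -
    have "continuous_on {a..b} (apply_bcontfun \<phi>)"
      by (rule continuous_on_apply_bcontfun)
    then show ?thesis
      unfolding E_def by (rule continuous_on_scaleR[rotated]) (intro continuous_intros)
  qed
  have conth: "continuous_on {a..b} (h \<phi>)" for \<phi>
    unfolding h_def by (intro continuous_intros cont contE)
  have bc: "(\<lambda>t. h \<phi> (k t)) \<in> bcontfun" for \<phi>
  proof -
    have "continuous_on UNIV (\<lambda>t. h \<phi> (k t))"
      by (rule continuous_on_compose2[OF conth contk]) (use k(1) in auto)
    moreover have "bounded (range (\<lambda>t. h \<phi> (k t)))"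
      by (rule bounded_subset[OF compact_imp_bounded[OF compact_continuous_image[OF conth]]]) (use k(1) in auto)
    ultimately show ?thesis
      by (simp add: bcontfun_def)
  qed
  define T where "T \<phi> = Bcontfun (\<lambda>t. h \<phi> (k t))" for \<phi>
  have T: "apply_bcontfun (T \<phi>) t = h \<phi> (k t)" for \<phi> t
    unfolding T_def by (simp add: Bcontfun_inverse[OF bc])
  have "dist (T \<phi>) (T \<psi>) \<le> 1 / 2 * dist \<phi> \<psi>" for \<phi> \<psi>
  proof (rule dist_bound)
    fix t
    let ?s = "k t"
    have "norm (E \<phi> s - E \<psi> s) \<le> dist \<phi> \<psi> * exp (c * (s - a))" for s
      unfolding E_def scaleR_diff_right[symmetric] norm_scaleR
      using dist_bounded[of \<phi> s \<psi>] by (simp add: dist_norm mult.commute mult_left_mono)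
    then have "norm (\<Phi> (E \<phi>) ?s - \<Phi> (E \<psi>) ?s) \<le> dist \<phi> \<psi> / 2 * exp (c * (?s - a))"
      by (intro contr contE k(1)) auto
    then have "exp (- c * (?s - a)) * norm (\<Phi> (E \<phi>) ?s - \<Phi> (E \<psi>) ?s)
        \<le> exp (- c * (?s - a)) * (dist \<phi> \<psi> / 2 * exp (c * (?s - a)))"
      by (intro mult_left_mono) auto
    also have "\<dots> = 1 / 2 * dist \<phi> \<psi> * (exp (- c * (?s - a)) * exp (c * (?s - a)))"
      by (simp only: mult_ac divide_inverse mult_1)
    also have "\<dots> = 1 / 2 * dist \<phi> \<psi>"
      by (simp add: mult_exp_exp)
    finally show "dist (apply_bcontfun (T \<phi>) t) (apply_bcontfun (T \<psi>) t) \<le> 1 / 2 * dist \<phi> \<psi>"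
      unfolding T dist_norm h_def scaleR_diff_right[symmetric] norm_scaleR by simp
  qed
  then have "\<exists>!\<phi>. T \<phi> = \<phi>"
    by (intro banach_fix_type[of "1 / 2"]) auto
  then obtain \<phi> where \<phi>: "T \<phi> = \<phi>"
    by auto
  have "E \<phi> t = \<Phi> (E \<phi>) t" if t: "t \<in> {a..b}" for t
  proof -
    have "apply_bcontfun \<phi> t = h \<phi> t"
      using T[of \<phi> t] k(2)[OF t] by (simp add: \<phi>)
    then have "E \<phi> t = exp (c * (t - a)) *\<^sub>R exp (- c * (t - a)) *\<^sub>R \<Phi> (E \<phi>) t"
      by (simp add: E_def h_def)
    then show ?thesis
      by (simp add: mult_exp_exp)
  qed
  then show "\<exists>v. continuous_on {a..b} v \<and> (\<forall>t\<in>{a..b}. v t = \<Phi> v t)"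
    using contE by blast
  show "v t = w t" if v: "continuous_on {a..b} v" and w: "continuous_on {a..b} w"
    and fv: "\<And>t. t \<in> {a..b} \<Longrightarrow> v t = \<Phi> v t" and fw: "\<And>t. t \<in> {a..b} \<Longrightarrow> w t = \<Phi> w t"
    and t: "t \<in> {a..b}" for v w t
  proof -
    \<comment> \<open>Uniqueness is read off at a maximum s0 of the weighted difference, where
      contraction gives D s0 \<le> D s0 / 2.\<close>
    define D where "D s = exp (- c * (s - a)) * norm (v s - w s)" for s
    have "continuous_on {a..b} D"
      unfolding D_def by (intro continuous_intros v w)
    then obtain s0 where s0: "s0 \<in> {a..b}" "\<And>s. s \<in> {a..b} \<Longrightarrow> D s \<le> D s0"
      using continuous_attains_sup[of "{a..b}" D] \<open>a \<le> b\<close> by auto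
    have D0: "0 \<le> D s" for s
      by (simp add: D_def)
    have DE: "norm (v s - w s) = D s * exp (c * (s - a))" for s
    proof -
      have "D s * exp (c * (s - a)) = norm (v s - w s) * (exp (- c * (s - a)) * exp (c * (s - a)))"
        by (simp only: D_def mult_ac)
      then show ?thesis
        by (simp add: mult_exp_exp)
    qed
    have "norm (\<Phi> v s0 - \<Phi> w s0) \<le> D s0 / 2 * exp (c * (s0 - a))"
      by (intro contr v w D0 s0(1)) (simp add: DE s0(2))
    then have "D s0 * exp (c * (s0 - a)) \<le> D s0 / 2 * exp (c * (s0 - a))"
      unfolding DE[symmetric] using fv[OF s0(1)] fw[OF s0(1)] by simp
    then have "D s0 \<le> 0"
      by (simp add: mult_le_0_iff)
    then have "D t = 0"
      using s0(2)[OF t] D0[of t] by simp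
    then show "v t = w t"
      by (simp add: D_def)
  qed
qed

lemma norm_vec_le_sum: "norm (x :: complex ^ 'm) \<le> (\<Sum>i\<in>UNIV. norm (x $ i))"
  unfolding norm_vec_def by (rule L2_set_le_sum) simp

lemma absolutely_integrable_times_continuous:
  fixes f z :: "real \<Rightarrow> complex"
  assumes f: "f absolutely_integrable_on {a..b}" and z: "continuous_on {a..b} z"
  shows "(\<lambda>t. f t * z t) absolutely_integrable_on {a..b}"
proof -
  have "(\<lambda>t. z t * f t) absolutely_integrable_on {a..b}"
  proof (rule absolutely_integrable_bounded_measurable_product[where h = "(*)", OF _ _ _ _ f])
    show "bilinear ((*) :: complex \<Rightarrow> complex \<Rightarrow> complex)"
      by (simp add: bilinear_conv_bounded_bilinear bounded_bilinear_mult)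
    show "z \<in> borel_measurable (lebesgue_on {a..b})"
      using z by (rule continuous_imp_measurable_on_sets_lebesgue) simp
    show "bounded (z ` {a..b})"
      using z by (intro compact_imp_bounded compact_continuous_image) auto
  qed simp
  then show ?thesis
    by (simp add: mult.commute)
qed

lemma class_on_sum: "class_on a b (\<lambda>t. \<Sum>i\<in>S. f i t) = (\<Sum>i\<in>S. class_on a b (f i))"
  by (induction S rule: infinite_finite_induct) (simp_all add: class_on_zero class_on_plus[symmetric])

lemma class_on_minus: "class_on a b f - class_on a b g = class_on a b (\<lambda>t. f t - g t)"
  unfolding class_on_def minus_aefun.abs_eq by (rule arg_cong[of _ _ abs_aefun]) auto

section \<open>The integral equation in L_1\<close>

context sobolev_interval
begin

text \<open>The operator J on functions instead of classes, so that its iterates can be estimated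
  pointwise.\<close>

definition antideriv :: "(real \<Rightarrow> complex) \<Rightarrow> real \<Rightarrow> complex"
  where "antideriv w t = integral {a..t} w"

lemma iterated_prim_class: "(prim ^^ k) (cl w) = cl ((antideriv ^^ k) w)"
proof (induction k)
  case (Suc k)
  then show ?case
    by (simp add: prim_class antideriv_def[abs_def])
qed simp

lemma continuous_on_iterated_antideriv:
  "continuous_on {a..b} w \<Longrightarrow> continuous_on {a..b} ((antideriv ^^ k) w)"
proof (induction k)
  case (Suc k)
  then show ?case
    using continuous_on_prim[OF absolutely_integrable_continuous_real] by (simp add: antideriv_def[abs_def])
qed simp

text \<open>Integration does not increase the weighted sup norm: integrating exp (c (s - a)) up to t
  gains a factor 1 / c, which is at most 1. This is the use of a rate c \<ge> 1.\<close>

lemma iterated_antideriv_weighted: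
  assumes v: "continuous_on {a..b} v" and w: "continuous_on {a..b} w"
    and "0 \<le> d" "1 \<le> c" and le: "\<And>s. s \<in> {a..b} \<Longrightarrow> norm (v s - w s) \<le> d * exp (c * (s - a))"
    and t: "t \<in> {a..b}"
  shows "norm ((antideriv ^^ k) v t - (antideriv ^^ k) w t) \<le> d * exp (c * (t - a))"
  using t
proof (induction k arbitrary: t)
  case (Suc k)
  let ?v = "(antideriv ^^ k) v" and ?w = "(antideriv ^^ k) w"
  have int: "?v integrable_on {a..t}" "?w integrable_on {a..t}"
    using continuous_on_iterated_antideriv[OF v, of k] continuous_on_iterated_antideriv[OF w, of k] Suc.prems
    by (auto intro!: integrable_continuous_real elim: continuous_on_subset)
  have int_exp: "((\<lambda>s. d * exp (c * (s - a))) has_integral (d / c * exp (c * (t - a)) - d / c * exp (c * (a - a)))) {a..t}"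
    using Suc.prems \<open>1 \<le> c\<close> by (intro fundamental_theorem_of_calculus)
      (auto intro!: derivative_eq_intros simp: has_real_derivative_iff_has_vector_derivative[symmetric])
  have E: "(\<lambda>s. d * exp (c * (s - a))) integrable_on {a..t}"
    "integral {a..t} (\<lambda>s. d * exp (c * (s - a))) = d / c * exp (c * (t - a)) - d / c"
    by (rule has_integral_integrable[OF int_exp])
      (simp only: integral_unique[OF int_exp] diff_self mult_zero_right exp_zero mult_1_right)
  have "norm ((antideriv ^^ Suc k) v t - (antideriv ^^ Suc k) w t) = norm (integral {a..t} (\<lambda>s. ?v s - ?w s))"
    using int by (simp add: antideriv_def Henstock_Kurzweil_Integration.integral_diff)
  also have "\<dots> \<le> integral {a..t} (\<lambda>s. d * exp (c * (s - a)))"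
    using Suc by (intro integral_norm_bound_integral integrable_diff int E(1)) auto
  also have "\<dots> \<le> d / c * exp (c * (t - a))"
    unfolding E(2) using \<open>0 \<le> d\<close> \<open>1 \<le> c\<close> by simp
  also have "\<dots> \<le> d / 1 * exp (c * (t - a))"
    using \<open>0 \<le> d\<close> \<open>1 \<le> c\<close> by (intro mult_right_mono divide_left_mono) auto
  finally show ?case
    by simp
qed (use le in simp)

text \<open>In terms of v = J u the right-hand side is an integrable function q v, since J^l u =
  J^(l-1) v for l \<ge> 1. Fixed points of \<Phi> v = J (q v) and solutions u correspond through v =
  J u and u = \<open>cl (q v)\<close>, taken componentwise.\<close>

lemma volterra_unique_solution:
  fixes A :: "nat \<Rightarrow> aefun ^ 'm ^ 'm" and G :: "aefun ^ 'm"
  assumes A: "\<And>l i j. l \<in> {1..r} \<Longrightarrow> A l $ i $ j \<in> L1" and G: "\<And>i. G $ i \<in> L1"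
  defines "solves u \<equiv> (\<forall>i. u $ i \<in> L1) \<and>
    (\<forall>i. u $ i = G $ i - (\<Sum>l = 1..r. \<Sum>j\<in>UNIV. A l $ i $ j * (prim ^^ l) (u $ j)))"
  shows "\<exists>u. solves u" and "\<lbrakk>solves u; solves u'\<rbrakk> \<Longrightarrow> u = u'"
proof -
  \<comment> \<open>Representatives are fixed once, so that \<Phi> acts on functions.\<close>
  define \<alpha> where "\<alpha> l i j = (SOME f. f absolutely_integrable_on {a..b} \<and> A l $ i $ j = cl f)" for l i j
  have \<alpha>: "\<alpha> l i j absolutely_integrable_on {a..b}" "A l $ i $ j = cl (\<alpha> l i j)" if "l \<in> {1..r}" for l i j
    using someI_ex[OF A[OF that, of i j, unfolded L1_iff]] by (simp_all add: \<alpha>_def)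
  define g where "g i = (SOME f. f absolutely_integrable_on {a..b} \<and> G $ i = cl f)" for i
  have g: "g i absolutely_integrable_on {a..b}" "G $ i = cl (g i)" for i
    using someI_ex[OF G[of i, unfolded L1_iff]] by (simp_all add: g_def)
  \<comment> \<open>One J is already contained in v, hence k - 1; the natural subtraction is exact
    because only k \<ge> 1 occurs.\<close>
  define I where "I k v j = (antideriv ^^ (k - 1)) (\<lambda>t. v t $ j)" for k v and j :: 'm
  define q where "q v i t = g i t - (\<Sum>l = 1..r. \<Sum>j\<in>UNIV. \<alpha> l i j t * I l v j t)" for v i t
  define \<Phi> where "\<Phi> v t = (\<chi> i. integral {a..t} (q v i))" for v t
  have contj: "continuous_on {a..b} (\<lambda>t. v t $ j)" if "continuous_on {a..b} v" for v :: "real \<Rightarrow> complex ^ 'm" and j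
    using that by (intro continuous_intros)
  have contI: "continuous_on {a..b} (I l v j)" if "continuous_on {a..b} v" for l v j
    unfolding I_def by (intro continuous_on_iterated_antideriv contj that)
  have qint: "q v i absolutely_integrable_on {a..b}" if "continuous_on {a..b} v" for v i
    unfolding q_def[abs_def]
    by (intro set_integral_diff(1) g absolutely_integrable_sum absolutely_integrable_times_continuous \<alpha> contI that) auto
  have qclass: "cl (q v i) = G $ i - (\<Sum>l = 1..r. \<Sum>j\<in>UNIV. A l $ i $ j * cl (I l v j))" for v i
  proof -
    have "(\<Sum>l = 1..r. \<Sum>j\<in>UNIV. A l $ i $ j * cl (I l v j))
        = (\<Sum>l = 1..r. \<Sum>j\<in>UNIV. cl (\<lambda>t. \<alpha> l i j t * I l v j t))"
      by (intro sum.cong refl) (simp add: \<alpha>(2) class_on_times)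
    then show ?thesis
      unfolding q_def[abs_def] g(2) class_on_minus[symmetric] class_on_sum by simp
  qed
  have cont\<Phi>: "continuous_on {a..b} (\<Phi> v)" if "continuous_on {a..b} v" for v
    unfolding \<Phi>_def by (intro continuous_on_vec_lambda continuous_on_prim qint that)
  \<comment> \<open>A single integrable majorant for all rows of the system, so that one rate c
    serves every component.\<close>
  define \<beta> where "\<beta> t = (\<Sum>i\<in>UNIV. \<Sum>l = 1..r. \<Sum>j\<in>UNIV. norm (\<alpha> l i j t))" for t
  have \<beta>: "\<beta> absolutely_integrable_on {a..b}"
    unfolding \<beta>_def[abs_def] by (intro absolutely_integrable_sum set_integrable_norm \<alpha>) auto
  have \<beta>0: "0 \<le> \<beta> t" for t
    unfolding \<beta>_def by (intro sum_nonneg) simp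
  \<comment> \<open>The norm of a vector is estimated by the sum of its CARD('m) components; this
    \<theta> makes the sum contract by 1/2.\<close>
  define \<theta> where "\<theta> = 1 / (2 * real CARD('m))"
  have "0 < \<theta>"
    by (simp add: \<theta>_def)
  from exponential_weight[OF \<beta> this] obtain c where c: "1 \<le> c"
    "\<forall>t\<in>{a..b}. integral {a..t} (\<lambda>s. \<bar>\<beta> s\<bar> * exp (c * (s - a))) \<le> \<theta> * exp (c * (t - a))"
    by (elim exE conjE) (rule that)
  have contr: "norm (\<Phi> v t - \<Phi> w t) \<le> d / 2 * exp (c * (t - a))"
    if v: "continuous_on {a..b} v" and w: "continuous_on {a..b} w" and "0 \<le> d"
      and vw: "\<forall>s\<in>{a..b}. norm (v s - w s) \<le> d * exp (c * (s - a))" and t: "t \<in> {a..b}"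
    for v w d t
  proof -
    have Ile: "norm (I l v j s - I l w j s) \<le> d * exp (c * (s - a))" if s: "s \<in> {a..b}" for l j s
      unfolding I_def
    proof (rule iterated_antideriv_weighted[OF contj[OF v] contj[OF w] \<open>0 \<le> d\<close> c(1) _ s])
      fix s assume s: "s \<in> {a..b}"
      have "norm (v s $ j - w s $ j) \<le> norm (v s - w s)"
        using Finite_Cartesian_Product.norm_nth_le[of "v s - w s" j] by simp
      then show "norm (v s $ j - w s $ j) \<le> d * exp (c * (s - a))"
        using vw[rule_format, OF s] by simp
    qed
    have \<beta>i: "(\<lambda>s. \<bar>\<beta> s\<bar> * exp (c * (s - a))) integrable_on {a..t}"
    proof -
      have "(\<lambda>s. exp (c * (s - a)) * \<beta> s) absolutely_integrable_on {a..b}"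
      proof (rule absolutely_integrable_bounded_measurable_product_real[OF _ _ _ \<beta>])
        have cont: "continuous_on {a..b} (\<lambda>s. exp (c * (s - a)))"
          by (intro continuous_intros)
        show "(\<lambda>s. exp (c * (s - a))) \<in> borel_measurable leb"
          using cont by (rule continuous_imp_measurable_on_sets_lebesgue) simp
        show "bounded ((\<lambda>s. exp (c * (s - a))) ` {a..b})"
          using cont by (intro compact_imp_bounded compact_continuous_image) auto
      qed simp
      from set_lebesgue_integral_eq_integral(1)[OF this]
      have "(\<lambda>s. \<bar>\<beta> s\<bar> * exp (c * (s - a))) integrable_on {a..b}"
        by (simp add: \<beta>0 mult.commute)
      then show ?thesis
        by (rule integrable_on_subinterval) (use t in auto)
    qed
    have comp: "norm (\<Phi> v t $ i - \<Phi> w t $ i) \<le> d * (\<theta> * exp (c * (t - a)))" for i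
    proof -
      have qi: "q v i integrable_on {a..t}" "q w i integrable_on {a..t}"
        using integrable_on_subinterval[OF set_lebesgue_integral_eq_integral(1)[OF qint[OF v]]]
          integrable_on_subinterval[OF set_lebesgue_integral_eq_integral(1)[OF qint[OF w]]] t by auto
      have "norm (\<Phi> v t $ i - \<Phi> w t $ i) = norm (integral {a..t} (\<lambda>s. q v i s - q w i s))"
        by (simp add: \<Phi>_def Henstock_Kurzweil_Integration.integral_diff[OF qi])
      also have "\<dots> \<le> integral {a..t} (\<lambda>s. d * (\<bar>\<beta> s\<bar> * exp (c * (s - a))))"
      proof (rule integral_norm_bound_integral[OF integrable_diff[OF qi] integrable_on_mult_right[OF \<beta>i]])
        fix s assume "s \<in> {a..t}"
        then have s: "s \<in> {a..b}"
          using t by auto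
        have "norm (q v i s - q w i s) = norm (\<Sum>l = 1..r. \<Sum>j\<in>UNIV. \<alpha> l i j s * (I l w j s - I l v j s))"
          by (simp add: q_def right_diff_distrib sum_subtractf)
        also have "\<dots> \<le> (\<Sum>l = 1..r. \<Sum>j\<in>UNIV. norm (\<alpha> l i j s) * (d * exp (c * (s - a))))"
          using Ile[OF s]
          by (intro sum_norm_le) (auto simp: norm_mult norm_minus_commute intro!: mult_left_mono)
        also have "\<dots> = (\<Sum>l = 1..r. \<Sum>j\<in>UNIV. norm (\<alpha> l i j s)) * (d * exp (c * (s - a)))"
          by (simp add: sum_distrib_right)
        also have "\<dots> \<le> \<beta> s * (d * exp (c * (s - a)))"
          unfolding \<beta>_def using \<open>0 \<le> d\<close>
          by (intro mult_right_mono member_le_sum) (auto intro!: sum_nonneg)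
        finally show "norm (q v i s - q w i s) \<le> d * (\<bar>\<beta> s\<bar> * exp (c * (s - a)))"
          using \<beta>0[of s] by (simp add: mult_ac)
      qed
      also have "\<dots> = d * integral {a..t} (\<lambda>s. \<bar>\<beta> s\<bar> * exp (c * (s - a)))"
        by simp
      also have "\<dots> \<le> d * (\<theta> * exp (c * (t - a)))"
        using c(2) t \<open>0 \<le> d\<close> by (intro mult_left_mono) auto
      finally show ?thesis .
    qed
    have "norm (\<Phi> v t - \<Phi> w t) \<le> (\<Sum>i\<in>UNIV. norm ((\<Phi> v t - \<Phi> w t) $ i))"
      by (rule norm_vec_le_sum)
    also have "\<dots> \<le> (\<Sum>i\<in>(UNIV :: 'm set). d * (\<theta> * exp (c * (t - a))))"
      using comp by (intro sum_mono) simp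
    also have "\<dots> = d / 2 * exp (c * (t - a))"
      by (simp add: \<theta>_def)
    finally show ?thesis .
  qed
  note fixpoint = weighted_contraction_fixpoint[where \<Phi> = \<Phi> and c = c, OF less_imp_le[OF ab]]
  have pow: "(prim ^^ l) U = cl (I l v j)" if U: "prim U = cl (\<lambda>t. v t $ j)" and l: "l \<in> {1..r}" for l U v j
  proof -
    obtain k where "l = Suc k"
      using l by (cases l) auto
    then show ?thesis
      using U by (simp add: I_def funpow_Suc_right iterated_prim_class del: funpow.simps)
  qed
  show "\<exists>u. solves u"
  proof -
    have "\<exists>v. continuous_on {a..b} v \<and> (\<forall>t\<in>{a..b}. v t = \<Phi> v t)"
      by (rule fixpoint(1)) (erule cont\<Phi>, rule contr, assumption+)
    then obtain v where v: "continuous_on {a..b} v" "\<forall>t\<in>{a..b}. v t = \<Phi> v t"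
      by (elim exE conjE) (rule that)
    define u :: "aefun ^ 'm" where "u = (\<chi> i. cl (q v i))"
    have u: "prim (u $ j) = cl (\<lambda>t. v t $ j)" for j
      unfolding u_def vec_lambda_beta prim_class
    proof (rule class_on_cong)
      fix t assume "t \<in> {a..b}"
      then have "v t $ j = \<Phi> v t $ j"
        using v(2) by simp
      then show "integral {a..t} (q v j) = v t $ j"
        by (simp add: \<Phi>_def)
    qed
    have "u $ i = G $ i - (\<Sum>l = 1..r. \<Sum>j\<in>UNIV. A l $ i $ j * (prim ^^ l) (u $ j))" for i
    proof -
      have "u $ i = G $ i - (\<Sum>l = 1..r. \<Sum>j\<in>UNIV. A l $ i $ j * cl (I l v j))"
        by (simp add: u_def qclass)
      also have "(\<Sum>l = 1..r. \<Sum>j\<in>UNIV. A l $ i $ j * cl (I l v j))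
          = (\<Sum>l = 1..r. \<Sum>j\<in>UNIV. A l $ i $ j * (prim ^^ l) (u $ j))"
        by (intro sum.cong refl arg_cong2[of _ _ _ _ "(*)"] pow[symmetric] u)
      finally show ?thesis .
    qed
    moreover have "u $ i \<in> L1" for i
      unfolding L1_iff u_def vec_lambda_beta using qint[OF v(1)] by blast
    ultimately show ?thesis
      unfolding solves_def by blast
  qed
  \<comment> \<open>Conversely, every solution u yields a fixed point, namely its primitive.\<close>
  have fixed: "\<exists>v. continuous_on {a..b} v \<and> (\<forall>t\<in>{a..b}. v t = \<Phi> v t) \<and> (\<forall>j. prim (u $ j) = cl (\<lambda>t. v t $ j))"
    if u: "solves u" for u
  proof -
    define f where "f i = (SOME f. f absolutely_integrable_on {a..b} \<and> u $ i = cl f)" for i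
    have f: "f i absolutely_integrable_on {a..b}" "u $ i = cl (f i)" for i
      using someI_ex[of "\<lambda>f. f absolutely_integrable_on {a..b} \<and> u $ i = cl f"] u
      unfolding solves_def L1_iff f_def by blast+
    define v :: "real \<Rightarrow> complex ^ 'm" where "v t = (\<chi> i. integral {a..t} (f i))" for t
    have v: "continuous_on {a..b} v"
      unfolding v_def by (intro continuous_on_vec_lambda continuous_on_prim f)
    have pv: "prim (u $ j) = cl (\<lambda>t. v t $ j)" for j
      by (simp add: f(2) prim_class v_def)
    have "u $ i = cl (q v i)" for i
    proof -
      have "u $ i = G $ i - (\<Sum>l = 1..r. \<Sum>j\<in>UNIV. A l $ i $ j * (prim ^^ l) (u $ j))"
        using u[unfolded solves_def, THEN conjunct2, rule_format, of i] .
      also have "(\<Sum>l = 1..r. \<Sum>j\<in>UNIV. A l $ i $ j * (prim ^^ l) (u $ j))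
          = (\<Sum>l = 1..r. \<Sum>j\<in>UNIV. A l $ i $ j * cl (I l v j))"
        by (intro sum.cong refl arg_cong2[of _ _ _ _ "(*)"] pow pv)
      finally show ?thesis
        by (simp add: qclass)
    qed
    then have "cl (\<lambda>t. v t $ i) = cl (\<lambda>t. \<Phi> v t $ i)" for i
      using pv[of i] by (simp add: prim_class \<Phi>_def)
    then have "v t $ i = \<Phi> v t $ i" if "t \<in> {a..b}" for t i
      using continuous_class_eq[OF contj[OF v] contj[OF cont\<Phi>[OF v]]] that by blast
    then show ?thesis
      using v pv by (auto simp: vec_eq_iff)
  qed
  show "u = u'" if u: "solves u" and u': "solves u'" for u u'
  proof -
    obtain v where v: "continuous_on {a..b} v" "\<forall>t\<in>{a..b}. v t = \<Phi> v t" "\<forall>j. prim (u $ j) = cl (\<lambda>t. v t $ j)"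
      using fixed[OF u] by (elim exE conjE) (rule that)
    obtain v' where v': "continuous_on {a..b} v'" "\<forall>t\<in>{a..b}. v' t = \<Phi> v' t" "\<forall>j. prim (u' $ j) = cl (\<lambda>t. v' t $ j)"
      using fixed[OF u'] by (elim exE conjE) (rule that)
    have "v t = v' t" if "t \<in> {a..b}" for t
      by (rule fixpoint(2)[OF _ _ v(1) v'(1) _ _ that])
        (erule cont\<Phi>, rule contr, assumption+, erule v(2)[rule_format], erule v'(2)[rule_format])
    \<comment> \<open>Uniqueness of v gives equality of J u and J u'. As the equation expresses u
      through J^l u with l \<ge> 1 only, this already determines u.\<close>
    then have prim_eq: "prim (u $ j) = prim (u' $ j)" for j
      unfolding v(3)[rule_format] v'(3)[rule_format] by (intro class_on_cong) simp
    have pow_eq: "(prim ^^ l) (u $ j) = (prim ^^ l) (u' $ j)" if l: "l \<in> {1..r}" for l j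
    proof -
      obtain k where "l = Suc k"
        using l by (cases l) auto
      then show ?thesis
        using prim_eq[of j] by (simp add: funpow_Suc_right del: funpow.simps)
    qed
    have "u $ i = u' $ i" for i
    proof -
      have "u $ i = G $ i - (\<Sum>l = 1..r. \<Sum>j\<in>UNIV. A l $ i $ j * (prim ^^ l) (u $ j))"
        using u[unfolded solves_def, THEN conjunct2, rule_format, of i] .
      also have "(\<Sum>l = 1..r. \<Sum>j\<in>UNIV. A l $ i $ j * (prim ^^ l) (u $ j))
          = (\<Sum>l = 1..r. \<Sum>j\<in>UNIV. A l $ i $ j * (prim ^^ l) (u' $ j))"
        by (intro sum.cong refl arg_cong2[of _ _ _ _ "(*)"] pow_eq)
      also have "G $ i - \<dots> = u' $ i"
        using u'[unfolded solves_def, THEN conjunct2, rule_format, of i] by (rule sym)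
      finally show ?thesis .
    qed
    then show "u = u'"
      by (rule vec_eq_iff[THEN iffD2, OF allI])
  qed
qed

end

section \<open>The differential operator\<close>

lemma scaleC_aefun_times_right: "c *\<^sub>C (x * y) = x * c *\<^sub>C (y :: aefun)"
  by transfer (simp add: mult_ac)

lemma diff_op_nth:
  "diff_op a b r A y $ i = nth_deriv a b r (y $ i) +
    (\<Sum>l = 1..r. \<Sum>j\<in>UNIV. A (r - l) $ i $ j * nth_deriv a b (r - l) (y $ j))"
  by (simp add: diff_op_def nth_deriv_vec_def matrix_vector_mult_def)

context sobolev_interval
begin

lemma sobolev_vec_subspace: "complex_vector.subspace (sobolev_vec p l a b :: (aefun ^ 'm) set)"
  by (simp add: complex_vector.subspace_def sobolev_vec_def scaleC_vec_def sobolev_zero sobolev_plus sobolev_scaleC)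

lemma sobolev_sum: "(\<And>i. i \<in> S \<Longrightarrow> f i \<in> W l) \<Longrightarrow> (\<Sum>i\<in>S. f i) \<in> W l"
  by (rule complex_vector.subspace_sum[OF sobolev_subspace])

lemma sobolev_diff: "X \<in> W l \<Longrightarrow> Y \<in> W l \<Longrightarrow> X - Y \<in> W l"
  by (rule complex_vector.subspace_diff[OF sobolev_subspace])

text \<open>Bootstrapping: each \<open>prim\<close> gains one derivative, which the coefficients preserve up to order \<open>n\<close>.\<close>

lemma volterra_regularity:
  fixes A :: "nat \<Rightarrow> aefun ^ 'm ^ 'm" and G u :: "aefun ^ 'm"
  assumes A: "\<And>l i j. l \<in> {1..r} \<Longrightarrow> A l $ i $ j \<in> W n" and G: "\<And>i. G $ i \<in> W n"
    and u: "\<And>i. u $ i \<in> L1"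
    and eq: "\<And>i. u $ i = G $ i - (\<Sum>l = 1..r. \<Sum>j\<in>UNIV. A l $ i $ j * (prim ^^ l) (u $ j))"
  shows "u $ i \<in> W n"
proof -
  have "\<forall>i. u $ i \<in> W s" if "s \<le> n" for s
    using that
  proof (induction s)
    case 0
    \<comment> \<open>At the start u is only in L_1, but J^l u has a continuous representative, so
      the product with a coefficient in L_p is in L_p.\<close>
    have summand: "A l $ i $ j * (prim ^^ l) (u $ j) \<in> W 0" if l: "l \<in> {1..r}" for l i j
    proof -
      obtain f where f: "f absolutely_integrable_on {a..b}" "u $ j = cl f"
        using u[of j] unfolding L1_iff by auto
      obtain k where "l = Suc k"
        using l by (cases l) auto
      then have "(prim ^^ l) (u $ j) = (prim ^^ k) (cl (\<lambda>t. integral {a..t} f))"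
        by (simp add: funpow_Suc_right f(2) prim_class del: funpow.simps)
      also have "\<dots> = cl ((antideriv ^^ k) (\<lambda>t. integral {a..t} f))"
        by (rule iterated_prim_class)
      finally show ?thesis
        using Lp_times_continuous(1)[OF subsetD[OF sobolev_subset_Lp A[OF l]]
            continuous_on_iterated_antideriv[OF continuous_on_prim[OF f(1)], of k], of i j]
        by (simp add: sobolev_0)
    qed
    have "G $ i \<in> W 0" for i
      using G[of i] sobolev_mono[of 0 n] by auto
    then have "G $ i - (\<Sum>l = 1..r. \<Sum>j\<in>UNIV. A l $ i $ j * (prim ^^ l) (u $ j)) \<in> W 0" for i
      by (intro sobolev_diff sobolev_sum summand)
    then show ?case
      unfolding eq[symmetric] by blast
  next
    case (Suc s)
    have summand: "A l $ i $ j * (prim ^^ l) (u $ j) \<in> W (Suc s)" if l: "l \<in> {1..r}" for l i j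
    proof (rule nth_deriv_1_times(1))
      show "A l $ i $ j \<in> W (Suc s)"
        using A[OF l] sobolev_mono[OF Suc.prems] by blast
      have "(prim ^^ l) (u $ j) \<in> W (s + l)"
        using Suc by (intro iterated_prim_in_sobolev) simp
      then show "(prim ^^ l) (u $ j) \<in> W (Suc s)"
        using sobolev_mono[of "Suc s" "s + l"] l by auto
    qed
    have "G $ i \<in> W (Suc s)" for i
      using G[of i] sobolev_mono[OF Suc.prems] by auto
    then have "G $ i - (\<Sum>l = 1..r. \<Sum>j\<in>UNIV. A l $ i $ j * (prim ^^ l) (u $ j)) \<in> W (Suc s)" for i
      by (intro sobolev_diff sobolev_sum summand)
    then show ?case
      unfolding eq[symmetric] by blast
  qed
  then show ?thesis
    by blast
qed

section \<open>Mapping properties of L and its initial value problem\<close>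

context
  fixes A :: "nat \<Rightarrow> aefun ^ 'm ^ 'm" and n r :: nat
  assumes A: "\<And>l. l \<in> {1..r} \<Longrightarrow> A (r - l) \<in> sobolev_mat p n a b"
begin

abbreviation "L \<equiv> diff_op a b r A"
abbreviation "V l \<equiv> sobolev_vec p l a b :: (aefun ^ 'm) set"

lemma coeff: "l \<in> {1..r} \<Longrightarrow> A (r - l) $ i $ j \<in> W n"
  using A by (simp add: sobolev_mat_def)

lemma V_D: "y \<in> V l \<Longrightarrow> y $ i \<in> W l"
  by (simp add: sobolev_vec_def)

text \<open>Since l \<ge> 1, the derivative of order r - l keeps at least order n + 1, which is the
  surplus that multiplication by a coefficient of order n consumes.\<close>

lemma nth_deriv_lower:
  assumes "Y \<in> W (n + r)" "l \<in> {1..r}"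
  shows "nd (r - l) Y \<in> W (Suc n)" "N (Suc n) (nd (r - l) Y) \<le> N (n + r) Y"
proof -
  have nr: "n + r = (n + l) + (r - l)"
    using assms(2) by simp
  have mem: "nd (r - l) Y \<in> W (n + l)"
    using assms(1) unfolding nr by (rule nth_deriv_mem)
  then show "nd (r - l) Y \<in> W (Suc n)"
    using sobolev_mono[of "Suc n" "n + l"] assms(2) by auto
  have "N (Suc n) (nd (r - l) Y) \<le> N (n + l) (nd (r - l) Y)"
    using assms(2) by (intro sobolev_norm_mono[OF mem]) auto
  also have "\<dots> \<le> N (n + r) Y"
    using assms(1) unfolding nr by (rule sobolev_norm_nth_deriv)
  finally show "N (Suc n) (nd (r - l) Y) \<le> N (n + r) Y" .
qed

lemma diff_op_summand_mem:
  assumes "l \<in> {1..r}" "y \<in> V (n + r)"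
  shows "A (r - l) $ i $ j * nd (r - l) (y $ j) \<in> W n"
  by (rule sobolev_times[OF coeff[OF assms(1)] nth_deriv_lower(1)[OF V_D[OF assms(2)] assms(1)]])

lemma diff_op_mem:
  assumes y: "y \<in> V (n + r)"
  shows "L y \<in> V n"
proof -
  have "L y $ i \<in> W n" for i
    unfolding diff_op_nth
    by (rule sobolev_plus[OF nth_deriv_mem[OF V_D[OF y]] sobolev_sum[OF sobolev_sum[OF diff_op_summand_mem[OF _ y]]]])
  then show ?thesis
    by (simp add: sobolev_vec_def)
qed

lemma diff_op_plus:
  assumes x: "x \<in> V (n + r)" and y: "y \<in> V (n + r)"
  shows "L (x + y) = L x + L y"
proof -
  have "L (x + y) $ i = (L x + L y) $ i" for i
    by (simp add: diff_op_nth nth_deriv_plus[OF V_D[OF x] V_D[OF y]] distrib_left sum.distrib)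
  then show ?thesis
    by (rule vec_eq_iff[THEN iffD2, OF allI])
qed

lemma diff_op_scaleC:
  assumes x: "x \<in> V (n + r)"
  shows "L (c *\<^sub>C x) = c *\<^sub>C L x"
proof -
  have "L (c *\<^sub>C x) $ i = (c *\<^sub>C L x) $ i" for i
    by (simp add: scaleC_vec_def diff_op_nth nth_deriv_scaleC[OF V_D[OF x]] scaleC_add_right
        complex_vector.scale_sum_right scaleC_aefun_times_right)
  then show ?thesis
    by (rule vec_eq_iff[THEN iffD2, OF allI])
qed

text \<open>With a quasi-norm the constant grows by a factor 4 at each addition, which is harmless
  for finite sums.\<close>

lemma sobolev_norm_sum_bound:
  assumes "finite S"
    and "\<And>s. s \<in> S \<Longrightarrow> \<exists>K. \<forall>y\<in>V (n + r). N n (f s y) \<le> K * sobolev_vec_norm p (n + r) a b y"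
    and "\<And>s y. s \<in> S \<Longrightarrow> y \<in> V (n + r) \<Longrightarrow> f s y \<in> W n"
  shows "\<exists>K. \<forall>y\<in>V (n + r). N n (\<Sum>s\<in>S. f s y) \<le> K * sobolev_vec_norm p (n + r) a b y"
  using assms
proof (induction S rule: finite_induct)
  case empty
  \<comment> \<open>The estimate for products with a continuous factor, applied with factor 0 and
    bound 0.\<close>
  have "Lp_norm p a b 0 = 0"
    using Lp_times_continuous(2)[of 0 "\<lambda>_. 0" 0] sobolev_zero[of 0] Lp_norm_nonneg[of 0]
    by (simp add: sobolev_0)
  moreover have "nd s 0 = 0" if "s \<le> n" for s
    using nth_deriv_scaleC[OF sobolev_zero that, of 0] by simp
  ultimately have "N n 0 = 0"
    by (simp add: sobolev_norm_def)
  then show ?case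
    by (intro exI[of _ 0]) simp
next
  case (insert s S)
  obtain K1 where K1: "\<forall>y\<in>V (n + r). N n (f s y) \<le> K1 * sobolev_vec_norm p (n + r) a b y"
    using insert.prems(1)[of s] by auto
  obtain K2 where K2: "\<forall>y\<in>V (n + r). N n (\<Sum>s\<in>S. f s y) \<le> K2 * sobolev_vec_norm p (n + r) a b y"
    using insert.IH insert.prems by auto
  have "N n (\<Sum>s\<in>insert s S. f s y) \<le> (4 * (K1 + K2)) * sobolev_vec_norm p (n + r) a b y"
    if y: "y \<in> V (n + r)" for y
  proof -
    have "N n (f s y + (\<Sum>s\<in>S. f s y)) \<le> 4 * (N n (f s y) + N n (\<Sum>s\<in>S. f s y))"
      using insert.prems(2) y by (intro sobolev_norm_plus sobolev_sum) auto
    also have "\<dots> \<le> 4 * (K1 * sobolev_vec_norm p (n + r) a b y + K2 * sobolev_vec_norm p (n + r) a b y)"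
      using K1 K2 y by (intro mult_left_mono add_mono) auto
    finally show ?thesis
      using insert.hyps by (simp add: algebra_simps)
  qed
  then show ?case
    by blast
qed

lemma sobolev_norm_component_le:
  assumes "y \<in> V l"
  shows "N l (y $ i) \<le> sobolev_vec_norm p l a b y"
  unfolding sobolev_vec_norm_def
  by (rule member_le_sum) (simp_all add: sobolev_norm_nonneg V_D[OF assms])

lemma diff_op_bounded:
  "\<exists>K. \<forall>y\<in>V (n + r). sobolev_vec_norm p n a b (L y) \<le> K * sobolev_vec_norm p (n + r) a b y"
proof -
  have summand: "\<exists>K. \<forall>y\<in>V (n + r). N n (A (r - l) $ i $ j * nd (r - l) (y $ j)) \<le> K * sobolev_vec_norm p (n + r) a b y"
    if l: "l \<in> {1..r}" for l i j
  proof -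
    obtain K where K: "0 \<le> K" "\<forall>Y\<in>W (Suc n). N n (A (r - l) $ i $ j * Y) \<le> K * N (Suc n) Y"
      using sobolev_times_bound[OF coeff[OF l, of i j]] by (elim exE conjE) (rule that)
    have "N n (A (r - l) $ i $ j * nd (r - l) (y $ j)) \<le> K * sobolev_vec_norm p (n + r) a b y"
      if y: "y \<in> V (n + r)" for y
    proof -
      have "N n (A (r - l) $ i $ j * nd (r - l) (y $ j)) \<le> K * N (Suc n) (nd (r - l) (y $ j))"
        using K(2) nth_deriv_lower(1)[OF V_D[OF y] l] by blast
      also have "\<dots> \<le> K * sobolev_vec_norm p (n + r) a b y"
        by (rule mult_left_mono[OF order_trans[OF nth_deriv_lower(2)[OF V_D[OF y] l] sobolev_norm_component_le[OF y]] K(1)])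
      finally show ?thesis .
    qed
    then show ?thesis
      by blast
  qed
  have "\<exists>K. \<forall>y\<in>V (n + r). N n (L y $ i) \<le> K * sobolev_vec_norm p (n + r) a b y" for i
  proof -
    have inner: "\<exists>K. \<forall>y\<in>V (n + r). N n (\<Sum>j\<in>UNIV. A (r - l) $ i $ j * nd (r - l) (y $ j))
        \<le> K * sobolev_vec_norm p (n + r) a b y" if l: "l \<in> {1..r}" for l
      by (rule sobolev_norm_sum_bound) (simp, rule summand[OF l], rule diff_op_summand_mem[OF l])
    have "\<exists>K. \<forall>y\<in>V (n + r). N n (\<Sum>l = 1..r. \<Sum>j\<in>UNIV. A (r - l) $ i $ j * nd (r - l) (y $ j))
        \<le> K * sobolev_vec_norm p (n + r) a b y"
      by (rule sobolev_norm_sum_bound) (simp, erule inner, rule sobolev_sum, erule diff_op_summand_mem)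
    then obtain K where K: "\<forall>y\<in>V (n + r). N n (\<Sum>l = 1..r. \<Sum>j\<in>UNIV. A (r - l) $ i $ j * nd (r - l) (y $ j))
        \<le> K * sobolev_vec_norm p (n + r) a b y"
      by (rule exE)
    have "N n (L y $ i) \<le> (4 * (1 + K)) * sobolev_vec_norm p (n + r) a b y" if y: "y \<in> V (n + r)" for y
    proof -
      let ?S = "\<Sum>l = 1..r. \<Sum>j\<in>UNIV. A (r - l) $ i $ j * nd (r - l) (y $ j)"
      have "N n (L y $ i) \<le> 4 * (N n (nd r (y $ i)) + N n ?S)"
        unfolding diff_op_nth
        by (rule sobolev_norm_plus[OF nth_deriv_mem[OF V_D[OF y]]
              sobolev_sum[OF sobolev_sum[OF diff_op_summand_mem[OF _ y]]]])
      also have "\<dots> \<le> 4 * (sobolev_vec_norm p (n + r) a b y + K * sobolev_vec_norm p (n + r) a b y)"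
        by (intro mult_left_mono add_mono order_trans[OF sobolev_norm_nth_deriv[OF V_D[OF y]] sobolev_norm_component_le[OF y]]
            K[rule_format, OF y]) simp
      finally show ?thesis
        by (simp add: algebra_simps)
    qed
    then show ?thesis
      by blast
  qed
  then have "\<exists>K. \<forall>i. \<forall>y\<in>V (n + r). N n (L y $ i) \<le> K i * sobolev_vec_norm p (n + r) a b y"
    by (intro choice allI)
  then obtain K where K: "\<forall>i. \<forall>y\<in>V (n + r). N n (L y $ i) \<le> K i * sobolev_vec_norm p (n + r) a b y"
    by (rule exE)
  have "sobolev_vec_norm p n a b (L y) \<le> (\<Sum>i\<in>UNIV. K i) * sobolev_vec_norm p (n + r) a b y"
    if y: "y \<in> V (n + r)" for y
  proof -
    have "sobolev_vec_norm p n a b (L y) \<le> (\<Sum>i\<in>UNIV. K i * sobolev_vec_norm p (n + r) a b y)"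
      unfolding sobolev_vec_norm_def[of p n] using K y by (intro sum_mono) auto
    then show ?thesis
      by (simp add: sum_distrib_right)
  qed
  then show ?thesis
    by blast
qed

text \<open>On y = J^r u the derivative of order r - l is J^l u, so L turns into the identity plus a
  Volterra operator.\<close>

lemma diff_op_iterated_prim:
  assumes "\<And>j. u $ j \<in> W n"
  shows "L (\<chi> j. (prim ^^ r) (u $ j)) $ i = u $ i + (\<Sum>l = 1..r. \<Sum>j\<in>UNIV. A (r - l) $ i $ j * (prim ^^ l) (u $ j))"
proof -
  have "nd (r - l) ((prim ^^ r) (u $ j)) = (prim ^^ l) (u $ j)" if "l \<in> {1..r}" for l j
    using nth_deriv_iterated_prim[OF assms, of "r - l" r j] that by simp
  moreover have "nd r ((prim ^^ r) (u $ i)) = u $ i"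
    using nth_deriv_iterated_prim[OF assms, of r r i] by simp
  ultimately show ?thesis
    unfolding diff_op_nth by simp
qed

text \<open>Existence corrects y0, which has the right initial values, by J^r u with u solving the
  equation for f - L y0. For uniqueness, a difference z of solutions has zero initial values, so z =
  J^r u with u its r-th derivative, and u solves the homogeneous equation.\<close>

lemma initial_value_problem:
  assumes f: "f \<in> V n"
  shows "\<exists>!y. y \<in> V (n + r) \<and> L y = f \<and> (\<forall>s<r. \<forall>j. init (nd s (y $ j)) = c s j)"
proof (rule ex_ex1I)
  have AL1: "l \<in> {1..r} \<Longrightarrow> A (r - l) $ i $ j \<in> L1" for l i j
    using coeff sobolev_subset_L1 by blast
  have "\<forall>j. \<exists>Y. Y \<in> W (n + r) \<and> (\<forall>s<r. init (nd s Y) = c s j)"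
  proof
    fix j
    show "\<exists>Y. Y \<in> W (n + r) \<and> (\<forall>s<r. init (nd s Y) = c s j)"
      \<comment> \<open>The r-th derivative is prescribed as 0, so Y is the Taylor polynomial of the
        given initial values.\<close>
      using initial_values_exist[OF sobolev_zero, of n r "\<lambda>s. c s j"] by auto
  qed
  from choice[OF this] obtain Y0 where Y0: "\<And>j. Y0 j \<in> W (n + r)" "\<And>s j. s < r \<Longrightarrow> init (nd s (Y0 j)) = c s j"
    by auto
  define y0 :: "aefun ^ 'm" where "y0 = (\<chi> j. Y0 j)"
  have y0: "y0 \<in> V (n + r)"
    using Y0(1) by (simp add: y0_def sobolev_vec_def)
  define G where "G = f - L y0"
  have G: "G $ i \<in> W n" for i
    using V_D[OF f] V_D[OF diff_op_mem[OF y0]] by (simp add: G_def sobolev_diff)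
  have GL1: "G $ i \<in> L1" for i
    using G sobolev_subset_L1 by blast
  obtain u :: "aefun ^ 'm" where u: "\<forall>i. u $ i \<in> L1"
    "\<forall>i. u $ i = G $ i - (\<Sum>l = 1..r. \<Sum>j\<in>UNIV. A (r - l) $ i $ j * (prim ^^ l) (u $ j))"
  proof -
    have "\<exists>u. (\<forall>i. u $ i \<in> L1) \<and>
        (\<forall>i. u $ i = G $ i - (\<Sum>l = 1..r. \<Sum>j\<in>UNIV. A (r - l) $ i $ j * (prim ^^ l) (u $ j)))"
      by (rule volterra_unique_solution(1)[of r "\<lambda>l. A (r - l)" G]) (erule AL1, rule GL1)
    then show ?thesis
      by (elim exE conjE) (rule that)
  qed
  have uW: "u $ i \<in> W n" for i
    by (rule volterra_regularity[of r "\<lambda>l. A (r - l)" n G])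
      (erule coeff, rule G, rule u(1)[rule_format], rule u(2)[rule_format])
  define z :: "aefun ^ 'm" where "z = (\<chi> j. (prim ^^ r) (u $ j))"
  have z: "z \<in> V (n + r)"
    using iterated_prim_in_sobolev[OF uW] by (simp add: z_def sobolev_vec_def)
  have "L z $ i = G $ i" for i
    unfolding z_def diff_op_iterated_prim[OF uW]
    using u(2)[rule_format, of i] by (simp only: eq_diff_eq)
  then have "L z = G"
    by (rule vec_eq_iff[THEN iffD2, OF allI])
  then have "L (y0 + z) = f"
    using diff_op_plus[OF y0 z] by (simp add: G_def)
  moreover have "init (nd s ((y0 + z) $ j)) = c s j" if s: "s < r" for s j
  proof -
    \<comment> \<open>Because s < r, the order n + r - s is a successor, as additivity of
      \<open>init\<close> requires.\<close>
    have mem: "nd s (Y0 j) \<in> W (Suc (n + r - Suc s))" "nd s (z $ j) \<in> W (Suc (n + r - Suc s))"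
      using s by (auto intro!: nth_deriv_mem simp: Y0(1) V_D[OF z])
    have "nd s ((y0 + z) $ j) = nd s (Y0 j) + nd s (z $ j)"
      using nth_deriv_plus[OF Y0(1) V_D[OF z], of s j j] s by (simp add: y0_def)
    then show ?thesis
      using init_plus[OF mem] Y0(2)[OF s] init_nth_deriv_iterated_prim[OF uW s] by (simp add: z_def)
  qed
  moreover have "y0 + z \<in> V (n + r)"
    using complex_vector.subspace_add[OF sobolev_vec_subspace y0 z] .
  ultimately show "\<exists>y. y \<in> V (n + r) \<and> L y = f \<and> (\<forall>s<r. \<forall>j. init (nd s (y $ j)) = c s j)"
    by (intro exI[of _ "y0 + z"]) simp
next
  have AL1: "l \<in> {1..r} \<Longrightarrow> A (r - l) $ i $ j \<in> L1" for l i j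
    using coeff sobolev_subset_L1 by blast
  have 0: "(0 :: aefun ^ 'm) $ i \<in> L1" for i
    using sobolev_zero[of 0] sobolev_subset_L1[of 0] by auto
  fix x y
  assume x: "x \<in> V (n + r) \<and> L x = f \<and> (\<forall>s<r. \<forall>j. init (nd s (x $ j)) = c s j)"
    and y: "y \<in> V (n + r) \<and> L y = f \<and> (\<forall>s<r. \<forall>j. init (nd s (y $ j)) = c s j)"
  define z where "z = x - y"
  have z: "z \<in> V (n + r)"
    unfolding z_def using x y by (intro complex_vector.subspace_diff[OF sobolev_vec_subspace]) auto
  have yz: "y + z = x"
    by (simp add: z_def)
  have "L z = 0"
    using diff_op_plus[of y z] x y z unfolding yz by simp
  have init0: "init (nd s (z $ j)) = 0" if s: "s < r" for s j
  proof -
    have mem: "nd s (y $ j) \<in> W (Suc (n + r - Suc s))" "nd s (z $ j) \<in> W (Suc (n + r - Suc s))"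
      using s y z by (auto intro!: nth_deriv_mem V_D)
    have "nd s (x $ j) = nd s (y $ j) + nd s (z $ j)"
      using nth_deriv_plus[of "y $ j" "n + r" "z $ j" s] s y z unfolding yz[symmetric] by (simp add: V_D)
    then have "init (nd s (x $ j)) = init (nd s (y $ j)) + init (nd s (z $ j))"
      using init_plus[OF mem] by simp
    moreover have "init (nd s (x $ j)) = c s j" "init (nd s (y $ j)) = c s j"
      using x y s by simp_all
    ultimately show ?thesis
      by simp
  qed
  define u :: "aefun ^ 'm" where "u = (\<chi> j. nd r (z $ j))"
  have uW: "u $ j \<in> W n" for j
    using nth_deriv_mem[OF V_D[OF z]] by (simp add: u_def)
  have zu: "z $ j = (prim ^^ r) (u $ j)" for j
    using eq_iterated_prim[OF V_D[OF z]] init0 by (simp add: u_def)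
  then have "z = (\<chi> j. (prim ^^ r) (u $ j))"
    by (simp add: vec_eq_iff)
  then have "u $ i + (\<Sum>l = 1..r. \<Sum>j\<in>UNIV. A (r - l) $ i $ j * (prim ^^ l) (u $ j)) = 0" for i
    using diff_op_iterated_prim[OF uW, of i] \<open>L z = 0\<close> by simp
  then have u: "u $ i = (0 :: aefun ^ 'm) $ i - (\<Sum>l = 1..r. \<Sum>j\<in>UNIV. A (r - l) $ i $ j * (prim ^^ l) (u $ j))" for i
    unfolding zero_index diff_0 eq_neg_iff_add_eq_0 .
  have prim0: "(prim ^^ l) 0 = 0" for l
    by (induction l) (simp_all add: prim_0)
  \<comment> \<open>Both u and the zero vector solve the equation with G = 0.\<close>
  have "u = 0"
  proof (rule volterra_unique_solution(2)[of r "\<lambda>l. A (r - l)" 0])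
    show "A (r - l) $ i $ j \<in> L1" if "l \<in> {1..r}" for l i j
      using that by (rule AL1)
    show "(0 :: aefun ^ 'm) $ i \<in> L1" for i
      by (rule 0)
    show "(\<forall>i. u $ i \<in> L1) \<and> (\<forall>i. u $ i = 0 $ i - (\<Sum>l = 1..r. \<Sum>j\<in>UNIV. A (r - l) $ i $ j * (prim ^^ l) (u $ j)))"
      using u subsetD[OF sobolev_subset_L1 uW] by (intro conjI allI)
    show "(\<forall>i. 0 $ i \<in> L1) \<and> (\<forall>i. 0 $ i = 0 $ i - (\<Sum>l = 1..r. \<Sum>j\<in>UNIV. A (r - l) $ i $ j * (prim ^^ l) (0 $ j)))"
      using 0 by (simp add: prim0)
  qed
  then have "z = 0"
    using zu by (simp add: vec_eq_iff prim0)
  then show "x = y"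
    by (simp add: z_def)
qed

end

end

section \<open>The Fredholm property of the boundary-value problem\<close>

theorem theorem2:
  fixes a b :: real and n r :: nat and p :: ennreal
    and A :: "nat \<Rightarrow> aefun ^ 'm ^ 'm"
    and B :: "aefun ^ 'm \<Rightarrow> complex ^ 'k"
  assumes "a < b" and "1 \<le> r" and "1 \<le> p"
    and "CARD('k) = r * CARD('m)"
    and "\<And>l. l \<in> {1..r} \<Longrightarrow> A (r - l) \<in> sobolev_mat p n a b"
    and "bounded_linear_betw (sobolev_vec p (n + r) a b) (sobolev_vec_norm p (n + r) a b)
           UNIV norm B"
  shows "fredholm (sobolev_vec p (n + r) a b) (sobolev_vec_norm p (n + r) a b)
           (sobolev_vec p n a b \<times> UNIV) (prod_norm (sobolev_vec_norm p n a b) norm)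
           (\<lambda>y. (diff_op a b r A y, B y))
       \<and> fredholm_index (sobolev_vec p (n + r) a b) (sobolev_vec p n a b \<times> UNIV)
           (\<lambda>y. (diff_op a b r A y, B y)) = 0"
proof -
  interpret sobolev_interval a b p
    by unfold_locales (use assms in auto)
  let ?V = "\<lambda>l. sobolev_vec p l a b :: (aefun ^ 'm) set" and ?L = "diff_op a b r A"
  have mem: "?L y \<in> ?V n" if "y \<in> ?V (n + r)" for y
    by (rule diff_op_mem) (erule assms(5), rule that)
  have plus: "?L (x + y) = ?L x + ?L y" if "x \<in> ?V (n + r)" "y \<in> ?V (n + r)" for x y
    by (rule diff_op_plus) (erule assms(5), rule that, rule that)
  have scale: "?L (c *\<^sub>C x) = c *\<^sub>C ?L x" if "x \<in> ?V (n + r)" for c x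
    by (rule diff_op_scaleC) (erule assms(5), rule that)
  have B_plus: "B (x + y) = B x + B y" if "x \<in> ?V (n + r)" "y \<in> ?V (n + r)" for x y
    using assms(6) that by (simp add: bounded_linear_betw_def)
  have B_scale: "B (c *\<^sub>C x) = c *\<^sub>C B x" if "x \<in> ?V (n + r)" for c x
    using assms(6) that by (simp add: bounded_linear_betw_def)
  obtain KB where KB: "\<forall>x\<in>?V (n + r). norm (B x) \<le> KB * sobolev_vec_norm p (n + r) a b x"
    using assms(6) unfolding bounded_linear_betw_def by auto
  obtain KL where KL: "\<forall>y\<in>?V (n + r). sobolev_vec_norm p n a b (?L y) \<le> KL * sobolev_vec_norm p (n + r) a b y"
  proof -
    have "\<exists>K. \<forall>y\<in>?V (n + r). sobolev_vec_norm p n a b (?L y) \<le> K * sobolev_vec_norm p (n + r) a b y"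
      by (rule diff_op_bounded) (erule assms(5))
    then show ?thesis
      by (elim exE) (rule that)
  qed
  \<comment> \<open>The r m initial values are indexed by pairs (s, j); \<phi> renumbers them by the
    index type of the boundary values, so that \<Lambda> and B share the target C^(rm).\<close>
  have "card (UNIV :: 'k set) = card ({..<r} \<times> (UNIV :: 'm set))"
    using assms(4) by (simp add: card_cartesian_product)
  then obtain \<phi> where \<phi>: "bij_betw \<phi> (UNIV :: 'k set) ({..<r} \<times> (UNIV :: 'm set))"
    using finite_same_card_bij[of "UNIV :: 'k set" "{..<r} \<times> (UNIV :: 'm set)"] by auto
  have \<phi>r: "fst (\<phi> k) < r" for k
    using bij_betwE[OF \<phi>] by (auto simp: mem_Times_iff)
  define \<Lambda> :: "aefun ^ 'm \<Rightarrow> complex ^ 'k" where "\<Lambda> y = (\<chi> k. init (nd (fst (\<phi> k)) (y $ snd (\<phi> k))))" for y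
  have mem\<Lambda>: "nd (fst (\<phi> k)) (y $ j) \<in> W (Suc (n + r - Suc (fst (\<phi> k))))" if "y \<in> ?V (n + r)" for y k j
    using that \<phi>r[of k] by (intro nth_deriv_mem) (simp add: sobolev_vec_def)
  have \<Lambda>_plus: "\<Lambda> (x + y) = \<Lambda> x + \<Lambda> y" if x: "x \<in> ?V (n + r)" and y: "y \<in> ?V (n + r)" for x y
  proof -
    have "nd (fst (\<phi> k)) (x $ j + y $ j) = nd (fst (\<phi> k)) (x $ j) + nd (fst (\<phi> k)) (y $ j)" for k j
      using x y \<phi>r[of k] by (intro nth_deriv_plus[of _ "n + r"]) (auto simp: sobolev_vec_def)
    then show ?thesis
      by (simp add: \<Lambda>_def vec_eq_iff init_plus[OF mem\<Lambda>[OF x] mem\<Lambda>[OF y]])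
  qed
  have \<Lambda>_scale: "\<Lambda> (c *\<^sub>C x) = c *\<^sub>C \<Lambda> x" if x: "x \<in> ?V (n + r)" for c x
  proof -
    have "nd (fst (\<phi> k)) (c *\<^sub>C x $ j) = c *\<^sub>C nd (fst (\<phi> k)) (x $ j)" for k j
      using x \<phi>r[of k] by (intro nth_deriv_scaleC[of _ "n + r"]) (auto simp: sobolev_vec_def)
    then show ?thesis
      by (simp add: \<Lambda>_def vec_eq_iff scaleC_vec_def scaleC_complex_def init_scaleC[OF mem\<Lambda>[OF x]])
  qed
  have bij: "\<exists>!x. x \<in> ?V (n + r) \<and> ?L x = f \<and> \<Lambda> x = c" if f: "f \<in> ?V n" for f c
  proof -
    \<comment> \<open>The vector c read back as a table of initial values; entries with s \<ge> r
      are arbitrary and never consulted.\<close>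
    define c' where "c' s j = c $ inv_into UNIV \<phi> (s, j)" for s j
    have "\<Lambda> x = c \<longleftrightarrow> (\<forall>s<r. \<forall>j. init (nd s (x $ j)) = c' s j)" for x
    proof
      assume \<Lambda>: "\<Lambda> x = c"
      show "\<forall>s<r. \<forall>j. init (nd s (x $ j)) = c' s j"
      proof (intro allI impI)
        fix s j assume "s < r"
        then have "\<phi> (inv_into UNIV \<phi> (s, j)) = (s, j)"
          using \<phi> by (intro f_inv_into_f) (auto simp: bij_betw_def)
        then show "init (nd s (x $ j)) = c' s j"
          unfolding c'_def \<Lambda>[symmetric] \<Lambda>_def by simp
      qed
    next
      assume c': "\<forall>s<r. \<forall>j. init (nd s (x $ j)) = c' s j"
      have "inv_into UNIV \<phi> (\<phi> k) = k" for k
        using \<phi> by (intro inv_into_f_f) (auto simp: bij_betw_def)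
      then show "\<Lambda> x = c"
        using c' \<phi>r by (simp add: \<Lambda>_def vec_eq_iff c'_def)
    qed
    moreover have "\<exists>!x. x \<in> ?V (n + r) \<and> ?L x = f \<and> (\<forall>s<r. \<forall>j. init (nd s (x $ j)) = c' s j)"
      by (rule initial_value_problem) (erule assms(5), rule f)
    ultimately show ?thesis
      by simp
  qed
  note hyps = sobolev_vec_subspace plus scale mem \<Lambda>_plus \<Lambda>_scale B_plus B_scale bij
  have alternative: "\<exists>S. finite S \<and> kernel_on (?V (n + r)) (\<lambda>y. (?L y, B y)) \<subseteq> complex_vector.span S"
    "quotient_finite_dim (?V n \<times> UNIV) ((\<lambda>y. (?L y, B y)) ` ?V (n + r))"
    "fredholm_index (?V (n + r)) (?V n \<times> UNIV) (\<lambda>y. (?L y, B y)) = 0"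
    by (rule fredholm_index_zero_if_bijective[where F = "?V n" and \<Lambda> = \<Lambda>]; (rule hyps; assumption))+
  have "bounded_linear_betw (?V (n + r)) (sobolev_vec_norm p (n + r) a b) (?V n \<times> UNIV)
      (prod_norm (sobolev_vec_norm p n a b) norm) (\<lambda>y. (?L y, B y))"
    unfolding bounded_linear_betw_def
  proof (intro conjI ballI allI)
    show "(\<lambda>y. (?L y, B y)) ` ?V (n + r) \<subseteq> ?V n \<times> UNIV"
      using mem by auto
    show "(?L (x + y), B (x + y)) = (?L x, B x) + (?L y, B y)" if "x \<in> ?V (n + r)" "y \<in> ?V (n + r)" for x y
      using that by (simp add: plus B_plus)
    show "(?L (c *\<^sub>C x), B (c *\<^sub>C x)) = c *\<^sub>C (?L x, B x)" if "x \<in> ?V (n + r)" for c x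
      using scale[OF that] B_scale[OF that] by (simp add: scaleC_prod_def)
    show "\<exists>K. \<forall>x\<in>?V (n + r). prod_norm (sobolev_vec_norm p n a b) norm (?L x, B x) \<le> K * sobolev_vec_norm p (n + r) a b x"
      using KL KB by (intro exI[of _ "KL + KB"]) (simp add: prod_norm_def distrib_right add_mono)
  qed
  then show ?thesis
    using alternative by (simp add: fredholm_def)
qed

end
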